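(* There is a polynomial-time randomized offline algorithm that returns, for every $k$-gossip instance (on $n$ nodes), a broadcast schedule of length $O\left(n\min\{k,\sqrt{k\log n}\}\right)$, with high probability.
   Context: $k$-gossip: there are $n$ nodes and $k$ distinct tokens that are initially present in some nodes; the goal is to disseminate all $k$ tokens to all $n$ nodes. Communication proceeds in synchronous rounds; nodes only store, copy and forward tokens, and in a round a node can send only tokens it held at the start of the round. An offline algorithm for $k$-gossip takes as input an initial token distribution and a sequence of $nk$ graphs $G_1,\dots,G_{nk}$ on the $n$ nodes, each of them connected, where $G_t$ represents the communication network in round $t$. The output of the algorithm is a schedule that specifies, for each $t$ and each edge $e$ of $G_t$, a token (if any) sent along $e$ in each direction. The length of the schedule is the largest $t$ for which a token is sent on any edge in round $t$. A broadcast schedule is one in which each node can only broadcast a single token to all of its neighbors in each round.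
   Formalization: The length bound is proved for k ≤ n: for unrestricted k it fails, since with n = 2 and all k tokens at one node at least k rounds are needed, while the claimed bound is O(√k). *)

theory Defs
  imports "HOL-Probability.Probability" "HOL-Computational_Algebra.Polynomial"
begin

section \<open>k-gossip in a dynamic network\<close>

text \<open>
  The nodes are \<open>{..<n}\<close> and the tokens are \<open>{..<k}\<close>. A token may initially be present in several
  nodes. Round \<open>t\<close>, for \<open>t \<in> {1..n * k}\<close>, takes place on the graph whose set of edges, each listed
  in both directions, is \<open>net t\<close>. Nothing outside these ranges matters.
\<close>

record gossip =
  nodes :: nat
  tokens :: nat
  init :: "nat \<Rightarrow> nat set"
  net :: "nat \<Rightarrow> nat rel"

definition connected_graph :: "nat \<Rightarrow> nat rel \<Rightarrow> bool" where
  "connected_graph n E \<longleftrightarrow> E \<subseteq> {..<n} \<times> {..<n} \<and> sym E \<and> irrefl E \<and>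
     (\<forall>u<n. \<forall>v<n. (u, v) \<in> E\<^sup>*)"

definition gossip_instance :: "gossip \<Rightarrow> bool" where
  "gossip_instance I \<longleftrightarrow> nodes I \<ge> 1 \<and> tokens I \<ge> 1 \<and>
     (\<Union>u<nodes I. init I u) = {..<tokens I} \<and>
     (\<forall>t\<in>{1..nodes I * tokens I}. connected_graph (nodes I) (net I t))"

text \<open>\<open>\<sigma> t u v\<close> is the token, if any, sent from \<open>u\<close> to \<open>v\<close> in round \<open>t\<close>.\<close>

type_synonym schedule = "nat \<Rightarrow> nat \<Rightarrow> nat \<Rightarrow> nat option"

text \<open>\<open>held I \<sigma> t u\<close> is the set of tokens at node \<open>u\<close> at the end of round \<open>t\<close>.\<close>

fun held :: "gossip \<Rightarrow> schedule \<Rightarrow> nat \<Rightarrow> nat \<Rightarrow> nat set" where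
  "held I \<sigma> 0 u = init I u"
| "held I \<sigma> (Suc t) u =
     held I \<sigma> t u \<union> {i. \<exists>v. (v, u) \<in> net I (Suc t) \<and> \<sigma> (Suc t) v u = Some i}"

definition valid_schedule :: "gossip \<Rightarrow> schedule \<Rightarrow> bool" where
  "valid_schedule I \<sigma> \<longleftrightarrow>
     (\<forall>t\<in>{1..nodes I * tokens I}. \<forall>u v i. \<sigma> t u v = Some i \<longrightarrow>
        (u, v) \<in> net I t \<and> i \<in> held I \<sigma> (t - 1) u)"

definition disseminates :: "gossip \<Rightarrow> schedule \<Rightarrow> bool" where
  "disseminates I \<sigma> \<longleftrightarrow>
     (\<forall>u<nodes I. held I \<sigma> (nodes I * tokens I) u = {..<tokens I})"

definition broadcast :: "gossip \<Rightarrow> schedule \<Rightarrow> bool" where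
  "broadcast I \<sigma> \<longleftrightarrow>
     (\<forall>t\<in>{1..nodes I * tokens I}. \<forall>u v w.
        (u, v) \<in> net I t \<and> (u, w) \<in> net I t \<longrightarrow> \<sigma> t u v = \<sigma> t u w)"

definition schedule_length :: "gossip \<Rightarrow> schedule \<Rightarrow> nat" where
  "schedule_length I \<sigma> =
     Max (insert 0 {t \<in> {1..nodes I * tokens I}. \<exists>u v i. \<sigma> t u v = Some i})"


section \<open>Polynomial-time randomized algorithms\<close>

text \<open>
  The model of computation is Jones's WHILE language (N. D. Jones, Computability and Complexity
  from a Programming Perspective): imperative programs whose variables hold binary trees. Any tree
  other than \<open>Leaf\<close> counts as true. Every (sub)expression that is evaluated costs the size of its
  value, so that data sharing cannot create large objects for free and the running time is
  polynomially related to that of a Turing machine.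
\<close>

datatype data = Leaf | Node data data

fun dsize :: "data \<Rightarrow> nat" where
  "dsize Leaf = 1"
| "dsize (Node a b) = 1 + dsize a + dsize b"

datatype exp = Var nat | Lf | Cons exp exp | Hd exp | Tl exp | Eq exp exp

type_synonym state = "nat \<Rightarrow> data"

fun hd_data :: "data \<Rightarrow> data" where
  "hd_data Leaf = Leaf"
| "hd_data (Node a b) = a"

fun tl_data :: "data \<Rightarrow> data" where
  "tl_data Leaf = Leaf"
| "tl_data (Node a b) = b"

definition enc_bool :: "bool \<Rightarrow> data" where
  "enc_bool b = (if b then Node Leaf Leaf else Leaf)"

fun evaluate :: "exp \<Rightarrow> state \<Rightarrow> data" where
  "evaluate (Var x) s = s x"
| "evaluate Lf s = Leaf"
| "evaluate (Cons a b) s = Node (evaluate a s) (evaluate b s)"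
| "evaluate (Hd a) s = hd_data (evaluate a s)"
| "evaluate (Tl a) s = tl_data (evaluate a s)"
| "evaluate (Eq a b) s = enc_bool (evaluate a s = evaluate b s)"

fun exp_cost :: "exp \<Rightarrow> state \<Rightarrow> nat" where
  "exp_cost (Var x) s = dsize (s x)"
| "exp_cost Lf s = 1"
| "exp_cost (Cons a b) s = exp_cost a s + exp_cost b s + dsize (evaluate (Cons a b) s)"
| "exp_cost (Hd a) s = exp_cost a s + dsize (evaluate (Hd a) s)"
| "exp_cost (Tl a) s = exp_cost a s + dsize (evaluate (Tl a) s)"
| "exp_cost (Eq a b) s = exp_cost a s + exp_cost b s + dsize (evaluate (Eq a b) s)"

datatype com =
    Assign nat exp
  | Seq com com
  | If exp com com
  | While exp com

text \<open>\<open>exec c s T s'\<close>: started in \<open>s\<close>, the program \<open>c\<close> halts in \<open>s'\<close> after time \<open>T\<close>.\<close>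

inductive exec :: "com \<Rightarrow> state \<Rightarrow> nat \<Rightarrow> state \<Rightarrow> bool" where
  Assign: "exec (Assign x e) s (exp_cost e s) (s(x := evaluate e s))"
| Seq: "exec c s T s' \<Longrightarrow> exec d s' T' s'' \<Longrightarrow> exec (Seq c d) s (T + T') s''"
| IfTrue: "evaluate e s \<noteq> Leaf \<Longrightarrow> exec c s T s' \<Longrightarrow> exec (If e c d) s (exp_cost e s + T) s'"
| IfFalse: "evaluate e s = Leaf \<Longrightarrow> exec d s T s' \<Longrightarrow> exec (If e c d) s (exp_cost e s + T) s'"
| WhileFalse: "evaluate e s = Leaf \<Longrightarrow> exec (While e c) s (exp_cost e s) s"
| WhileTrue: "evaluate e s \<noteq> Leaf \<Longrightarrow> exec c s T s' \<Longrightarrow> exec (While e c) s' T' s'' \<Longrightarrow>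
    exec (While e c) s (exp_cost e s + T + T') s''"

inductive_cases exec_AssignE: "exec (Assign x e) s T s'"
inductive_cases exec_SeqE: "exec (Seq c d) s T s'"
inductive_cases exec_IfE: "exec (If e c d) s T s'"
inductive_cases exec_WhileE: "exec (While e c) s T s'"

lemma exec_deterministic:
  "exec c s T s' \<Longrightarrow> exec c s U t' \<Longrightarrow> T = U \<and> s' = t'"
proof (induction arbitrary: U t' rule: exec.induct)
  case (Assign x e s)
  from Assign.prems show ?case by (rule exec_AssignE) simp
next
  case (Seq c s T s' d T' s'')
  from Seq.prems obtain V w V'
    where *: "U = V + V'" "exec c s V w" "exec d w V' t'" by (rule exec_SeqE)
  from Seq.IH(1)[OF *(2)] have "T = V" "s' = w" by (rule conjunct1, rule conjunct2)
  with Seq.IH(2)[of V' t'] * show ?case by simp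
next
  case (IfTrue e s c T s' d)
  from IfTrue.prems show ?case
  proof (rule exec_IfE)
    fix V assume "U = exp_cost e s + V" "exec c s V t'"
    with IfTrue.IH[of V t'] show ?thesis by simp
  qed (use IfTrue.hyps(1) in contradiction)
next
  case (IfFalse e s d T s' c)
  from IfFalse.prems show ?case
  proof (rule exec_IfE)
    fix V assume "U = exp_cost e s + V" "exec d s V t'"
    with IfFalse.IH[of V t'] show ?thesis by simp
  qed (use IfFalse.hyps(1) in contradiction)
next
  case (WhileFalse e s c)
  from WhileFalse.prems show ?case
  proof (rule exec_WhileE)
    assume "U = exp_cost e s" "t' = s"
    then show ?thesis by simp
  qed (use WhileFalse.hyps in contradiction)
next
  case (WhileTrue e s c T s' T' s'')
  from WhileTrue.prems show ?case
  proof (rule exec_WhileE)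
    fix V w V'
    assume *: "U = exp_cost e s + V + V'" "exec c s V w" "exec (While e c) w V' t'"
    from WhileTrue.IH(1)[OF *(2)] have "T = V" "s' = w" by (rule conjunct1, rule conjunct2)
    with WhileTrue.IH(2)[of V' t'] * show ?thesis by simp
  qed (use WhileTrue.hyps(1) in contradiction)
qed

text \<open>Input and output are passed in variable 0; all other variables initially hold \<open>Leaf\<close>.\<close>

definition returns :: "com \<Rightarrow> data \<Rightarrow> nat \<Rightarrow> data \<Rightarrow> bool" where
  "returns c x T y \<longleftrightarrow> (\<exists>s. exec c ((\<lambda>_. Leaf)(0 := x)) T s \<and> s 0 = y)"

lemma returns_deterministic: "returns c x T y \<Longrightarrow> returns c x U z \<Longrightarrow> T = U \<and> y = z"
  unfolding returns_def by (elim exE conjE) (drule (1) exec_deterministic, simp)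

definition enc_list :: "data list \<Rightarrow> data" where
  "enc_list xs = foldr Node xs Leaf"

text \<open>
  A randomized algorithm is a program together with a polynomial \<open>q\<close>. On input \<open>x\<close> the program
  receives, next to \<open>x\<close>, a list of \<open>q |x|\<close> independent fair coin flips. The time bound below is a
  worst-case one: it holds for all outcomes of the coin flips.
\<close>

definition with_coins :: "data \<Rightarrow> bool list \<Rightarrow> data" where
  "with_coins x r = Node x (enc_list (map enc_bool r))"

definition coins :: "nat poly \<Rightarrow> data \<Rightarrow> bool list set" where
  "coins q x = {r. length r = poly q (dsize x)}"

definition polynomial_time_on :: "data set \<Rightarrow> com \<Rightarrow> nat poly \<Rightarrow> bool" where
  "polynomial_time_on X c q \<longleftrightarrow>
     (\<exists>p :: nat poly. \<forall>x\<in>X. \<forall>r\<in>coins q x.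
        \<exists>T y. returns c (with_coins x r) T y \<and> T \<le> poly p (dsize x))"

definition output_pmf :: "com \<Rightarrow> nat poly \<Rightarrow> data \<Rightarrow> data pmf" where
  "output_pmf c q x =
     map_pmf (\<lambda>r. THE y. \<exists>T. returns c (with_coins x r) T y) (pmf_of_set (coins q x))"


section \<open>Encoding of instances and schedules\<close>

text \<open>
  Numbers are encoded in unary. This does not affect polynomiality, because an instance comprises
  \<open>n * k\<close> graphs on \<open>n\<close> nodes, given by their adjacency matrices, and thus has size at least \<open>n\<close> and
  \<open>k\<close> anyway.
\<close>

definition enc_nat :: "nat \<Rightarrow> data" where
  "enc_nat m = enc_list (replicate m Leaf)"

fun enc_option :: "nat option \<Rightarrow> data" where
  "enc_option None = Leaf"
| "enc_option (Some i) = Node (enc_nat i) Leaf"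

definition enc_table :: "nat \<Rightarrow> nat \<Rightarrow> (nat \<Rightarrow> nat \<Rightarrow> data) \<Rightarrow> data" where
  "enc_table a b f = enc_list (map (\<lambda>i. enc_list (map (f i) [0..<b])) [0..<a])"

definition enc_instance :: "gossip \<Rightarrow> data" where
  "enc_instance I = (let n = nodes I; k = tokens I in
     enc_list
       [enc_nat n, enc_nat k,
        enc_table n k (\<lambda>u i. enc_bool (i \<in> init I u)),
        enc_list (map (\<lambda>t. enc_table n n (\<lambda>u v. enc_bool ((u, v) \<in> net I t)))
          [1..<Suc (n * k)])])"

definition enc_schedule :: "gossip \<Rightarrow> schedule \<Rightarrow> data" where
  "enc_schedule I \<sigma> = (let n = nodes I; k = tokens I in
     enc_list (map (\<lambda>t. enc_table n n (\<lambda>u v. enc_option (\<sigma> t u v))) [1..<Suc (n * k)]))"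

end

theory Submission
  imports Defs
begin

text \<open>
  The algorithm is deterministic. Let \<open>W = n + k\<close>. In a window of \<open>W\<close> rounds all tokens can be gathered
  at any given node: by connectivity and a max-flow min-cut argument there are disjoint paths for them
  in the time-expanded network, and augmenting paths find them. On the other hand, in a window of \<open>d\<close>
  rounds every node can be reached from more than \<open>d\<close> nodes. Hence, greedily, some
  \<open>m > (2 n log n) / d\<close> nodes can be chosen such that, in each of \<open>k\<close> later windows of \<open>d\<close> rounds, every
  node is reached from a chosen one. Gathering all tokens at each chosen node in turn and then flooding
  token \<open>i\<close> in the \<open>i\<close>-th of the \<open>k\<close> windows takes \<open>m W + k d\<close> rounds, which for \<open>m\<close> about
  \<open>sqrt (k log n)\<close> is \<open>O(n sqrt (k log n))\<close>. If this exceeds \<open>n k\<close>, every token is flooded for \<open>n\<close>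
  rounds instead.
\<close>

section \<open>Polynomial-time functions on encoded types\<close>

text \<open>The number \<open>m\<close> of chosen nodes is a compromise: gathering costs about
  \<open>n m\<close> rounds and flooding about \<open>k n L / m\<close>, with \<open>L\<close> about
  log n, and these balance at \<open>m\<close> about \<open>sqrt (k L)\<close>. The greedy choice
  replaces random sampling: a fixed pair of a window and a node is missed by at most
  \<open>n - d\<close> nodes, so some node leaves at most the fraction \<open>1 - d / n\<close> of
  the pairs missed so far, and the \<open>n k \<le> n * n\<close> pairs are exhausted once
  \<open>d m > 2 n L\<close>. For gathering, a cut is never formed explicitly: a failed search for
  an augmenting path would yield a set of holes that reaches fewer slots than connectivity forces.
  The complexity side dictates the style of the definitions: the only loop of the
  \<open>ptime\<close> calculus is \<open>fold\<close>, with an accumulator of polynomial size, so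
  the algorithm is written with total list functions, default values and bounded searches.\<close>

class enc =
  fixes enc :: "'a \<Rightarrow> data"
  assumes inj_enc: "inj enc"

text \<open>Injectivity is what lets the tree comparison \<open>Eq\<close> of the WHILE language
  decide equality of values of every encoded type.\<close>

lemma enc_eq_iff [simp]: "enc x = enc y \<longleftrightarrow> x = y"
  using inj_enc by (auto dest: injD)

instantiation unit :: enc
begin
definition enc_unit :: "unit \<Rightarrow> data" where "enc_unit x = Leaf"
instance by standard (simp add: inj_def)
end

instantiation bool :: enc
begin
definition enc_bool_def': "enc (b :: bool) = enc_bool b"
instance by standard (simp add: inj_def enc_bool_def' enc_bool_def)
end

instantiation prod :: (enc, enc) enc
begin
definition enc_prod :: "'a \<times> 'b \<Rightarrow> data" where "enc_prod p = Node (enc (fst p)) (enc (snd p))"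
instance by standard (auto simp: inj_def enc_prod_def)
end

instantiation list :: (enc) enc
begin
definition enc_list_def': "enc (xs :: 'a list) = enc_list (map enc xs)"
instance
proof
  have "xs = ys" if "enc_list (map enc xs) = enc_list (map enc ys)" for xs ys :: "'a list"
    using that
  proof (induction xs arbitrary: ys)
    case Nil
    then show ?case by (cases ys) (auto simp: enc_list_def)
  next
    case (Cons x xs)
    then show ?case by (cases ys) (auto simp: enc_list_def)
  qed
  then show "inj (enc :: 'a list \<Rightarrow> data)"
    by (auto simp: inj_def enc_list_def')
qed
end

instantiation option :: (enc) enc
begin
definition enc_option_def': "enc (z :: 'a option) = (case z of None \<Rightarrow> Leaf | Some x \<Rightarrow> Node (enc x) Leaf)"
instance by standard (auto simp: inj_def enc_option_def' split: option.splits)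
end

lemma enc_list_simps [simp]:
  "enc_list [] = Leaf"
  "enc_list (x # xs) = Node x (enc_list xs)"
  by (simp_all add: enc_list_def)

lemma inj_enc_nat: "inj enc_nat"
proof (rule injI)
  fix m n assume "enc_nat m = enc_nat n"
  then have "enc (replicate m ()) = enc (replicate n ())"
    by (simp add: enc_list_def' enc_nat_def enc_unit_def)
  then have "length (replicate m ()) = length (replicate n ())"
    by (simp only: enc_eq_iff)
  then show "m = n" by simp
qed

instantiation nat :: enc
begin
definition enc_nat_def': "enc (m :: nat) = enc_nat m"
instance using inj_enc_nat by intro_classes (simp add: enc_nat_def'[abs_def])
end

lemma enc_simps [simp]:
  "enc () = Leaf"
  "enc True = Node Leaf Leaf" "enc False = Leaf"
  "enc (p, q) = Node (enc p) (enc q)"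
  "enc [] = Leaf" "enc (x # xs) = Node (enc x) (enc xs)"
  "enc None = Leaf" "enc (Some x) = Node (enc x) Leaf"
  "enc (0 :: nat) = Leaf" "enc (Suc n) = Node Leaf (enc n)"
  by (simp_all add: enc_unit_def enc_bool_def' enc_bool_def enc_prod_def enc_list_def'
      enc_option_def' enc_nat_def' enc_nat_def)

lemma enc_eq_Leaf [simp]:
  "enc b = Leaf \<longleftrightarrow> \<not> b" "enc xs = Leaf \<longleftrightarrow> xs = []"
  by (cases b, simp_all) (cases xs, simp_all)

text \<open>A unary number is literally a list of units, so arithmetic reduces to list functions:
  addition to append, subtraction to \<open>drop\<close>, multiplication to
  \<open>concat\<close>.\<close>

lemma enc_nat_units: "enc (n :: nat) = enc (replicate n ())"
  by (induction n) auto

section \<open>Sizes of encoded values\<close>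

definition sz :: "'a :: enc \<Rightarrow> nat" where "sz x = dsize (enc x)"

lemma sz_simps [simp]:
  "sz () = 1" "sz False = 1" "sz True = 3"
  "sz (p, q) = 1 + sz p + sz q"
  "sz [] = 1" "sz (x # xs) = 1 + sz x + sz xs"
  "sz None = 1" "sz (Some x) = 2 + sz x"
  "sz (n :: nat) = 2 * n + 1"
proof -
  show "sz (n :: nat) = 2 * n + 1" for n
    by (induction n) (auto simp: sz_def)
qed (simp_all add: sz_def)

lemma sz_list_le:
  assumes "\<And>x. x \<in> set xs \<Longrightarrow> sz x \<le> B"
  shows "sz xs \<le> 1 + length xs * (1 + B)"
  using assms by (induction xs) (simp, fastforce)

lemma length_le_sz: "length xs \<le> sz xs"
  by (induction xs) auto

lemma sz_elem_le: "x \<in> set xs \<Longrightarrow> sz x \<le> sz xs"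
  by (induction xs) auto

lemma sz_drop_le: "sz (drop j xs) \<le> sz xs"
proof (induction xs arbitrary: j)
  case (Cons x xs)
  then show ?case by (cases j) (auto intro: le_SucI trans_le_add2)
qed simp


subsection \<open>Polynomial bounds\<close>

text \<open>The base is at least 2, so constants and sums can be absorbed by raising the exponent; a
  single exponent then describes a class closed under sums, products and composition.\<close>

definition pbound :: "('a :: enc \<Rightarrow> nat) \<Rightarrow> bool" where
  "pbound b \<longleftrightarrow> (\<exists>d. \<forall>x. b x \<le> (2 + sz x) ^ d)"

lemma pbound_mono: "pbound b \<Longrightarrow> (\<And>x. b' x \<le> b x) \<Longrightarrow> pbound b'"
  unfolding pbound_def by (meson le_trans)

lemma pbound_const: "pbound (\<lambda>_. m)"
proof -
  have "m \<le> (2 + sz x) ^ m" for x :: 'a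
  proof -
    have "m \<le> 2 ^ m" by (simp add: less_imp_le)
    also have "\<dots> \<le> (2 + sz x) ^ m" by (intro power_mono) auto
    finally show ?thesis .
  qed
  then show ?thesis unfolding pbound_def by blast
qed

lemma pbound_sz: "pbound sz"
  unfolding pbound_def by (rule exI[of _ 1]) simp

lemma pbound_mult:
  assumes "pbound b" "pbound b'" shows "pbound (\<lambda>x. b x * b' x)"
proof -
  obtain d d' where "\<And>x. b x \<le> (2 + sz x) ^ d" "\<And>x. b' x \<le> (2 + sz x) ^ d'"
    using assms unfolding pbound_def by blast
  then have "b x * b' x \<le> (2 + sz x) ^ (d + d')" for x
    unfolding power_add by (intro mult_mono) auto
  then show ?thesis unfolding pbound_def by blast
qed

lemma pbound_add:
  assumes "pbound b" "pbound b'" shows "pbound (\<lambda>x. b x + b' x)"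
proof -
  have "pbound (\<lambda>x. (b x + 1) * (b' x + 1))"
  proof (rule pbound_mult)
    have step: "pbound (\<lambda>x. c x + 1)" if c: "pbound c" for c :: "'a \<Rightarrow> nat"
    proof -
      obtain d where d: "\<And>x. c x \<le> (2 + sz x) ^ d"
        using c unfolding pbound_def by blast
      have "c x + 1 \<le> (2 + sz x) ^ Suc d" for x
      proof -
        have "c x + 1 \<le> (2 + sz x) ^ d + (2 + sz x) ^ d"
          using d[of x] by (intro add_mono) (auto simp: Suc_le_eq)
        also have "\<dots> \<le> (2 + sz x) ^ Suc d" by simp
        finally show ?thesis .
      qed
      then show ?thesis unfolding pbound_def by blast
    qed
    show "pbound (\<lambda>x. b x + 1)" "pbound (\<lambda>x. b' x + 1)" using assms step by auto
  qed
  then show ?thesis by (rule pbound_mono) auto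
qed

lemma pbound_power: "pbound b \<Longrightarrow> pbound (\<lambda>x. b x ^ d)"
  by (induction d) (auto intro: pbound_mult pbound_const)

lemma pbound_comp:
  assumes "pbound b" "pbound (\<lambda>x. sz (f x))"
  shows "pbound (\<lambda>x. b (f x))"
proof -
  obtain d where d: "\<And>y. b y \<le> (2 + sz y) ^ d"
    using assms(1) unfolding pbound_def by blast
  have "pbound (\<lambda>x. (2 + sz (f x)) ^ d)"
    by (intro pbound_power pbound_add pbound_const assms)
  then show ?thesis by (rule pbound_mono) (rule d)
qed

lemmas pbound_intros = pbound_const pbound_sz pbound_add pbound_mult pbound_power


subsection \<open>Execution with a time bound\<close>

definition runs :: "com \<Rightarrow> state \<Rightarrow> nat \<Rightarrow> (state \<Rightarrow> bool) \<Rightarrow> bool" where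
  "runs c s t Q \<longleftrightarrow> (\<exists>T s'. exec c s T s' \<and> T \<le> t \<and> Q s')"

lemma runs_Assign:
  "exp_cost e s \<le> t \<Longrightarrow> Q (s(x := evaluate e s)) \<Longrightarrow> runs (Assign x e) s t Q"
  unfolding runs_def using exec.Assign by blast

lemma runs_Seq:
  "runs c s t (\<lambda>s'. runs d s' t' Q) \<Longrightarrow> runs (Seq c d) s (t + t') Q"
  unfolding runs_def by (meson exec.Seq add_mono)

lemma runs_SeqI:
  "runs c s t Q \<Longrightarrow> (\<And>s'. Q s' \<Longrightarrow> runs d s' t' R) \<Longrightarrow> runs (Seq c d) s (t + t') R"
  unfolding runs_def by (meson exec.Seq add_mono)

lemma runs_If:
  assumes "evaluate e s \<noteq> Leaf \<Longrightarrow> runs c s t Q" "evaluate e s = Leaf \<Longrightarrow> runs d s t Q"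
  shows "runs (If e c d) s (exp_cost e s + t) Q"
  using assms unfolding runs_def
  by (metis exec.IfTrue exec.IfFalse add_left_mono)

lemma runs_conseq:
  "runs c s t Q \<Longrightarrow> t \<le> t' \<Longrightarrow> (\<And>s'. Q s' \<Longrightarrow> Q' s') \<Longrightarrow> runs c s t' Q'"
  unfolding runs_def by (meson le_trans)

text \<open>The invariant is indexed by the list of items still to be processed, which serves as the
  variant. Each item costs a test and a body, at most \<open>t\<close> each, and the final failing
  test costs another \<open>t\<close>.\<close>

lemma runs_While:
  assumes step: "\<And>y l s. Inv (y # l) s \<Longrightarrow> runs c s t (Inv l)"
    and test: "\<And>l s. Inv l s \<Longrightarrow> exp_cost e s \<le> t \<and> (evaluate e s = Leaf \<longleftrightarrow> l = [])"
    and "Inv l s"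
  shows "runs (While e c) s ((2 * length l + 1) * t) (Inv [])"
  using assms(3)
proof (induction l arbitrary: s)
  case Nil
  then show ?case
    using test[OF Nil] exec.WhileFalse[of e s c] unfolding runs_def by auto
next
  case (Cons y l)
  obtain T s' where 1: "exec c s T s'" "T \<le> t" "Inv l s'"
    using step[OF Cons.prems] unfolding runs_def by blast
  obtain T' s'' where 2: "exec (While e c) s' T' s''" "T' \<le> (2 * length l + 1) * t" "Inv [] s''"
    using Cons.IH[OF 1(3)] unfolding runs_def by blast
  have "exec (While e c) s (exp_cost e s + T + T') s''"
    using exec.WhileTrue[OF _ 1(1) 2(1)] test[OF Cons.prems] by auto
  moreover have "exp_cost e s + T + T' \<le> (2 * length (y # l) + 1) * t"
    using test[OF Cons.prems] 1(2) 2(2) by (auto simp: algebra_simps)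
  ultimately show ?case using 2(3) unfolding runs_def by blast
qed


subsection \<open>Polynomial-time functions\<close>

text \<open>
  The program for \<open>f\<close> works in place on an arbitrary variable \<open>a\<close>, leaves the variables below \<open>a\<close>
  alone and assumes nothing about the variables above \<open>a\<close>. Programs can thus be combined by choosing
  different \<open>a\<close>, without any renaming.
\<close>

definition computes :: "com \<Rightarrow> nat \<Rightarrow> nat \<Rightarrow> ('a :: enc \<Rightarrow> 'b :: enc) \<Rightarrow> ('a \<Rightarrow> nat) \<Rightarrow> bool" where
  "computes c a a' f b \<longleftrightarrow>
     (\<forall>x s. s a = enc x \<longrightarrow> runs c s (b x) (\<lambda>s'. s' a' = enc (f x) \<and> (\<forall>i<a'. s' i = s i)))"

lemma computesD:
  "computes c a a' f b \<Longrightarrow> s a = enc x \<Longrightarrow>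
     runs c s (b x) (\<lambda>s'. s' a' = enc (f x) \<and> (\<forall>i<a'. s' i = s i))"
  unfolding computes_def by blast

lemma computesI:
  "(\<And>x s. s a = enc x \<Longrightarrow> runs c s (b x) (\<lambda>s'. s' a' = enc (f x) \<and> (\<forall>i<a'. s' i = s i))) \<Longrightarrow>
     computes c a a' f b"
  unfolding computes_def by blast

text \<open>The bound \<open>b\<close> is chosen before the variable \<open>a\<close>, so relocating
  the program does not change its cost bound. The size of the value is bounded as well, because
  under composition it is the input size of the next program.\<close>

definition ptime :: "('a :: enc \<Rightarrow> 'b :: enc) \<Rightarrow> bool" where
  "ptime f \<longleftrightarrow> pbound (\<lambda>x. sz (f x)) \<and> (\<exists>b. pbound b \<and> (\<forall>a. \<exists>c. computes c a a f b))"

lemma ptimeI: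
  assumes "pbound (\<lambda>x. sz (f x))" "pbound b" and "\<And>a. \<exists>c. computes c a a f b"
  shows "ptime f"
  using assms unfolding ptime_def by blast

lemma ptimeE:
  assumes "ptime f"
  obtains b where "pbound (\<lambda>x. sz (f x))" "pbound b" "\<And>a. \<exists>c. computes c a a f b"
  using assms unfolding ptime_def by blast

lemma ptime_pbound: "ptime f \<Longrightarrow> pbound (\<lambda>x. sz (f x))"
  unfolding ptime_def by blast

text \<open>Programs see only trees, so functions whose values have equal encodings share a program.
  This turns pairing into \<open>Suc\<close>, \<open>Some\<close> and list construction at no
  cost.\<close>

lemma ptime_recode:
  assumes "ptime f" "\<And>x. enc (f x) = enc (g x)"
  shows "ptime g"
proof -
  have "sz (f x) = sz (g x)" for x by (simp add: sz_def assms(2))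
  then show ?thesis using assms unfolding ptime_def computes_def by simp
qed

lemma ptime_id: "ptime (\<lambda>x. x)"
proof (rule ptimeI)
  show "\<exists>c. computes c a a (\<lambda>x. x) sz" for a
    by (intro exI[of _ "Assign a (Var a)"] computesI runs_Assign) (auto simp: sz_def)
qed (auto intro: pbound_intros)

primrec data_exp :: "data \<Rightarrow> exp" where
  "data_exp Leaf = Lf"
| "data_exp (Node x y) = Cons (data_exp x) (data_exp y)"

lemma evaluate_data_exp [simp]: "evaluate (data_exp d) s = d"
  by (induction d) auto

lemma exp_cost_data_exp: "exp_cost (data_exp d) s = exp_cost (data_exp d) s'"
  by (induction d) auto

lemma ptime_const: "ptime (\<lambda>_. v)"
proof (rule ptimeI)
  let ?e = "data_exp (enc v)"
  have cost: "exp_cost ?e s \<le> exp_cost ?e (\<lambda>_. Leaf)" for s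
    by (rule eq_refl) (rule exp_cost_data_exp)
  show "\<exists>c. computes c a a (\<lambda>_. v) (\<lambda>_. exp_cost ?e (\<lambda>_. Leaf))" for a
    by (intro exI[of _ "Assign a ?e"] computesI runs_Assign cost) auto
qed (auto intro: pbound_intros)

lemma ptime_comp:
  fixes f :: "'a :: enc \<Rightarrow> 'b :: enc" and g :: "'b \<Rightarrow> 'c :: enc"
  assumes "ptime f" "ptime g" shows "ptime (\<lambda>x. g (f x))"
proof -
  obtain b where f: "pbound (\<lambda>x. sz (f x))" "pbound b" "\<And>a. \<exists>c. computes c a a f b"
    using ptimeE[OF assms(1)] by blast
  obtain b' where g: "pbound (\<lambda>x. sz (g x))" "pbound b'" "\<And>a. \<exists>c. computes c a a g b'"
    using ptimeE[OF assms(2)] by blast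
  show ?thesis
  proof (rule ptimeI)
    show "pbound (\<lambda>x. sz (g (f x)))" by (rule pbound_comp[OF g(1) f(1)])
    show "pbound (\<lambda>x. b x + b' (f x))" by (intro pbound_add f pbound_comp[OF g(2) f(1)])
    fix a
    obtain c where c: "computes c a a f b" using f(3) by blast
    obtain c' where c': "computes c' a a g b'" using g(3) by blast
    have "computes (Seq c c') a a (\<lambda>x. g (f x)) (\<lambda>x. b x + b' (f x))"
    proof (rule computesI, rule runs_SeqI)
      fix x :: 'a and s :: state assume s: "s a = enc x"
      show "runs c s (b x) (\<lambda>s'. s' a = enc (f x) \<and> (\<forall>i<a. s' i = s i))"
        by (rule computesD[OF c]) (rule s)
      fix s' assume "s' a = enc (f x) \<and> (\<forall>i<a. s' i = s i)"
      then show "runs c' s' (b' (f x)) (\<lambda>s'. s' a = enc (g (f x)) \<and> (\<forall>i<a. s' i = s i))"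
        by (intro runs_conseq[OF computesD[OF c', of s' "f x"]]) auto
    qed
    then show "\<exists>c. computes c a a (\<lambda>x. g (f x)) (\<lambda>x. b x + b' (f x))" by blast
  qed
qed

text \<open>Programs work in place and destroy their argument. Copying it upwards first keeps it
  available, as needed whenever two computations read the same input.\<close>

lemma computes_copy:
  fixes f :: "'a :: enc \<Rightarrow> 'b :: enc"
  assumes "ptime f"
  obtains b where "pbound b" "\<And>a a'. a < a' \<Longrightarrow> \<exists>c. computes c a a' f b"
proof -
  obtain b where f: "pbound (\<lambda>x. sz (f x))" "pbound b" "\<And>a. \<exists>c. computes c a a f b"
    using ptimeE[OF assms(1)] by blast
  show ?thesis
  proof (rule that)
    show "pbound (\<lambda>x. sz x + b x)" by (intro pbound_intros f)
    fix a a' :: nat assume a: "a < a'"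
    obtain c where c: "computes c a' a' f b" using f(3) by blast
    have "computes (Seq (Assign a' (Var a)) c) a a' f (\<lambda>x. sz x + b x)"
    proof (intro computesI runs_Seq runs_Assign)
      fix x :: 'a and s :: state assume s: "s a = enc x"
      then show "exp_cost (Var a) s \<le> sz x" by (simp add: sz_def)
      show "runs c (s(a' := evaluate (Var a) s)) (b x)
          (\<lambda>s'. s' a' = enc (f x) \<and> (\<forall>i<a'. s' i = s i))"
        using s by (intro runs_conseq[OF computesD[OF c, of _ x]]) auto
    qed
    then show "\<exists>c. computes c a a' f (\<lambda>x. sz x + b x)" by blast
  qed
qed

lemma ptime_Pair:
  fixes f :: "'a :: enc \<Rightarrow> 'b :: enc" and g :: "'a \<Rightarrow> 'c :: enc"
  assumes "ptime f" "ptime g" shows "ptime (\<lambda>x. (f x, g x))"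
proof -
  obtain b where f: "pbound b" "\<And>a a'. a < a' \<Longrightarrow> \<exists>c. computes c a a' f b"
    using computes_copy[OF assms(1)] by blast
  obtain b' where g: "pbound b'" "\<And>a a'. a < a' \<Longrightarrow> \<exists>c. computes c a a' g b'"
    using computes_copy[OF assms(2)] by blast
  have sizes: "pbound (\<lambda>x. sz (f x))" "pbound (\<lambda>x. sz (g x))"
    using assms by (auto dest: ptime_pbound)
  show ?thesis
  proof (rule ptimeI)
    have "pbound (\<lambda>x. 1 + sz (f x) + sz (g x))" by (intro pbound_intros sizes)
    then show "pbound (\<lambda>x. sz (f x, g x))" by simp
    let ?t = "\<lambda>x. 2 * sz (f x) + 2 * sz (g x) + 1"
    show "pbound (\<lambda>x. b x + (b' x + ?t x))"
      by (intro pbound_intros f g sizes)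
    fix a
    obtain c where c: "computes c a (a + 1) f b" using f(2)[of a "a + 1"] by auto
    obtain c' where c': "computes c' a (a + 2) g b'" using g(2)[of a "a + 2"] by auto
    have "computes (Seq c (Seq c' (Assign a (Cons (Var (a + 1)) (Var (a + 2)))))) a a
        (\<lambda>x. (f x, g x)) (\<lambda>x. b x + (b' x + ?t x))"
    proof (rule computesI, rule runs_SeqI, rule computesD[OF c], assumption, rule runs_SeqI)
      fix x :: 'a and s s1 :: state
      assume s: "s a = enc x" and s1: "s1 (a + 1) = enc (f x) \<and> (\<forall>i<a + 1. s1 i = s i)"
      show "runs c' s1 (b' x) (\<lambda>s'. s' (a + 2) = enc (g x) \<and> (\<forall>i<a + 2. s' i = s1 i))"
        by (rule computesD[OF c']) (use s s1 in simp)
      fix s2 assume s2: "s2 (a + 2) = enc (g x) \<and> (\<forall>i<a + 2. s2 i = s1 i)"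
      show "runs (Assign a (Cons (Var (a + 1)) (Var (a + 2)))) s2 (?t x)
         (\<lambda>s'. s' a = enc (f x, g x) \<and> (\<forall>i<a. s' i = s i))"
        using s s1 s2 by (intro runs_Assign) (auto simp: sz_def)
    qed
    then show "\<exists>c. computes c a a (\<lambda>x. (f x, g x)) (\<lambda>x. b x + (b' x + ?t x))" by blast
  qed
qed

lemma ptime_exp:
  fixes f :: "'a :: enc \<Rightarrow> 'b :: enc" and b :: "'a \<Rightarrow> nat"
  assumes "pbound (\<lambda>x. sz (f x))"
    and "\<And>a s x. s a = enc x \<Longrightarrow> evaluate (e a) s = enc (f x)"
    and "\<And>a s x. s a = enc x \<Longrightarrow> exp_cost (e a) s \<le> b x" "pbound b"
  shows "ptime f"
proof (rule ptimeI[OF assms(1,4)])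
  show "\<exists>c. computes c a a f b" for a
    by (intro exI[of _ "Assign a (e a)"] computesI runs_Assign) (auto simp: assms(2,3))
qed

lemma ptime_fst_prim: "ptime fst"
proof (rule ptime_exp[where e = "\<lambda>a. Hd (Var a)" and b = "\<lambda>x. 2 * sz x"])
  show "pbound (\<lambda>x :: 'a \<times> 'b. sz (fst x))" by (rule pbound_mono[OF pbound_sz]) auto
  show "exp_cost (Hd (Var a)) s \<le> 2 * sz x" if "s a = enc x" for a s and x :: "'a \<times> 'b"
    using that by (cases x) (auto simp: sz_def)
  show "evaluate (Hd (Var a)) s = enc (fst x)" if "s a = enc x" for a s and x :: "'a \<times> 'b"
    using that by (cases x) auto
qed (intro pbound_intros)

lemma ptime_snd_prim: "ptime snd"
proof (rule ptime_exp[where e = "\<lambda>a. Tl (Var a)" and b = "\<lambda>x. 2 * sz x"])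
  show "pbound (\<lambda>x :: 'a \<times> 'b. sz (snd x))" by (rule pbound_mono[OF pbound_sz]) auto
  show "exp_cost (Tl (Var a)) s \<le> 2 * sz x" if "s a = enc x" for a s and x :: "'a \<times> 'b"
    using that by (cases x) (auto simp: sz_def)
  show "evaluate (Tl (Var a)) s = enc (snd x)" if "s a = enc x" for a s and x :: "'a \<times> 'b"
    using that by (cases x) auto
qed (intro pbound_intros)

lemma ptime_eq_prim: "ptime (\<lambda>p. fst p = snd p)"
proof (rule ptime_exp[where e = "\<lambda>a. Eq (Hd (Var a)) (Tl (Var a))" and b = "\<lambda>x. 4 * sz x + 3"])
  show "pbound (\<lambda>x :: 'a \<times> 'a. sz (fst x = snd x))"
  proof (rule pbound_mono[OF pbound_const[of 3]])
    show "sz (fst x = snd x) \<le> 3" for x :: "'a \<times> 'a" by (cases "fst x = snd x") auto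
  qed
  show "exp_cost (Eq (Hd (Var a)) (Tl (Var a))) s \<le> 4 * sz x + 3"
    if "s a = enc x" for a s and x :: "'a \<times> 'a"
    using that by (cases x) (auto simp: sz_def enc_bool_def)
  show "evaluate (Eq (Hd (Var a)) (Tl (Var a))) s = enc (fst x = snd x)"
    if "s a = enc x" for a s and x :: "'a \<times> 'a"
    using that by (cases x) (auto simp: enc_bool_def)
qed (intro pbound_intros)

lemma ptime_tl_prim: "ptime (tl :: 'a :: enc list \<Rightarrow> _)"
proof (rule ptime_exp[where e = "\<lambda>a. Tl (Var a)" and b = "\<lambda>x. 2 * sz x"])
  have "sz (tl xs) \<le> sz xs" for xs :: "'a list" by (cases xs) auto
  then show "pbound (\<lambda>x :: 'a list. sz (tl x))" by (rule pbound_mono[OF pbound_sz])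
  show "evaluate (Tl (Var a)) s = enc (tl x)" if "s a = enc x" for a s and x :: "'a list"
    using that by (cases x) auto
  show "exp_cost (Tl (Var a)) s \<le> 2 * sz x" if "s a = enc x" for a s and x :: "'a list"
    using that by (cases x) (auto simp: sz_def)
qed (intro pbound_intros)

lemma ptime_fst: "ptime f \<Longrightarrow> ptime (\<lambda>x. fst (f x))"
  by (rule ptime_comp[OF _ ptime_fst_prim])

lemma ptime_snd: "ptime f \<Longrightarrow> ptime (\<lambda>x. snd (f x))"
  by (rule ptime_comp[OF _ ptime_snd_prim])

lemma ptime_comp2:
  assumes "ptime (\<lambda>p. h (fst p) (snd p))" "ptime f" "ptime g"
  shows "ptime (\<lambda>x. h (f x) (g x))"
  using ptime_comp[OF ptime_Pair[OF assms(2,3)] assms(1)] by simp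

lemmas ptime_eq = ptime_comp2[OF ptime_eq_prim]

lemma ptime_if:
  fixes f :: "'a :: enc \<Rightarrow> 'b :: enc"
  assumes "ptime p" "ptime f" "ptime g" shows "ptime (\<lambda>x. if p x then f x else g x)"
proof -
  obtain b0 where p: "pbound b0" "\<And>a a'. a < a' \<Longrightarrow> \<exists>c. computes c a a' p b0"
    using computes_copy[OF assms(1)] by blast
  obtain b where f: "pbound (\<lambda>x. sz (f x))" "pbound b" "\<And>a. \<exists>c. computes c a a f b"
    using ptimeE[OF assms(2)] by blast
  obtain b' where g: "pbound (\<lambda>x. sz (g x))" "pbound b'" "\<And>a. \<exists>c. computes c a a g b'"
    using ptimeE[OF assms(3)] by blast
  let ?h = "\<lambda>x. if p x then f x else g x"
  show ?thesis
  proof (rule ptimeI)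
    show "pbound (\<lambda>x. sz (?h x))"
      by (rule pbound_mono[OF pbound_add[OF f(1) g(1)]]) auto
    let ?t = "\<lambda>x. b0 x + (3 + (b x + b' x))"
    show "pbound ?t" by (intro pbound_intros p f g)
    fix a
    obtain c0 where c0: "computes c0 a (a + 1) p b0" using p(2)[of a "a + 1"] by auto
    obtain c where c: "computes c a a f b" using f(3) by blast
    obtain c' where c': "computes c' a a g b'" using g(3) by blast
    have "computes (Seq c0 (If (Var (a + 1)) c c')) a a ?h ?t"
    proof (rule computesI, rule runs_SeqI, rule computesD[OF c0], assumption)
      fix x :: 'a and s s' :: state
      assume s: "s a = enc x" and s': "s' (a + 1) = enc (p x) \<and> (\<forall>i<a + 1. s' i = s i)"
      let ?Q = "\<lambda>s'. s' a = enc (?h x) \<and> (\<forall>i<a. s' i = s i)"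
      have 1: "s' a = enc x" using s s' by simp
      show "runs (If (Var (a + 1)) c c') s' (3 + (b x + b' x)) ?Q"
      proof (rule runs_conseq[OF runs_If])
        show "evaluate (Var (a + 1)) s' \<noteq> Leaf \<Longrightarrow> runs c s' (b x + b' x) ?Q"
          using s' 1 by (intro runs_conseq[OF computesD[OF c, where x = x]]) auto
        show "evaluate (Var (a + 1)) s' = Leaf \<Longrightarrow> runs c' s' (b x + b' x) ?Q"
          using s' 1 by (intro runs_conseq[OF computesD[OF c', where x = x]]) auto
        show "exp_cost (Var (a + 1)) s' + (b x + b' x) \<le> 3 + (b x + b' x)"
          using s' by (cases "p x") auto
      qed auto
    qed
    then show "\<exists>c. computes c a a ?h ?t" by blast
  qed
qed

text \<open>Variable \<open>a\<close> keeps the input, \<open>a + 1\<close> the rest of the list,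
  \<open>a + 2\<close> the accumulator, and the body works in place at \<open>a + 3\<close>. The
  bound on all intermediate accumulators is essential: iterating a polynomial-time body could
  otherwise make them exponentially large.\<close>

lemma ptime_fold:
  fixes l :: "'a :: enc \<Rightarrow> 'b :: enc list" and a0 :: "'a \<Rightarrow> 'c :: enc" and b :: "'a \<Rightarrow> nat"
  assumes body: "ptime (\<lambda>(x, y, acc). f x y acc)" and l: "ptime l" and a0: "ptime a0"
    and bnd: "pbound b"
    and acc: "\<And>x j. j \<le> length (l x) \<Longrightarrow> sz (fold (f x) (take j (l x)) (a0 x)) \<le> b x"
  shows "ptime (\<lambda>x. fold (f x) (l x) (a0 x))"
proof -
  obtain bl where l': "pbound bl" "\<And>a a'. a < a' \<Longrightarrow> \<exists>c. computes c a a' l bl"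
    using computes_copy[OF l] by blast
  obtain ba where a': "pbound ba" "\<And>a a'. a < a' \<Longrightarrow> \<exists>c. computes c a a' a0 ba"
    using computes_copy[OF a0] by blast
  let ?f = "\<lambda>(x, y, acc). f x y acc" and ?h = "\<lambda>x. fold (f x) (l x) (a0 x)"
  obtain bf where f: "pbound bf" "\<And>a. \<exists>c. computes c a a ?f bf"
    using ptimeE[OF body] by blast
  obtain d where d: "\<And>z. bf z \<le> (2 + sz z) ^ d"
    using f(1) unfolding pbound_def by blast
  note sl = ptime_pbound[OF l] and sa = ptime_pbound[OF a0]
  \<comment> \<open>\<open>M x\<close> exceeds by 2 the size of every argument
    \<open>(x, y, acc)\<close> given to the body, so the body costs at most \<open>M x ^ d\<close>;
    \<open>K x\<close> adds the surrounding assignments and bounds one iteration.\<close>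
  define M where "M x = 4 + sz x + sz (l x) + b x" for x
  define K where "K x = 10 * M x + M x ^ d" for x
  have M: "pbound M" unfolding M_def by (intro pbound_intros sl bnd)
  have K: "pbound K" unfolding K_def by (intro pbound_intros M)
  show ?thesis
  proof (rule ptimeI)
    have "sz (fold (f x) (l x) (a0 x)) \<le> b x" for x
      using acc[of "length (l x)" x] by simp
    then show "pbound (\<lambda>x. sz (fold (f x) (l x) (a0 x)))" by (rule pbound_mono[OF bnd])
    let ?t = "\<lambda>x. bl x + (ba x + ((2 * length (l x) + 1) * K x + b x))"
    have "pbound (\<lambda>x. length (l x))"
      by (rule pbound_mono[OF sl]) (rule length_le_sz)
    then show "pbound ?t" by (intro pbound_intros K bnd l' a')
    fix a
    obtain cl where cl: "computes cl a (a + 1) l bl" using l'(2)[of a "a + 1"] by auto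
    obtain ca where ca: "computes ca a (a + 2) a0 ba" using a'(2)[of a "a + 2"] by auto
    obtain cf where cf: "computes cf (a + 3) (a + 3) ?f bf" using f(2) by blast
    define body where "body =
      Seq (Assign (a + 3) (Cons (Var a) (Cons (Hd (Var (a + 1))) (Var (a + 2)))))
        (Seq cf (Seq (Assign (a + 2) (Var (a + 3))) (Assign (a + 1) (Tl (Var (a + 1))))))"
    define loop where "loop = While (Var (a + 1)) body"
    have "computes (Seq cl (Seq ca (Seq loop (Assign a (Var (a + 2)))))) a a ?h ?t"
    proof (rule computesI)
      fix x :: 'a and s :: state assume s: "s a = enc x"
      define Inv where "Inv r s' \<longleftrightarrow> (\<exists>j\<le>length (l x). r = drop j (l x) \<and> s' a = enc x \<and>
          s' (a + 1) = enc r \<and> s' (a + 2) = enc (fold (f x) (take j (l x)) (a0 x)) \<and>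
          (\<forall>i<a. s' i = s i))" for r s'
      have step: "runs body s' (K x) (Inv r)" if "Inv (y # r) s'" for y r s'
      proof -
        obtain j where j: "j \<le> length (l x)" "y # r = drop j (l x)" "s' a = enc x"
          "s' (a + 1) = enc (y # r)" "s' (a + 2) = enc (fold (f x) (take j (l x)) (a0 x))"
          "\<forall>i<a. s' i = s i"
          using \<open>Inv (y # r) s'\<close> unfolding Inv_def by blast
        let ?acc = "fold (f x) (take j (l x)) (a0 x)"
        let ?s1 = "s'(a + 3 := enc (x, y, ?acc))"
        have jl: "j < length (l x)" using j(2) by (metis drop_eq_Nil leI list.distinct(1))
        have y: "y = l x ! j" "r = drop (Suc j) (l x)"
          using j(2) Cons_nth_drop_Suc[OF jl] by (metis list.inject)+
        have tk: "take (Suc j) (l x) = take j (l x) @ [y]"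
          using take_Suc_conv_app_nth[OF jl] y by simp
        have acc': "f x y ?acc = fold (f x) (take (Suc j) (l x)) (a0 x)"
          by (simp add: tk)
        have b1: "sz ?acc \<le> b x" using acc[of j x] jl by simp
        have b2: "sz (f x y ?acc) \<le> b x" unfolding acc' using acc[of "Suc j" x] jl by simp
        have b3: "1 + sz y + sz r \<le> sz (l x)"
          using sz_drop_le[of j "l x"] j(2)[symmetric] by simp
        have b4: "sz (x, y, ?acc) + 2 \<le> M x" using b1 b3 unfolding M_def by simp
        have b5: "bf (x, y, ?acc) \<le> M x ^ d"
        proof (rule le_trans[OF d])
          show "(2 + sz (x, y, ?acc)) ^ d \<le> M x ^ d" using b4 by (intro power_mono) auto
        qed
        have A: "runs (Assign (a + 3) (Cons (Var a) (Cons (Hd (Var (a + 1))) (Var (a + 2))))) s'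
           (5 * M x) (\<lambda>s'. s' = ?s1)"
          using j(3-5) b3 b1 by (intro runs_Assign) (auto simp: sz_def M_def)
        have B: "runs cf ?s1 (M x ^ d)
           (\<lambda>s2. s2 (a + 3) = enc (f x y ?acc) \<and> (\<forall>i<a + 3. s2 i = s' i))"
          by (rule runs_conseq[OF computesD[OF cf, of _ "(x, y, ?acc)"]]) (use b5 in auto)
        have C: "runs (Seq (Assign (a + 2) (Var (a + 3))) (Assign (a + 1) (Tl (Var (a + 1)))))
            s2 (M x + 2 * M x) (Inv r)"
          if s2: "s2 (a + 3) = enc (f x y ?acc)" "\<forall>i<a + 3. s2 i = s' i" for s2
        proof (intro runs_Seq runs_Assign)
          show "exp_cost (Var (a + 3)) s2 \<le> M x"
            using s2 b2 by (simp add: sz_def M_def)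
          show "exp_cost (Tl (Var (a + 1))) (s2(a + 2 := evaluate (Var (a + 3)) s2)) \<le> 2 * M x"
            using s2 j(3-5) b3 by (simp add: sz_def M_def)
          show "Inv r (s2(a + 2 := evaluate (Var (a + 3)) s2, a + 1 :=
              evaluate (Tl (Var (a + 1))) (s2(a + 2 := evaluate (Var (a + 3)) s2))))"
            unfolding Inv_def using s2 j(3-6) jl y(2) acc' by (intro exI[of _ "Suc j"]) auto
        qed
        have "runs body s' (5 * M x + (M x ^ d + (M x + 2 * M x))) (Inv r)"
          unfolding body_def
          by (rule runs_SeqI[OF A], simp only:, rule runs_SeqI[OF B], rule C) blast+
        then show ?thesis by (rule runs_conseq) (auto simp: K_def)
      qed
      have test: "exp_cost (Var (a + 1)) s' \<le> K x \<and> (evaluate (Var (a + 1)) s' = Leaf \<longleftrightarrow> r = [])"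
        if "Inv r s'" for r s'
      proof -
        have "sz r \<le> sz (l x)" "s' (a + 1) = enc r"
          using that sz_drop_le unfolding Inv_def by auto
        then show ?thesis by (simp add: K_def M_def sz_def)
      qed
      have w: "runs loop s' ((2 * length (l x) + 1) * K x) (Inv [])" if "Inv (l x) s'" for s'
        unfolding loop_def by (rule runs_While[where Inv = Inv, OF step test that])
      have fin: "runs (Assign a (Var (a + 2))) s' (b x)
          (\<lambda>s'. s' a = enc (fold (f x) (l x) (a0 x)) \<and> (\<forall>i<a. s' i = s i))" if "Inv [] s'" for s'
      proof (rule runs_Assign)
        have "s' (a + 2) = enc (fold (f x) (l x) (a0 x))" "\<forall>i<a. s' i = s i"
          using that unfolding Inv_def by auto
        then show "exp_cost (Var (a + 2)) s' \<le> b x"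
          and "(s'(a := evaluate (Var (a + 2)) s')) a = enc (fold (f x) (l x) (a0 x)) \<and>
           (\<forall>i<a. (s'(a := evaluate (Var (a + 2)) s')) i = s i)"
          using acc[of "length (l x)" x] by (auto simp: sz_def)
      qed
      have init: "Inv (l x) s'"
        if "s1 (a + 1) = enc (l x)" "\<forall>i<a + 1. s1 i = s i" "s' (a + 2) = enc (a0 x)"
          "\<forall>i<a + 2. s' i = s1 i" for s1 s'
        unfolding Inv_def using that s by (intro exI[of _ 0]) auto
      show "runs (Seq cl (Seq ca (Seq loop (Assign a (Var (a + 2)))))) s (?t x)
         (\<lambda>s'. s' a = enc (fold (f x) (l x) (a0 x)) \<and> (\<forall>i<a. s' i = s i))"
      proof (rule runs_SeqI[OF computesD[OF cl, where x = x]], rule s, rule runs_SeqI)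
        fix s1 assume s1: "s1 (a + 1) = enc (l x) \<and> (\<forall>i<a + 1. s1 i = s i)"
        show "runs ca s1 (ba x) (\<lambda>s'. s' (a + 2) = enc (a0 x) \<and> (\<forall>i<a + 2. s' i = s1 i))"
          by (rule computesD[OF ca]) (use s s1 in simp)
        fix s2 assume "s2 (a + 2) = enc (a0 x) \<and> (\<forall>i<a + 2. s2 i = s1 i)"
        then have "Inv (l x) s2" using s1 by (intro init[of s1]) auto
        then show "runs (Seq loop (Assign a (Var (a + 2)))) s2 ((2 * length (l x) + 1) * K x + b x)
            (\<lambda>s'. s' a = enc (?h x) \<and> (\<forall>i<a. s' i = s i))"
          by (rule runs_SeqI[OF w fin])
      qed
    qed
    then show "\<exists>c. computes c a a ?h ?t" by blast
  qed
qed


text \<open>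
  With raw trees among the encoded types, a function like \<open>hd0\<close> below can be computed by cases one of
  which applies a tree operation that makes sense only in that case.
\<close>

instantiation data :: enc
begin
definition enc_data :: "data \<Rightarrow> data" where "enc_data x = x"
instance by standard (simp add: inj_def enc_data_def)
end

lemma ptime_fold_inv:
  fixes l :: "'a :: enc \<Rightarrow> 'b :: enc list" and a0 :: "'a \<Rightarrow> 'c :: enc" and b :: "'a \<Rightarrow> nat"
  assumes body: "ptime (\<lambda>p. f (fst p) (fst (snd p)) (snd (snd p)))" and l: "ptime l" and a0: "ptime a0"
    and bnd: "pbound b"
    and J0: "\<And>x. J x 0 (a0 x)"
    and J: "\<And>x j acc. j < length (l x) \<Longrightarrow> J x j acc \<Longrightarrow> J x (Suc j) (f x (l x ! j) acc)"
    and Jb: "\<And>x j acc. j \<le> length (l x) \<Longrightarrow> J x j acc \<Longrightarrow> sz acc \<le> b x"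
  shows "ptime (\<lambda>x. fold (f x) (l x) (a0 x))"
proof (rule ptime_fold[OF _ l a0 bnd])
  show "ptime (\<lambda>(x, y, acc). f x y acc)" using body by (simp add: case_prod_beta')
  have "J x j (fold (f x) (take j (l x)) (a0 x))" if "j \<le> length (l x)" for x j
    using that
  proof (induction j)
    case (Suc j)
    then show ?case using J[of j x] by (simp add: take_Suc_conv_app_nth)
  qed (simp add: J0)
  then show "sz (fold (f x) (take j (l x)) (a0 x)) \<le> b x" if "j \<le> length (l x)" for x j
    using Jb that by blast
qed

text \<open>An increment bounded independently of the accumulator sums to at most the length of the
  list times \<open>c x\<close>, so no blow-up can occur.\<close>

lemma ptime_fold_add:
  fixes l :: "'a :: enc \<Rightarrow> 'b :: enc list" and a0 :: "'a \<Rightarrow> 'c :: enc" and c :: "'a \<Rightarrow> nat"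
  assumes body: "ptime (\<lambda>p. f (fst p) (fst (snd p)) (snd (snd p)))" and l: "ptime l" and a0: "ptime a0"
    and bnd: "pbound c"
    and c: "\<And>x y acc. y \<in> set (l x) \<Longrightarrow> sz (f x y acc) \<le> sz acc + c x"
  shows "ptime (\<lambda>x. fold (f x) (l x) (a0 x))"
proof (rule ptime_fold_inv[OF body l a0, where J = "\<lambda>x j acc. sz acc \<le> sz (a0 x) + j * c x"
      and b = "\<lambda>x. sz (a0 x) + sz (l x) * c x"])
  show "pbound (\<lambda>x. sz (a0 x) + sz (l x) * c x)"
    by (intro pbound_intros ptime_pbound l a0 bnd)
  show "sz (f x (l x ! j) acc) \<le> sz (a0 x) + Suc j * c x"
    if "j < length (l x)" "sz acc \<le> sz (a0 x) + j * c x" for x j acc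
    using c[of "l x ! j" x acc] that by simp
  show "sz acc \<le> sz (a0 x) + sz (l x) * c x"
    if "j \<le> length (l x)" "sz acc \<le> sz (a0 x) + j * c x" for x j acc
  proof -
    have "j * c x \<le> sz (l x) * c x"
      using that(1) length_le_sz[of "l x"] by (intro mult_right_mono) auto
    then show ?thesis using that by linarith
  qed
qed simp

lemma ptime_elem_bound:
  fixes l :: "'a :: enc \<Rightarrow> 'b :: enc list"
  assumes "ptime (\<lambda>p. f (fst p) (snd p))" "ptime l"
  obtains c where "pbound c" "\<And>x y. y \<in> set (l x) \<Longrightarrow> sz (f x y) \<le> c x"
proof -
  obtain d where d: "\<And>p. sz (f (fst p) (snd p)) \<le> (2 + sz p) ^ d"
    using ptime_pbound[OF assms(1)] unfolding pbound_def by blast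
  show ?thesis
  proof (rule that)
    show "pbound (\<lambda>x. (3 + sz x + sz (l x)) ^ d)"
      by (intro pbound_intros ptime_pbound assms)
    fix x y assume y: "y \<in> set (l x)"
    have "sz (f x y) \<le> (2 + sz (x, y)) ^ d" using d[of "(x, y)"] by simp
    also have "\<dots> \<le> (3 + sz x + sz (l x)) ^ d"
      using sz_elem_le[OF y] by (intro power_mono) auto
    finally show "sz (f x y) \<le> (3 + sz x + sz (l x)) ^ d" .
  qed
qed


subsection \<open>Lists and numbers\<close>

named_theorems ptime_intros

lemmas [ptime_intros] = ptime_id ptime_const ptime_Pair ptime_fst ptime_snd ptime_eq ptime_if

lemma ptime_Not [ptime_intros]: "ptime p \<Longrightarrow> ptime (\<lambda>x. \<not> p x)"
  by (rule ptime_recode[OF ptime_if[of p "\<lambda>_. False" "\<lambda>_. True"]]) (simp_all add: ptime_const)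

lemma ptime_conj [ptime_intros]: "ptime p \<Longrightarrow> ptime q \<Longrightarrow> ptime (\<lambda>x. p x \<and> q x)"
  by (rule ptime_recode[OF ptime_if[of p q "\<lambda>_. False"]]) (simp_all add: ptime_const)

lemma ptime_disj [ptime_intros]: "ptime p \<Longrightarrow> ptime q \<Longrightarrow> ptime (\<lambda>x. p x \<or> q x)"
  by (rule ptime_recode[OF ptime_if[of p "\<lambda>_. True" q]]) (simp_all add: ptime_const)

lemma ptime_Some [ptime_intros]: "ptime f \<Longrightarrow> ptime (\<lambda>x. Some (f x))"
  by (rule ptime_recode[of "\<lambda>x. (f x, ())"]) (auto intro: ptime_intros)

lemma ptime_Suc [ptime_intros]: "ptime f \<Longrightarrow> ptime (\<lambda>x. Suc (f x))"
  by (rule ptime_recode[of "\<lambda>x. ((), f x)"]) (auto intro: ptime_intros)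

lemma ptime_Cons [ptime_intros]: "ptime f \<Longrightarrow> ptime g \<Longrightarrow> ptime (\<lambda>x. f x # g x)"
  by (rule ptime_recode[of "\<lambda>x. (f x, g x)"]) (auto intro: ptime_intros)

lemma ptime_units: "ptime f \<Longrightarrow> ptime (\<lambda>x. replicate (f x) ())"
  by (rule ptime_recode[of f]) (auto simp: enc_nat_units)

lemma ptime_tl [ptime_intros]: "ptime f \<Longrightarrow> ptime (\<lambda>x. tl (f x))"
  by (rule ptime_comp[OF _ ptime_tl_prim])

text \<open>\<open>hd []\<close> is an unspecified value, which no program can be shown to compute;
  the default makes the function total.\<close>

definition hd0 :: "'a \<Rightarrow> 'a list \<Rightarrow> 'a" where
  "hd0 d xs = (case xs of [] \<Rightarrow> d | x # _ \<Rightarrow> x)"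

lemma hd0_simps [simp]: "hd0 d [] = d" "hd0 d (x # xs) = x"
  by (simp_all add: hd0_def)

lemma ptime_hd0 [ptime_intros]:
  fixes g :: "'a :: enc \<Rightarrow> 'b :: enc list"
  assumes "ptime f" "ptime g" shows "ptime (\<lambda>x. hd0 (f x) (g x))"
proof (rule ptime_recode)
  have hd: "ptime (\<lambda>xs :: 'b list. hd_data (enc xs))"
  proof (rule ptime_exp[where e = "\<lambda>a. Hd (Var a)" and b = "\<lambda>x. 2 * sz x"])
    show "pbound (\<lambda>xs :: 'b list. sz (hd_data (enc xs)))"
    proof (rule pbound_mono[OF pbound_sz])
      show "sz (hd_data (enc xs)) \<le> sz xs" for xs :: "'b list"
        by (cases xs) (auto simp: sz_def enc_data_def)
    qed
    show "exp_cost (Hd (Var a)) s \<le> 2 * sz xs" if "s a = enc xs" for a s and xs :: "'b list"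
      using that by (cases xs) (auto simp: sz_def)
  qed (auto simp: enc_data_def intro!: pbound_intros)
  have enc: "ptime (\<lambda>x. enc (f x))"
    by (rule ptime_recode[OF assms(1)]) (simp add: enc_data_def)
  show "ptime (\<lambda>x. if g x = [] then enc (f x) else hd_data (enc (g x)))"
    by (intro ptime_intros assms enc ptime_comp[OF assms(2) hd])
  show "enc (if g x = [] then enc (f x) else hd_data (enc (g x))) = enc (hd0 (f x) (g x))" for x
    by (cases "g x") (auto simp: enc_data_def)
qed

definition the0 :: "'a \<Rightarrow> 'a option \<Rightarrow> 'a" where
  "the0 d z = (case z of None \<Rightarrow> d | Some x \<Rightarrow> x)"

lemma the0_simps [simp]: "the0 d None = d" "the0 d (Some x) = x"
  by (simp_all add: the0_def)

lemma ptime_the0 [ptime_intros]: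
  fixes g :: "'a :: enc \<Rightarrow> 'b :: enc option"
  assumes "ptime f" "ptime g" shows "ptime (\<lambda>x. the0 (f x) (g x))"
proof -
  let ?g = "\<lambda>x. case g x of None \<Rightarrow> [] | Some y \<Rightarrow> [y]"
  have "ptime ?g"
    by (rule ptime_recode[OF assms(2)]) (simp split: option.splits)
  then have "ptime (\<lambda>x. hd0 (f x) (?g x))" by (intro ptime_intros assms)
  moreover have "hd0 (f x) (?g x) = the0 (f x) (g x)" for x by (simp split: option.splits)
  ultimately show ?thesis by simp
qed

lemma sz_append: "sz (xs @ ys) + 1 = sz xs + sz ys"
  by (induction xs) auto

lemma ptime_rev [ptime_intros]:
  assumes "ptime l" shows "ptime (\<lambda>x. rev (l x))"
proof -
  have "ptime (\<lambda>x. fold (\<lambda>y acc. y # acc) (l x) [])"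
  proof (rule ptime_fold_add[where c = "\<lambda>x. 1 + sz (l x)"])
    show "pbound (\<lambda>x. 1 + sz (l x))" by (intro pbound_intros ptime_pbound assms)
  qed (auto intro!: ptime_intros assms dest: sz_elem_le)
  then show ?thesis by (simp add: rev_conv_fold)
qed

lemma ptime_append [ptime_intros]:
  fixes l :: "'a :: enc \<Rightarrow> 'b :: enc list"
  assumes "ptime l" "ptime l'" shows "ptime (\<lambda>x. l x @ l' x)"
proof -
  have "ptime (\<lambda>x. fold (\<lambda>y acc. y # acc) (rev (l x)) (l' x))"
  proof (rule ptime_fold_add[where c = "\<lambda>x. 1 + sz (l x)"])
    show "pbound (\<lambda>x. 1 + sz (l x))" by (intro pbound_intros ptime_pbound assms)
  qed (auto intro!: ptime_intros assms dest: sz_elem_le)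
  moreover have "fold (\<lambda>y acc. y # acc) (rev xs) ys = xs @ ys" for xs ys :: "'b list"
    by (induction xs arbitrary: ys) auto
  ultimately show ?thesis by simp
qed

lemma ptime_map [ptime_intros]:
  fixes l :: "'a :: enc \<Rightarrow> 'b :: enc list"
  assumes f: "ptime (\<lambda>p. f (fst p) (snd p))" and l: "ptime l"
  shows "ptime (\<lambda>x. map (f x :: 'b \<Rightarrow> 'c :: enc) (l x))"
proof -
  obtain c where c: "pbound c" "\<And>x y. y \<in> set (l x) \<Longrightarrow> sz (f x y) \<le> c x"
    using ptime_elem_bound[OF assms] by blast
  have "ptime (\<lambda>x. fold (\<lambda>y acc. f x y # acc) (l x) [])"
  proof (rule ptime_fold_add[where c = "\<lambda>x. 1 + c x"])
    have "ptime (\<lambda>p :: 'a \<times> 'b \<times> 'c list. (fst p, fst (snd p)))" by (intro ptime_intros)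
    from ptime_comp[OF this f]
    have "ptime (\<lambda>p :: 'a \<times> 'b \<times> 'c list. f (fst p) (fst (snd p)))" by simp
    then show "ptime (\<lambda>p. f (fst p) (fst (snd p)) # snd (snd p))" by (intro ptime_intros)
    show "pbound (\<lambda>x. 1 + c x)" by (intro pbound_intros c)
  qed (auto intro!: ptime_intros assms c)
  then have "ptime (\<lambda>x. rev (fold (\<lambda>y acc. f x y # acc) (l x) []))" by (intro ptime_intros)
  moreover have "fold (\<lambda>y acc. f x y # acc) xs ys = rev (map (f x) xs) @ ys" for x xs ys
    by (induction xs arbitrary: ys) auto
  ultimately show ?thesis by simp
qed

lemma ptime_concat [ptime_intros]:
  fixes l :: "'a :: enc \<Rightarrow> 'b :: enc list list"
  assumes "ptime l" shows "ptime (\<lambda>x. concat (l x))"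
proof -
  have "ptime (\<lambda>x. fold (\<lambda>y acc. acc @ y) (l x) [])"
  proof (rule ptime_fold_add[where c = "\<lambda>x. sz (l x)"])
    show "sz (acc @ y) \<le> sz acc + sz (l x)" if "y \<in> set (l x)" for x y acc
      using sz_append[of acc y] sz_elem_le[OF that] by simp
  qed (auto intro!: ptime_intros assms ptime_pbound)
  moreover have "fold (\<lambda>y acc. acc @ y) xs ys = ys @ concat xs" for xs and ys :: "'b list"
    by (induction xs arbitrary: ys) auto
  ultimately show ?thesis by simp
qed

lemma ptime_filter [ptime_intros]:
  assumes f: "ptime (\<lambda>p. f (fst p) (snd p))" and l: "ptime l"
  shows "ptime (\<lambda>x. filter (f x) (l x))"
proof -
  have "ptime (\<lambda>x. concat (map (\<lambda>y. if f x y then [y] else []) (l x)))"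
    by (intro ptime_intros assms)
  moreover have "concat (map (\<lambda>y. if f x y then [y] else []) xs) = filter (f x) xs" for x xs
    by (induction xs) auto
  ultimately show ?thesis by simp
qed

lemma ptime_length [ptime_intros]:
  assumes "ptime l" shows "ptime (\<lambda>x. length (l x))"
proof (rule ptime_recode)
  show "ptime (\<lambda>x. map (\<lambda>_. ()) (l x))" by (intro ptime_intros assms)
qed (simp add: enc_nat_units map_replicate_const)

lemma ptime_drop [ptime_intros]:
  fixes l :: "'a :: enc \<Rightarrow> 'b :: enc list"
  assumes "ptime i" "ptime l" shows "ptime (\<lambda>x. drop (i x) (l x))"
proof -
  have "ptime (\<lambda>x. fold (\<lambda>_ acc. tl acc) (replicate (i x) ()) (l x))"
  proof (rule ptime_fold_add[where c = "\<lambda>_. 0"])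
    show "sz (tl acc) \<le> sz acc + 0" for acc :: "'b list" by (cases acc) auto
  qed (auto intro!: ptime_intros assms ptime_units pbound_const)
  moreover have "fold (\<lambda>_ acc. tl acc) (replicate m ()) xs = drop m xs" for m and xs :: "'b list"
    by (induction m arbitrary: xs) (auto simp: drop_Suc)
  ultimately show ?thesis by simp
qed

lemma ptime_list_ex [ptime_intros]:
  assumes "ptime (\<lambda>p. f (fst p) (snd p))" and "ptime l"
  shows "ptime (\<lambda>x. list_ex (f x) (l x))"
proof -
  have "ptime (\<lambda>x. \<not> filter (f x) (l x) = [])" by (intro ptime_intros assms)
  moreover have "filter (f x) (l x) \<noteq> [] \<longleftrightarrow> list_ex (f x) (l x)" for x
    by (simp add: list_ex_iff filter_empty_conv)
  ultimately show ?thesis by simp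
qed

lemma ptime_member [ptime_intros]:
  assumes "ptime f" "ptime l" shows "ptime (\<lambda>x. f x \<in> set (l x))"
proof -
  have "ptime (\<lambda>x. list_ex (\<lambda>y. y = f x) (l x))"
    by (intro ptime_intros assms ptime_comp[OF _ assms(1)])
  then show ?thesis by (simp add: list_ex_iff)
qed

definition get :: "'a \<Rightarrow> 'a list \<Rightarrow> nat \<Rightarrow> 'a" where
  "get d xs i = hd0 d (drop i xs)"

lemma get_nth: "i < length xs \<Longrightarrow> get d xs i = xs ! i"
  unfolding get_def by (simp add: Cons_nth_drop_Suc[symmetric])

lemma get_default: "length xs \<le> i \<Longrightarrow> get d xs i = d"
  unfolding get_def by simp

lemma ptime_get [ptime_intros]:
  "ptime d \<Longrightarrow> ptime l \<Longrightarrow> ptime i \<Longrightarrow> ptime (\<lambda>x. get (d x) (l x) (i x))"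
  unfolding get_def by (intro ptime_intros)

lemma ptime_plus [ptime_intros]:
  assumes "ptime a" "ptime b" shows "ptime (\<lambda>x. a x + b x :: nat)"
proof -
  have "ptime (\<lambda>x. length (replicate (a x) () @ replicate (b x) ()))"
    by (intro ptime_intros ptime_units assms)
  then show ?thesis by simp
qed

lemma ptime_minus [ptime_intros]:
  assumes "ptime a" "ptime b" shows "ptime (\<lambda>x. a x - b x :: nat)"
proof -
  have "ptime (\<lambda>x. length (drop (b x) (replicate (a x) ())))"
    by (intro ptime_intros ptime_units assms)
  then show ?thesis by simp
qed

lemma ptime_times [ptime_intros]:
  assumes "ptime a" "ptime b" shows "ptime (\<lambda>x. a x * b x :: nat)"
proof -
  have "ptime (\<lambda>x. length (concat (map (\<lambda>_. replicate (b x) ()) (replicate (a x) ()))))"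
    by (intro ptime_intros ptime_units ptime_comp[OF _ assms(2)] assms)
  then show ?thesis by (simp add: length_concat sum_list_replicate)
qed

lemma ptime_le [ptime_intros]:
  assumes "ptime a" "ptime b" shows "ptime (\<lambda>x. a x \<le> (b x :: nat))"
proof -
  have "ptime (\<lambda>x. a x - b x = 0)"
    by (intro ptime_intros assms)
  then show ?thesis by simp
qed

lemma ptime_less [ptime_intros]:
  assumes "ptime a" "ptime b" shows "ptime (\<lambda>x. a x < (b x :: nat))"
  unfolding Suc_le_eq[symmetric] by (intro ptime_intros assms)

lemma ptime_upt [ptime_intros]:
  assumes "ptime a" "ptime b" shows "ptime (\<lambda>x. [a x..<b x])"
proof -
  \<comment> \<open>The length of the accumulator is itself the next number to append, so no
    separate counter is carried.\<close>
  have "ptime (\<lambda>x. fold (\<lambda>_ acc. acc @ [length acc]) (replicate (b x) ()) [])"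
  proof (rule ptime_fold_inv[where J = "\<lambda>_ j acc. acc = [0..<j]"
        and b = "\<lambda>x. 1 + b x * (1 + (2 * b x + 1))"])
    have *: "pbound (\<lambda>x. b x)"
      by (rule pbound_mono[OF ptime_pbound[OF assms(2)]]) simp
    show "pbound (\<lambda>x. 1 + b x * (1 + (2 * b x + 1)))" by (intro pbound_intros *)
    show "sz acc \<le> 1 + b x * (1 + (2 * b x + 1))"
      if "j \<le> length (replicate (b x) ())" "acc = [0..<j]" for x j acc
    proof -
      have "sz acc \<le> 1 + length acc * (1 + (2 * b x + 1))"
        by (rule sz_list_le) (use that in auto)
      also have "\<dots> \<le> 1 + b x * (1 + (2 * b x + 1))"
        using that by (intro add_mono mult_right_mono) auto
      finally show ?thesis .
    qed
  qed (auto intro!: ptime_intros ptime_units assms)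
  moreover have "fold (\<lambda>_ acc. acc @ [length acc]) (replicate m ()) [] = [0..<m]" for m
    by (induction m) (simp_all add: replicate_app_Cons_same[symmetric] replicate_append_same[symmetric] del: replicate.simps)
  ultimately have "ptime (\<lambda>x. [0..<b x])" by simp
  then have "ptime (\<lambda>x. drop (a x) [0..<b x])" by (intro ptime_intros assms)
  then show ?thesis by simp
qed

lemma ptime_replicate [ptime_intros]:
  assumes "ptime m" "ptime f" shows "ptime (\<lambda>x. replicate (m x) (f x))"
proof -
  have "ptime (\<lambda>x. map (\<lambda>_. f x) (replicate (m x) ()))"
    by (intro ptime_intros ptime_units ptime_comp[OF _ assms(2)] assms)
  then show ?thesis by simp
qed

lemma ptime_program:
  assumes "ptime f"
  obtains A p where "\<And>x. \<exists>T. returns A (enc x) T (enc (f x)) \<and> T \<le> poly p (sz x)"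
proof -
  obtain b where b: "pbound b" "\<And>a. \<exists>c. computes c a a f b"
    using ptimeE[OF assms] by blast
  obtain d where d: "\<And>x. b x \<le> (2 + sz x) ^ d"
    using b(1) unfolding pbound_def by blast
  obtain A where A: "computes A 0 0 f b" using b(2) by blast
  show ?thesis
  proof (rule that)
    fix x
    have "runs A ((\<lambda>_. Leaf)(0 := enc x)) (b x) (\<lambda>s'. s' 0 = enc (f x))"
      by (rule runs_conseq[OF computesD[OF A, of _ x]]) auto
    then obtain T s where "exec A ((\<lambda>_. Leaf)(0 := enc x)) T s" "T \<le> b x" "s 0 = enc (f x)"
      unfolding runs_def by blast
    moreover have "b x \<le> poly ([:2, 1:] ^ d) (sz x)" using d[of x] by simp
    ultimately show "\<exists>T. returns A (enc x) T (enc (f x)) \<and> T \<le> poly ([:2, 1:] ^ d) (sz x)"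
      unfolding returns_def by (meson le_trans)
  qed
qed


section \<open>Broadcasting plans\<close>

text \<open>
  From here on rounds are numbered from 0, and \<open>E t u v\<close> says that \<open>u\<close> and \<open>v\<close> are adjacent in round
  \<open>t\<close>. A plan \<open>\<pi>\<close> names the token \<open>\<pi> t u\<close> that \<open>u\<close> is to broadcast in round \<open>t\<close>; it is carried out
  only if \<open>u\<close> has that token, so that every plan yields a valid schedule.
\<close>

fun has :: "(nat \<Rightarrow> nat \<Rightarrow> nat \<Rightarrow> bool) \<Rightarrow> (nat \<Rightarrow> nat \<Rightarrow> bool) \<Rightarrow> (nat \<Rightarrow> nat \<Rightarrow> nat option) \<Rightarrow>
    nat \<Rightarrow> nat \<Rightarrow> nat \<Rightarrow> bool" where
  "has E I0 \<pi> 0 u i = I0 u i"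
| "has E I0 \<pi> (Suc t) u i =
     (has E I0 \<pi> t u i \<or> (\<exists>v. E t v u \<and> \<pi> t v = Some i \<and> has E I0 \<pi> t v i))"

lemma has_mono: "has E I0 \<pi> t u i \<Longrightarrow> t \<le> t' \<Longrightarrow> has E I0 \<pi> t' u i"
  by (induction t') (auto simp: le_Suc_eq)

locale network =
  fixes n k T :: nat and E :: "nat \<Rightarrow> nat \<Rightarrow> nat \<Rightarrow> bool" and I0 :: "nat \<Rightarrow> nat \<Rightarrow> bool"
  assumes n_pos: "n \<ge> 1"
    and conn: "\<And>t. t < T \<Longrightarrow> connected_graph n {(u, v). E t u v}"
    and present: "\<And>i. i < k \<Longrightarrow> \<exists>u<n. I0 u i"
begin

lemma E_less: "t < T \<Longrightarrow> E t u v \<Longrightarrow> u < n \<and> v < n"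
  using conn[of t] unfolding connected_graph_def by auto

lemma E_sym: "t < T \<Longrightarrow> E t u v \<Longrightarrow> E t v u"
  using conn[of t] unfolding connected_graph_def sym_def by auto

lemma boundary:
  assumes "t < T" "U \<subseteq> {..<n}" "u \<in> U" "v < n" "v \<notin> U"
  shows "\<exists>x\<in>U. \<exists>y. y < n \<and> y \<notin> U \<and> E t x y"
proof -
  have "(u, v) \<in> {(u, v). E t u v}\<^sup>*"
    using conn[OF assms(1)] assms unfolding connected_graph_def by auto
  then show ?thesis
    using assms(5)
  proof (induction rule: rtrancl_induct)
    case (step y z)
    then show ?case using E_less[OF assms(1)] by (cases "y \<in> U") auto
  qed (use assms in auto)
qed

end


subsection \<open>Flooding\<close>

primrec reach :: "(nat \<Rightarrow> nat \<Rightarrow> nat \<Rightarrow> bool) \<Rightarrow> nat \<Rightarrow> nat \<Rightarrow> nat \<Rightarrow> nat \<Rightarrow> bool" where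
  "reach E 0 t u v \<longleftrightarrow> u = v"
| "reach E (Suc d) t u v \<longleftrightarrow> (\<exists>w. (w = u \<or> E t u w) \<and> reach E d (Suc t) w v)"

lemma reach_has:
  assumes "reach E d t u v" "has E I0 \<pi> t u i"
    and "\<And>s w x. t \<le> s \<Longrightarrow> s < t + d \<Longrightarrow> E s w x \<Longrightarrow> \<pi> s w = Some i"
  shows "has E I0 \<pi> (t + d) v i"
  using assms
proof (induction d arbitrary: t u)
  case (Suc d)
  obtain w where w: "w = u \<or> E t u w" "reach E d (Suc t) w v" using Suc.prems(1) by auto
  have "has E I0 \<pi> (Suc t) w i" using w(1) Suc.prems(2) Suc.prems(3)[of t u w] by auto
  then show ?case using Suc.IH[OF w(2)] Suc.prems(3) by simp
qed simp

definition spread :: "nat \<Rightarrow> (nat \<Rightarrow> nat \<Rightarrow> nat \<Rightarrow> bool) \<Rightarrow> nat \<Rightarrow> nat list \<Rightarrow> nat list" where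
  "spread n E t S = filter (\<lambda>v. v \<in> set S \<or> list_ex (\<lambda>u. E t u v) S) [0..<n]"

definition flood :: "nat \<Rightarrow> (nat \<Rightarrow> nat \<Rightarrow> nat \<Rightarrow> bool) \<Rightarrow> nat \<Rightarrow> nat \<Rightarrow> nat list \<Rightarrow> nat list" where
  "flood n E t d S = fold (spread n E) [t..<t + d] S"

context network
begin

lemma set_flood:
  assumes "set S \<subseteq> {..<n}" "t + d \<le> T"
  shows "set (flood n E t d S) = {v. \<exists>u\<in>set S. reach E d t u v}"
  using assms
proof (induction d arbitrary: t S)
  case (Suc d)
  have s: "set (spread n E t S) = {v. \<exists>u\<in>set S. v = u \<or> E t u v}"
    using Suc.prems E_less[of t] unfolding spread_def by (auto simp: list_ex_iff)
  have "flood n E t (Suc d) S = flood n E (Suc t) d (spread n E t S)"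
    unfolding flood_def by (simp add: upt_rec del: upt_Suc)
  also have "set \<dots> = {v. \<exists>u\<in>set (spread n E t S). reach E d (Suc t) u v}"
    by (rule Suc.IH) (use Suc.prems in \<open>auto simp: spread_def\<close>)
  finally show ?case unfolding s by auto
qed (simp add: flood_def)

text \<open>The induction lengthens the window at its start, with the target fixed. The set of
  sources only grows, since a node may wait, and unless it is everything, connectivity in the new
  first round provides an edge into it from outside.\<close>

lemma card_reaching:
  assumes "v < n" "t + d \<le> T"
  shows "min n (Suc d) \<le> card {u. u < n \<and> reach E d t u v}"
  using assms
proof (induction d arbitrary: t)
  case 0
  have "{u. u < n \<and> reach E 0 t u v} = {v}" using 0 by auto
  then show ?case by simp
next
  case (Suc d)
  let ?U = "{u. u < n \<and> reach E d (Suc t) u v}" and ?U' = "{u. u < n \<and> reach E (Suc d) t u v}"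
  have IH: "min n (Suc d) \<le> card ?U" using Suc by simp
  have sub: "?U \<subseteq> ?U'" by auto
  show ?case
  proof (cases "?U = {..<n}")
    case True
    then have "?U' = {..<n}" using sub by auto
    then show ?thesis by simp
  next
    case False
    obtain u where "u \<in> ?U"
    proof (cases "?U = {}")
      case True
      then show ?thesis using IH n_pos unfolding True by simp
    qed (use that in blast)
    moreover obtain w where "w < n" "w \<notin> ?U" using False by auto
    ultimately obtain x y where xy: "x \<in> ?U" "y < n" "y \<notin> ?U" "E t x y"
      using boundary[of t ?U u w] Suc.prems by fastforce
    have "insert y ?U \<subseteq> ?U'" using xy sub E_sym[of t x y] Suc.prems by auto
    then have "card (insert y ?U) \<le> card ?U'" by (intro card_mono) auto
    then show ?thesis using IH xy by simp
  qed
qed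

end


subsection \<open>Hitting all flooding windows\<close>

text \<open>Only the number of missed pairs matters, so the window index is not recorded in the
  list.\<close>

definition missed :: "nat \<Rightarrow> nat \<Rightarrow> (nat \<Rightarrow> nat \<Rightarrow> nat \<Rightarrow> bool) \<Rightarrow> nat \<Rightarrow> nat \<Rightarrow> nat list \<Rightarrow> nat list" where
  "missed n k E t d H =
     concat (map (\<lambda>i. filter (\<lambda>v. v \<notin> set (flood n E (t + i * d) d H)) [0..<n]) [0..<k])"

text \<open>The test says that \<open>h\<close> shrinks the number of missed pairs by the factor
  \<open>1 - d / n\<close>, multiplied out to stay within the natural numbers. Any such node will
  do; no minimum is taken.\<close>

definition hitter :: "nat \<Rightarrow> nat \<Rightarrow> (nat \<Rightarrow> nat \<Rightarrow> nat \<Rightarrow> bool) \<Rightarrow> nat \<Rightarrow> nat \<Rightarrow> nat list \<Rightarrow> nat" where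
  "hitter n k E t d H = hd0 0 (filter (\<lambda>h.
     n * length (missed n k E t d (h # H)) \<le> (n - d) * length (missed n k E t d H)) [0..<n])"

definition hitters :: "nat \<Rightarrow> nat \<Rightarrow> (nat \<Rightarrow> nat \<Rightarrow> nat \<Rightarrow> bool) \<Rightarrow> nat \<Rightarrow> nat \<Rightarrow> nat \<Rightarrow> nat list" where
  "hitters n k E t d m = fold (\<lambda>_ H. hitter n k E t d H # H) [0..<m] []"

lemma hd0_filter:
  assumes "\<exists>x\<in>set xs. P x"
  shows "hd0 d (filter P xs) \<in> set xs \<and> P (hd0 d (filter P xs))"
proof -
  have "hd0 d (filter P xs) \<in> set (filter P xs)"
    using assms by (cases "filter P xs") (auto simp: filter_empty_conv)
  then show ?thesis by simp
qed

context network
begin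

definition miss :: "nat \<Rightarrow> nat \<Rightarrow> nat set \<Rightarrow> (nat \<times> nat) set" where
  "miss t d H = {(i, v). i < k \<and> v < n \<and> (\<forall>u\<in>H. \<not> reach E d (t + i * d) u v)}"

lemma finite_miss: "finite (miss t d H)"
  by (rule finite_subset[of _ "{..<k} \<times> {..<n}"]) (auto simp: miss_def)

lemma window_le: "i < k \<Longrightarrow> t + k * d \<le> T \<Longrightarrow> t + i * d + d \<le> (T :: nat)"
proof -
  assume "i < k" "t + k * d \<le> T"
  then have "Suc i * d \<le> k * d" by (intro mult_right_mono) auto
  then show ?thesis using \<open>t + k * d \<le> T\<close> by simp
qed

lemma length_missed:
  assumes "set H \<subseteq> {..<n}" "t + k * d \<le> T"
  shows "length (missed n k E t d H) = card (miss t d (set H))"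
proof -
  let ?M = "\<lambda>i. {v. v < n \<and> (\<forall>u\<in>set H. \<not> reach E d (t + i * d) u v)}"
  have fl: "set (flood n E (t + i * d) d H) = {v. \<exists>u\<in>set H. reach E d (t + i * d) u v}"
    if "i < k" for i
    by (rule set_flood[OF assms(1)]) (rule window_le[OF that assms(2)])
  have "length (filter (\<lambda>v. v \<notin> set (flood n E (t + i * d) d H)) [0..<n]) = card (?M i)"
    if "i < k" for i
  proof -
    let ?f = "filter (\<lambda>v. v \<notin> set (flood n E (t + i * d) d H)) [0..<n]"
    have "length ?f = card (set ?f)" by (rule distinct_card[symmetric]) simp
    also have "set ?f = ?M i" using fl[OF that] by auto
    finally show ?thesis .
  qed
  then have "length (missed n k E t d H) = (\<Sum>i\<in>{..<k}. card (?M i))"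
    unfolding missed_def length_concat map_map
    by (simp add: comp_def interv_sum_list_conv_sum_set_nat atLeast0LessThan)
  also have "\<dots> = card (SIGMA i:{..<k}. ?M i)" by (subst card_SigmaI) auto
  also have "(SIGMA i:{..<k}. ?M i) = miss t d (set H)" by (auto simp: miss_def)
  finally show ?thesis .
qed

text \<open>Averaging by double counting: each missed pair is reached from at least
  \<open>min n (Suc d)\<close> nodes, so at most \<open>n - d\<close> choices of \<open>h\<close>
  leave it missed. If every \<open>h\<close> were bad, the sum over all \<open>h\<close> would
  exceed this.\<close>

lemma hitter_exists:
  assumes "t + k * d \<le> T"
  shows "\<exists>h<n. n * card (miss t d (insert h H)) \<le> (n - d) * card (miss t d H)"
proof (rule ccontr)
  assume "\<not> ?thesis"
  then have less: "(n - d) * card (miss t d H) < n * card (miss t d (insert h H))" if "h < n" for h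
    using that by (meson not_le)
  let ?R = "\<lambda>h p. reach E d (t + fst p * d) h (snd p)"
  have "n * ((n - d) * card (miss t d H)) = (\<Sum>h<n. (n - d) * card (miss t d H))" by simp
  also have "\<dots> < (\<Sum>h<n. n * card (miss t d (insert h H)))"
    using less n_pos by (intro sum_strict_mono) (auto simp: lessThan_empty_iff)
  also have "\<dots> = n * (\<Sum>h<n. card (miss t d (insert h H)))" by (simp add: sum_distrib_left)
  also have "(\<Sum>h<n. card (miss t d (insert h H))) = card (SIGMA h:{..<n}. miss t d (insert h H))"
    by (subst card_SigmaI) (auto simp: finite_miss)
  also have "\<dots> = card (SIGMA p:miss t d H. {h. h < n \<and> \<not> ?R h p})"
    by (rule bij_betw_same_card[of "\<lambda>(a, b). (b, a)"])
      (auto simp: bij_betw_def inj_on_def miss_def image_iff)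
  also have "\<dots> = (\<Sum>p\<in>miss t d H. card {h. h < n \<and> \<not> ?R h p})"
    by (subst card_SigmaI) (auto simp: finite_miss)
  also have "\<dots> \<le> (\<Sum>p\<in>miss t d H. n - d)"
  proof (rule sum_mono)
    fix p assume p: "p \<in> miss t d H"
    let ?U = "{h. h < n \<and> ?R h p}"
    have "min n (Suc d) \<le> card ?U"
      by (rule card_reaching) (use p window_le[OF _ assms] in \<open>auto simp: miss_def\<close>)
    moreover have "{h. h < n \<and> \<not> ?R h p} = {..<n} - ?U" by auto
    moreover have "card ({..<n} - ?U) = n - card ?U" by (subst card_Diff_subset) auto
    ultimately show "card {h. h < n \<and> \<not> ?R h p} \<le> n - d" by simp
  qed
  finally show False by (simp add: mult.commute)
qed

lemma hitters_miss:
  assumes "t + k * d \<le> T"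
  shows "set (hitters n k E t d m) \<subseteq> {..<n} \<and> length (hitters n k E t d m) = m \<and>
     n ^ m * card (miss t d (set (hitters n k E t d m))) \<le> (n - d) ^ m * (n * k)"
proof (induction m)
  case 0
  have "card (miss t d {}) \<le> card ({..<k} \<times> {..<n})" by (intro card_mono) (auto simp: miss_def)
  then show ?case by (simp add: hitters_def mult.commute)
next
  case (Suc m)
  define H where "H = hitters n k E t d m"
  have H: "set H \<subseteq> {..<n}" "length H = m"
    "n ^ m * card (miss t d (set H)) \<le> (n - d) ^ m * (n * k)"
    using Suc by (auto simp: H_def)
  have Suc_eq: "hitters n k E t d (Suc m) = hitter n k E t d H # H"
    by (simp add: hitters_def H_def)
  let ?h = "hitter n k E t d H"
  have "\<exists>h\<in>set [0..<n]. n * length (missed n k E t d (h # H)) \<le> (n - d) * length (missed n k E t d H)"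
    using hitter_exists[OF assms, of "set H"] H(1) assms by (auto simp: length_missed)
  from hd0_filter[OF this, of 0]
  have h: "?h < n" "n * length (missed n k E t d (?h # H)) \<le> (n - d) * length (missed n k E t d H)"
    unfolding hitter_def by auto
  then have h': "n * card (miss t d (set (?h # H))) \<le> (n - d) * card (miss t d (set H))"
    using H(1) assms by (simp add: length_missed)
  have "n ^ Suc m * card (miss t d (set (?h # H))) = n ^ m * (n * card (miss t d (set (?h # H))))"
    by simp
  also have "\<dots> \<le> n ^ m * ((n - d) * card (miss t d (set H)))"
    by (intro mult_left_mono h') simp
  also have "\<dots> = (n - d) * (n ^ m * card (miss t d (set H)))" by simp
  also have "\<dots> \<le> (n - d) * ((n - d) ^ m * (n * k))" by (intro mult_left_mono H(3)) simp
  finally show ?case unfolding Suc_eq using h(1) H by simp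
qed

text \<open>At most \<open>n * k \<le> n * n\<close> pairs are missed initially, which is below
  \<open>exp (2 L)\<close> because \<open>n < 2 ^ L\<close>; this square is the origin of the factor
  2 in \<open>2 * n * L\<close>. The factor \<open>(1 - d / n) ^ m \<le> exp (- d m / n)\<close>
  brings the number below 1, hence to 0.\<close>

lemma hitters_hit:
  assumes "t + k * d \<le> T" "k \<le> n" "n < 2 ^ L" "2 * n * L < d * m" "i < k" "v < n"
  shows "\<exists>u\<in>set (hitters n k E t d m). reach E d (t + i * d) u v"
proof -
  define H where "H = hitters n k E t d m"
  have le: "n ^ m * card (miss t d (set H)) \<le> (n - d) ^ m * (n * k)"
    using hitters_miss[OF assms(1), of m] by (simp add: H_def)
  have "m > 0" using assms(4) by (cases m) auto
  have "card (miss t d (set H)) < 1"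
  \<comment> \<open>Here the truncated difference \<open>n - d\<close> is 0 and one chosen node
    suffices; otherwise it is a true difference and the exponential estimate applies.\<close>
  proof (cases "n \<le> d")
    case True
    then have "(n - d) ^ m * (n * k) = 0" using \<open>m > 0\<close> by simp
    then have "n ^ m * card (miss t d (set H)) = 0" using le by linarith
    then show ?thesis using n_pos by auto
  next
    case False
    let ?c = "card (miss t d (set H))"
    have "Transcendental.exp (- (real d / real n)) ^ m = Transcendental.exp (- (real (d * m) / real n))"
      by (simp add: exp_of_nat_mult[symmetric] field_simps)
    also have "\<dots> \<le> Transcendental.exp (- (2 * real L))"
    proof -
      have "real (2 * n * L) \<le> real (d * m)" using assms(4) by (simp only: of_nat_le_iff less_imp_le)
      then have "2 * real L \<le> real (d * m) / real n" using n_pos by (simp add: field_simps)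
      then show ?thesis by simp
    qed
    finally have power: "Transcendental.exp (- (real d / real n)) ^ m \<le> Transcendental.exp (- (2 * real L))" .
    have "real n ^ m * real ?c \<le> real (n - d) ^ m * real (n * k)"
      using le by (simp only: of_nat_mult[symmetric] of_nat_power[symmetric] of_nat_le_iff)
    then have "real ?c \<le> (real (n - d) / real n) ^ m * real (n * k)"
      using n_pos by (simp add: power_divide field_simps)
    also have "\<dots> \<le> Transcendental.exp (- (real d / real n)) ^ m * real (n * n)"
    proof (intro mult_mono power_mono)
      have "real (n - d) / real n = 1 + - (real d / real n)"
        using False n_pos by (simp add: of_nat_diff field_simps)
      also have "\<dots> \<le> Transcendental.exp (- (real d / real n))" by (rule exp_ge_add_one_self)
      finally show "real (n - d) / real n \<le> Transcendental.exp (- (real d / real n))" .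
      show "real (n * k) \<le> real (n * n)" using assms(2) by (simp only: of_nat_le_iff mult_le_mono2)
    qed auto
    also have "\<dots> \<le> Transcendental.exp (- (2 * real L)) * real (n * n)"
      by (intro mult_right_mono power) simp
    also have "\<dots> < 1"
    proof -
      have "real n < 2 ^ L" using assms(3) by (metis of_nat_less_iff of_nat_numeral of_nat_power)
      also have "\<dots> \<le> Transcendental.exp (1 :: real) ^ L"
        by (intro power_mono) (use exp_ge_add_one_self[of "1 :: real"] in auto)
      also have "\<dots> = Transcendental.exp (real L)" by (simp add: exp_of_nat_mult[symmetric])
      finally have "real n < Transcendental.exp (real L)" .
      then have "real n * real n < Transcendental.exp (real L) * Transcendental.exp (real L)"
        by (intro mult_strict_mono) auto
      then have "real (n * n) < Transcendental.exp (2 * real L)" by (simp add: exp_add[symmetric])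
      then show ?thesis by (simp add: exp_minus field_simps)
    qed
    finally show ?thesis by (simp del: of_nat_mult)
  qed
  then have "miss t d (set H) = {}" using finite_miss by simp
  then show ?thesis using assms(5,6) unfolding H_def miss_def by auto
qed

end


section \<open>Gathering all tokens at one node\<close>

text \<open>
  To bring all tokens to a node \<open>h\<close> within a window of \<open>W\<close> rounds, every token needs a path through
  slots \<open>(u, r)\<close>, meaning that \<open>u\<close> broadcasts in the \<open>r\<close>-th round of the window, \<open>1 \<le> r \<le> W\<close>, and the
  paths must be disjoint. Token \<open>i\<close> itself is represented by \<open>(i, 0)\<close>. By the usual reduction of
  disjoint paths to bipartite matching, we look for an injective map \<open>P\<close> assigning to every slot a
  predecessor, where an idle slot is its own predecessor, such that every token and every slot either
  is such a predecessor or can reach \<open>h\<close> directly. The association list \<open>P\<close> stands for the map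
  \<open>look P\<close>, the identity outside the list.
\<close>

type_synonym slot = "nat \<times> nat"

text \<open>Slots count the rounds of the window from 1, while the window starts with round
  \<open>t\<close> of the network, hence \<open>t + snd x - 1\<close>. Tokens start from their
  initial places, whatever earlier windows delivered, so the windows can be planned
  independently.\<close>

definition sends :: "(nat \<Rightarrow> nat \<Rightarrow> nat \<Rightarrow> bool) \<Rightarrow> (nat \<Rightarrow> nat \<Rightarrow> bool) \<Rightarrow> nat \<Rightarrow> slot \<Rightarrow> nat \<Rightarrow> bool" where
  "sends E I0 t x w \<longleftrightarrow>
     (if snd x = 0 then I0 w (fst x) else w = fst x \<or> E (t + snd x - 1) (fst x) w)"

text \<open>The later slot need not be in the next round: storing a token occupies no slot, so a
  path may skip rounds.\<close>

definition edge :: "(nat \<Rightarrow> nat \<Rightarrow> nat \<Rightarrow> bool) \<Rightarrow> (nat \<Rightarrow> nat \<Rightarrow> bool) \<Rightarrow> nat \<Rightarrow> slot \<Rightarrow> slot \<Rightarrow> bool" where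
  "edge E I0 t x y \<longleftrightarrow> x = y \<or> snd x < snd y \<and> sends E I0 t x (fst y)"

text \<open>The node \<open>h\<close> is the sink and has no slots: a path ends as soon as it gets
  there.\<close>

definition slots :: "nat \<Rightarrow> nat \<Rightarrow> nat \<Rightarrow> slot list" where
  "slots n W h = filter (\<lambda>y. fst y \<noteq> h) (concat (map (\<lambda>u. map (\<lambda>r. (u, r)) [1..<Suc W]) [0..<n]))"

definition look :: "(slot \<times> slot) list \<Rightarrow> slot \<Rightarrow> slot" where
  "look P y = hd0 y (map snd (filter (\<lambda>e. fst e = y) P))"

lemma look_Nil [simp]: "look [] y = y"
  by (simp add: look_def)

lemma look_Cons: "look ((y, x) # P) z = (if z = y then x else look P z)"
  by (simp add: look_def)

text \<open>
  The search for an augmenting path keeps a list of pairs of a hole, i.e. a token or slot that is not a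
  predecessor but should be, and a map \<open>P\<close> with just this hole. Letting the hole \<open>x\<close> take over the slot
  \<open>y\<close> moves the hole to the former predecessor of \<open>y\<close>.
\<close>

definition moves :: "nat \<Rightarrow> (nat \<Rightarrow> nat \<Rightarrow> nat \<Rightarrow> bool) \<Rightarrow> (nat \<Rightarrow> nat \<Rightarrow> bool) \<Rightarrow> nat \<Rightarrow> nat \<Rightarrow> nat \<Rightarrow>
    (slot \<times> (slot \<times> slot) list) list \<Rightarrow> (slot \<times> (slot \<times> slot) list) list" where
  "moves n E I0 t W h V = concat (map (\<lambda>v.
     map (\<lambda>y. (look (snd v) y, (y, fst v) # snd v))
       (filter (\<lambda>y. edge E I0 t (fst v) y \<and> look (snd v) y \<notin> set (map fst V)) (slots n W h))) V)"

definition grow :: "nat \<Rightarrow> (nat \<Rightarrow> nat \<Rightarrow> nat \<Rightarrow> bool) \<Rightarrow> (nat \<Rightarrow> nat \<Rightarrow> bool) \<Rightarrow> nat \<Rightarrow> nat \<Rightarrow> nat \<Rightarrow>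
    (slot \<times> (slot \<times> slot) list) list \<Rightarrow> (slot \<times> (slot \<times> slot) list) list" where
  "grow n E I0 t W h V =
     (if moves n E I0 t W h V = [] then V else hd0 ((0, 0), []) (moves n E I0 t W h V) # V)"

text \<open>Each step adds at most one hole, and never one already listed. There are at most
  \<open>n * W + k\<close> slots and tokens, so this many steps exhaust the search.\<close>

definition search :: "nat \<Rightarrow> nat \<Rightarrow> (nat \<Rightarrow> nat \<Rightarrow> nat \<Rightarrow> bool) \<Rightarrow> (nat \<Rightarrow> nat \<Rightarrow> bool) \<Rightarrow> nat \<Rightarrow> nat \<Rightarrow> nat \<Rightarrow>
    nat \<Rightarrow> (slot \<times> slot) list \<Rightarrow> (slot \<times> (slot \<times> slot) list) list" where
  "search n k E I0 t W h i P = fold (\<lambda>_ V. grow n E I0 t W h V) [0..<n * W + k] [((i, 0), P)]"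

definition augment :: "nat \<Rightarrow> nat \<Rightarrow> (nat \<Rightarrow> nat \<Rightarrow> nat \<Rightarrow> bool) \<Rightarrow> (nat \<Rightarrow> nat \<Rightarrow> bool) \<Rightarrow> nat \<Rightarrow> nat \<Rightarrow> nat \<Rightarrow>
    nat \<Rightarrow> (slot \<times> slot) list \<Rightarrow> (slot \<times> slot) list" where
  "augment n k E I0 t W h i P =
     hd0 P (map snd (filter (\<lambda>v. sends E I0 t (fst v) h) (search n k E I0 t W h i P)))"

definition preds :: "nat \<Rightarrow> nat \<Rightarrow> (nat \<Rightarrow> nat \<Rightarrow> nat \<Rightarrow> bool) \<Rightarrow> (nat \<Rightarrow> nat \<Rightarrow> bool) \<Rightarrow> nat \<Rightarrow> nat \<Rightarrow> nat \<Rightarrow>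
    (slot \<times> slot) list" where
  "preds n k E I0 t W h = fold (augment n k E I0 t W h) [0..<k] []"

text \<open>Each step back from a slot that is not idle lowers its round, so \<open>W\<close> steps
  suffice to arrive at a fixed point: a token, or an idle slot, in which case nothing is to be
  sent.\<close>

definition trace :: "nat \<Rightarrow> (slot \<times> slot) list \<Rightarrow> slot \<Rightarrow> slot" where
  "trace W P y = fold (\<lambda>_ z. look P z) [0..<W] y"

definition slot_token :: "nat \<Rightarrow> (slot \<times> slot) list \<Rightarrow> slot \<Rightarrow> nat option" where
  "slot_token W P y = (if snd (trace W P y) = 0 then Some (fst (trace W P y)) else None)"

definition gather :: "nat \<Rightarrow> nat \<Rightarrow> (nat \<Rightarrow> nat \<Rightarrow> nat \<Rightarrow> bool) \<Rightarrow> (nat \<Rightarrow> nat \<Rightarrow> bool) \<Rightarrow> nat \<Rightarrow> nat \<Rightarrow> nat \<Rightarrow>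
    nat option list list" where
  "gather n k E I0 t W h =
     map (\<lambda>r. map (\<lambda>u. slot_token W (preds n k E I0 t W h) (u, r)) [0..<n]) [1..<Suc W]"

lemma trace_funpow: "trace W P y = (look P ^^ W) y"
  unfolding trace_def by (induction W) auto

locale gathering = network +
  fixes t W h :: nat
  assumes h: "h < n" and window: "t + W \<le> T" and W: "n + k \<le> W + 1" "W \<ge> 1"
begin

abbreviation "sends' \<equiv> sends E I0 t"
abbreviation "edge' \<equiv> edge E I0 t"

section \<open>Augmenting paths for predecessor maps\<close>

definition R :: "slot set" where
  "R = set (slots n W h)"

lemma R_iff: "y \<in> R \<longleftrightarrow> fst y < n \<and> fst y \<noteq> h \<and> 1 \<le> snd y \<and> snd y \<le> W"
  unfolding R_def slots_def by (cases y) (auto simp: image_iff)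

lemma finite_R: "finite R"
  by (simp add: R_def)

lemma card_R: "card R \<le> n * W"
proof -
  have "R \<subseteq> {..<n} \<times> {1..W}" by (auto simp: R_iff)
  then have "card R \<le> card ({..<n} \<times> {1..W})" by (intro card_mono) auto
  then show ?thesis by simp
qed

text \<open>\<open>A\<close> collects the slots and the tokens treated so far, \<open>B\<close> the
  holes. That \<open>look P\<close> is a function gives each slot a single token to carry; that it
  is injective makes a move create exactly one new hole and drives the counting argument for a
  failed search.\<close>

definition linked :: "slot set \<Rightarrow> slot set \<Rightarrow> (slot \<times> slot) list \<Rightarrow> bool" where
  "linked A B P \<longleftrightarrow> inj_on (look P) R \<and> (\<forall>y\<in>R. edge' (look P y) y \<and> look P y \<in> A - B) \<and>
     (\<forall>x\<in>A - B. x \<in> look P ` R \<or> sends' x h) \<and> (\<forall>y. y \<notin> R \<longrightarrow> look P y = y)"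

lemma linked_initial: "linked R {} []"
proof -
  have "look [] = (\<lambda>y. y)" by auto
  then show ?thesis by (auto simp: linked_def edge_def)
qed

lemma linked_insert: "linked A {} P \<Longrightarrow> x \<notin> A \<Longrightarrow> linked (insert x A) {x} P"
  unfolding linked_def by auto

lemma linked_finish: "linked A {x} P \<Longrightarrow> sends' x h \<Longrightarrow> linked A {} P"
  unfolding linked_def by auto

lemma linked_move:
  assumes P: "linked A {x} P" and x: "x \<in> A" and y: "y \<in> R" "edge' x y"
  shows "linked A {look P y} ((y, x) # P)" and "look P y \<in> A"
proof -
  have P': "inj_on (look P) R" "\<And>z. z \<in> R \<Longrightarrow> edge' (look P z) z" "\<And>z. z \<in> R \<Longrightarrow> look P z \<in> A"
    "\<And>z. z \<in> R \<Longrightarrow> look P z \<noteq> x"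
    "\<And>z. z \<in> A \<Longrightarrow> z \<noteq> x \<Longrightarrow> z \<in> look P ` R \<or> sends' z h" "\<And>z. z \<notin> R \<Longrightarrow> look P z = z"
    using P unfolding linked_def by auto
  show "look P y \<in> A" by (rule P'(3)[OF y(1)])
  let ?Q = "look ((y, x) # P)"
  have "inj_on ?Q R"
    using P'(1,4) by (fastforce simp: inj_on_def look_Cons)
  moreover have "edge' (?Q z) z \<and> ?Q z \<in> A - {look P y}" if "z \<in> R" for z
    using P'(2,3)[OF that] P'(4)[OF that] P'(4)[OF y(1)] that y x inj_onD[OF P'(1), of z y]
    by (auto simp: look_Cons)
  moreover have "z \<in> ?Q ` R \<or> sends' z h" if z: "z \<in> A - {look P y}" for z
  proof (cases "z = x")
    case True
    then have "z = ?Q y" by (simp add: look_Cons)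
    then show ?thesis using y(1) by blast
  next
    case False
    show ?thesis
    proof (cases "sends' z h")
      case False
      then obtain w where w: "w \<in> R" "z = look P w" using P'(5)[of z] \<open>z \<noteq> x\<close> z by auto
      then have "z = ?Q w" using z by (auto simp: look_Cons)
      then show ?thesis using w(1) by blast
    qed simp
  qed
  moreover have "?Q z = z" if "z \<notin> R" for z
    using P'(6) that y(1) by (auto simp: look_Cons)
  ultimately show "linked A {look P y} ((y, x) # P)" unfolding linked_def by blast
qed

text \<open>
  The core of the argument. If the holes \<open>Z\<close> could not be moved further and none of them reached \<open>h\<close>,
  then in each round the slots reachable from \<open>Z\<close> would outnumber those of \<open>Z\<close> in the preceding round,
  as the network is connected. Over \<open>n + k - 1\<close> rounds this contradicts the injectivity of \<open>P\<close>, which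
  makes \<open>Z\<close> larger than the set of slots reachable from it.
\<close>

lemma closed_sends:
  assumes P: "linked A {(i, 0)} P" and A: "A \<subseteq> R \<union> (\<lambda>j. (j, 0)) ` {..<k}" and i: "i < k"
    and Z: "Z \<subseteq> A" "(i, 0) \<in> Z"
    and closed: "\<And>x y. x \<in> Z \<Longrightarrow> y \<in> R \<Longrightarrow> edge' x y \<Longrightarrow> look P y \<in> Z"
  shows "\<exists>x\<in>Z. sends' x h"
proof (rule ccontr)
  assume "\<not> ?thesis"
  then have no: "\<not> sends' x h" if "x \<in> Z" for x using that by blast
  define N where "N = {y \<in> R. \<exists>x\<in>Z. edge' x y}"
  have finA: "finite A" by (rule finite_subset[OF A]) (simp add: finite_R)
  have finZ: "finite Z" by (rule finite_subset[OF Z(1) finA])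
  have finN: "finite N" unfolding N_def using finite_R by simp
  \<comment> \<open>The predecessors of the slots in \<open>N\<close> lie in \<open>Z\<close> by
    closure and differ from the hole \<open>(i, 0)\<close>, which gives strict inequality.\<close>
  have "card N = card (look P ` N)"
    using P by (intro card_image[symmetric]) (auto simp: linked_def N_def intro: inj_on_subset)
  also have "\<dots> \<le> card (Z - {(i, 0)})"
    using P closed finZ by (intro card_mono) (auto simp: linked_def N_def)
  also have "\<dots> < card Z" using Z(2) finZ by (intro psubset_card_mono) auto
  also have "Z = (Z \<inter> R) \<union> (Z - R)" by blast
  also have "card \<dots> = card (Z \<inter> R) + card (Z - R)"
    using finZ by (intro card_Un_disjoint) auto
  also have "card (Z - R) \<le> k"
  proof -
    have "Z - R \<subseteq> (\<lambda>j. (j, 0)) ` {..<k}" using A Z(1) by auto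
    then have "card (Z - R) \<le> card ((\<lambda>j. (j, 0 :: nat)) ` {..<k})" by (intro card_mono) auto
    also have "\<dots> \<le> k" using card_image_le[of "{..<k}"] by (simp add: card_image inj_on_def)
    finally show ?thesis .
  qed
  finally have small: "card N < card (Z \<inter> R) + k" by simp
  let ?N = "\<lambda>r. {u. (u, r) \<in> N}" and ?Z = "\<lambda>r. {u. (u, r) \<in> Z \<inter> R}"
  have slices: "card B = (\<Sum>r\<in>{1..W}. card {u. (u, r) \<in> B})" if "B \<subseteq> R" for B
  proof -
    have fin: "finite B" using that finite_R by (rule finite_subset)
    have "card B = card (SIGMA r:{1..W}. {u. (u, r) \<in> B})"
      by (rule bij_betw_same_card[of "\<lambda>(a, b). (b, a)"])
        (use that in \<open>auto simp: bij_betw_def inj_on_def R_iff image_iff\<close>)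
    also have "\<dots> = (\<Sum>r\<in>{1..W}. card {u. (u, r) \<in> B})"
    proof (rule card_SigmaI)
      have "{u. (u, r) \<in> B} \<subseteq> fst ` B" for r by force
      then show "\<forall>r\<in>{1..W}. finite {u. (u, r) \<in> B}" using fin by (meson finite_imageI finite_subset)
    qed simp
    finally show ?thesis .
  qed
  have finr: "finite (?N r)" for r
    by (rule finite_subset[of _ "fst ` N"]) (use finN in force)+
  obtain w0 where w0: "w0 < n" "I0 w0 i" using present[OF i] by blast
  have "sends' (i, 0) w0" using w0 by (simp add: sends_def)
  then have w0h: "w0 \<noteq> h" using no[OF Z(2)] by auto
  \<comment> \<open>An initial holder of token \<open>i\<close> can use a slot in any round, as
    edges may skip rounds. This supplies a reachable slot even where \<open>Z\<close> has none in
    the preceding round and the boundary argument has no starting point.\<close>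
  have w0N: "w0 \<in> ?N r" if "1 \<le> r" "r \<le> W" for r
    using that w0 w0h Z(2) \<open>sends' (i, 0) w0\<close>
    by (auto simp: N_def R_iff edge_def intro!: bexI[of _ "(i, 0)"])
  have step: "card (?Z r) + 1 \<le> card (?N (Suc r))" if r: "1 \<le> r" "Suc r \<le> W" for r
  proof (cases "?Z r = {}")
    case True
    have "card (?N (Suc r)) \<noteq> 0" using w0N[of "Suc r"] r finr by (auto simp: card_eq_0_iff)
    then show ?thesis unfolding True by simp
  next
    case False
    then obtain u where u: "u \<in> ?Z r" by blast
    have sub: "?Z r \<subseteq> {..<n}" by (auto simp: R_iff)
    have "h \<notin> ?Z r" by (auto simp: R_iff)
    moreover have "t + r - 1 < T" using r window by simp
    ultimately obtain x y where xy: "x \<in> ?Z r" "y < n" "y \<notin> ?Z r" "E (t + r - 1) x y"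
      using boundary[OF _ sub u h] by blast
    have xZ: "(x, r) \<in> Z" "(x, r) \<in> R" using xy(1) by auto
    have sy: "sends' (x, r) y" using xy(4) r by (simp add: sends_def)
    then have "y \<noteq> h" using no[OF xZ(1)] by auto
    then have "y \<in> ?N (Suc r)"
      using xy(2) r sy xZ by (auto simp: N_def R_iff edge_def intro!: bexI[of _ "(x, r)"])
    moreover have "?Z r \<subseteq> ?N (Suc r)"
    proof
      fix z assume "z \<in> ?Z r"
      then have "(z, r) \<in> Z" "(z, r) \<in> R" by auto
      then show "z \<in> ?N (Suc r)" using r
        by (auto simp: N_def R_iff edge_def sends_def intro!: bexI[of _ "(z, r)"])
    qed
    ultimately have "card (insert y (?Z r)) \<le> card (?N (Suc r))"
      using finr by (intro card_mono) auto
    moreover have "finite (?Z r)" using sub by (rule finite_subset) simp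
    ultimately show ?thesis using xy(3) by simp
  qed
  have "card (Z \<inter> R) = (\<Sum>r\<in>{1..W}. card (?Z r))" by (rule slices) blast
  also have "{1..W} = insert W {1..<W}" using W(2) by auto
  also have "(\<Sum>r\<in>insert W {1..<W}. card (?Z r)) = card (?Z W) + (\<Sum>r\<in>{1..<W}. card (?Z r))" by simp
  finally have cZ: "card (Z \<inter> R) = card (?Z W) + (\<Sum>r\<in>{1..<W}. card (?Z r))" .
  have "card N = (\<Sum>r\<in>{1..W}. card (?N r))" by (rule slices) (auto simp: N_def)
  also have "{1..W} = insert 1 (Suc ` {1..<W})"
    unfolding image_Suc_atLeastLessThan using W(2) by auto
  also have "(\<Sum>r\<in>insert 1 (Suc ` {1..<W}). card (?N r)) =
      card (?N 1) + (\<Sum>r\<in>{1..<W}. card (?N (Suc r)))"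
    by (subst sum.insert) (auto simp: sum.reindex simp del: image_Suc_atLeastLessThan)
  finally have cN: "card N = card (?N 1) + (\<Sum>r\<in>{1..<W}. card (?N (Suc r)))" .
  have "(\<Sum>r\<in>{1..<W}. card (?Z r)) + (W - 1) = (\<Sum>r\<in>{1..<W}. card (?Z r) + 1)"
    by (subst sum.distrib) simp
  also have "\<dots> \<le> (\<Sum>r\<in>{1..<W}. card (?N (Suc r)))" by (intro sum_mono step) auto
  finally have main: "(\<Sum>r\<in>{1..<W}. card (?Z r)) + (W - 1) \<le> (\<Sum>r\<in>{1..<W}. card (?N (Suc r)))" .
  have "card (?N 1) \<noteq> 0" using w0N[of 1] W finr by (auto simp: card_eq_0_iff)
  moreover have "card (?Z W) \<le> n - 1"
  proof -
    have "card (?Z W) \<le> card ({..<n} - {h})" by (intro card_mono) (auto simp: R_iff)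
    then show ?thesis using h by simp
  qed
  \<comment> \<open>Shifted by one round, \<open>N\<close> gains 1 in each of \<open>W - 1\<close>
    rounds and has an element in round 1, while \<open>Z\<close> has at most \<open>n - 1\<close>
    slots in round \<open>W\<close>. So
    \<open>card N \<ge> card (Z \<inter> R) + W - (n - 1)\<close>, which is at least
    \<open>card (Z \<inter> R) + k\<close>.\<close>
  ultimately show False using small cZ cN main W n_pos by linarith
qed

lemma moves_iff:
  "(x', P') \<in> set (moves n E I0 t W h V) \<longleftrightarrow>
     (\<exists>x P y. (x, P) \<in> set V \<and> y \<in> R \<and> edge' x y \<and> look P y \<notin> fst ` set V \<and>
        x' = look P y \<and> P' = (y, x) # P)"
  unfolding moves_def R_def by (force simp: image_iff)

text \<open>The holes found carry different maps \<open>Q\<close>, whereas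
  \<open>closed_sends\<close> speaks of the single map \<open>P\<close>. The clause that
  \<open>P\<close> takes a listed hole as its value wherever some \<open>Q\<close> departs from it
  transfers closure from the maps \<open>Q\<close> to \<open>P\<close>.\<close>

lemma search_inv:
  assumes P: "linked A {(i, 0)} P" and A: "(i, 0) \<in> A"
  defines "V m \<equiv> fold (\<lambda>_ V. grow n E I0 t W h V) [0..<m] [((i, 0), P)]"
  shows "distinct (map fst (V m)) \<and> (i, 0) \<in> fst ` set (V m) \<and>
    (\<forall>(x, Q)\<in>set (V m). linked A {x} Q \<and> x \<in> A \<and>
       (\<forall>y. look Q y \<noteq> look P y \<longrightarrow> look P y \<in> fst ` set (V m))) \<and>
    (moves n E I0 t W h (V m) = [] \<or> length (V m) = Suc m)"
proof (induction m)
  case 0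
  then show ?case using assms by simp
next
  case (Suc m)
  have V_Suc: "V (Suc m) = grow n E I0 t W h (V m)" by (simp add: V_def)
  show ?case
  proof (cases "moves n E I0 t W h (V m)")
    case Nil
    then show ?thesis using Suc V_Suc by (simp add: grow_def)
  next
    case (Cons a as)
    obtain x' P' where a: "a = (x', P')" by (cases a)
    have V': "V (Suc m) = (x', P') # V m" using Cons V_Suc by (simp add: grow_def a)
    have "(x', P') \<in> set (moves n E I0 t W h (V m))" using Cons a by simp
    then obtain x Q y where xQ: "(x, Q) \<in> set (V m)" "y \<in> R" "edge' x y"
      "look Q y \<notin> fst ` set (V m)" "x' = look Q y" "P' = (y, x) # Q"
      unfolding moves_iff by blast
    have Q: "linked A {x} Q" "x \<in> A" "\<And>z. look Q z \<noteq> look P z \<Longrightarrow> look P z \<in> fst ` set (V m)"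
      using Suc xQ(1) by auto
    have new: "linked A {x'} P'" "x' \<in> A"
      using linked_move[OF Q(1,2) xQ(2,3)] xQ by auto
    have "look P z \<in> insert x' (fst ` set (V m))" if "look P' z \<noteq> look P z" for z
      using Q(3)[of z] that xQ(5,6) by (cases "z = y"; cases "look Q z = look P z") (auto simp: look_Cons)
    then show ?thesis using Suc new xQ Cons unfolding V' by auto
  qed
qed

lemma augment_linked:
  assumes P: "linked (R \<union> (\<lambda>j. (j, 0)) ` {..<i}) {} P" and i: "i < k"
  shows "linked (R \<union> (\<lambda>j. (j, 0)) ` {..<Suc i}) {} (augment n k E I0 t W h i P)"
proof -
  define A where "A = R \<union> (\<lambda>j. (j, 0 :: nat)) ` {..<Suc i}"
  have A_eq: "A = insert (i, 0) (R \<union> (\<lambda>j. (j, 0)) ` {..<i})" by (auto simp: A_def lessThan_Suc)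
  have "(i, 0) \<notin> R \<union> (\<lambda>j. (j, 0)) ` {..<i}" by (auto simp: R_iff)
  then have P': "linked A {(i, 0)} P" unfolding A_eq by (rule linked_insert[OF P])
  have iA: "(i, 0) \<in> A" by (simp add: A_eq)
  have finA: "finite A" using finite_R by (simp add: A_def)
  have "card A \<le> card R + card ((\<lambda>j. (j, 0 :: nat)) ` {..<Suc i})"
    unfolding A_def by (rule card_Un_le)
  also have "\<dots> \<le> n * W + k"
    using card_R card_image_le[of "{..<Suc i}" "\<lambda>j. (j, 0 :: nat)"] i by simp
  finally have cardA: "card A \<le> n * W + k" .
  define V where "V = search n k E I0 t W h i P"
  have V: "distinct (map fst V)" "(i, 0) \<in> fst ` set V"
    "\<And>x Q. (x, Q) \<in> set V \<Longrightarrow> linked A {x} Q" "\<And>x Q. (x, Q) \<in> set V \<Longrightarrow> x \<in> A"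
    "\<And>x Q y. (x, Q) \<in> set V \<Longrightarrow> look Q y \<noteq> look P y \<Longrightarrow> look P y \<in> fst ` set V"
    "moves n E I0 t W h V = [] \<or> length V = Suc (n * W + k)"
    using search_inv[OF P' iA, of "n * W + k"] unfolding V_def search_def by auto
  have "length V = card (fst ` set V)"
    using distinct_card[OF V(1)] by simp
  also have "\<dots> \<le> card A" using V(4) finA by (intro card_mono) auto
  \<comment> \<open>Otherwise the list would contain \<open>n * W + k + 1\<close> distinct holes,
    more than \<open>A\<close> has elements.\<close>
  finally have closed: "moves n E I0 t W h V = []" using cardA V(6) by auto
  have "\<exists>x\<in>fst ` set V. sends' x h"
  proof (rule closed_sends[OF P' _ i])
    show "A \<subseteq> R \<union> (\<lambda>j. (j, 0)) ` {..<k}" using i by (auto simp: A_def)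
    show "fst ` set V \<subseteq> A" using V(4) by auto
    show "(i, 0) \<in> fst ` set V" by (rule V(2))
    fix x y assume x: "x \<in> fst ` set V" and y: "y \<in> R" "edge' x y"
    obtain Q where Q: "(x, Q) \<in> set V" using x by auto
    have "look Q y \<in> fst ` set V"
    proof (rule ccontr)
      assume "look Q y \<notin> fst ` set V"
      then have "(look Q y, (y, x) # Q) \<in> set (moves n E I0 t W h V)"
        unfolding moves_iff using Q y by blast
      then show False using closed by simp
    qed
    then show "look P y \<in> fst ` set V" using V(5)[OF Q, of y] by (cases "look Q y = look P y") auto
  qed
  then have ex: "\<exists>v\<in>set V. sends' (fst v) h" by auto
  define v where "v = hd0 ((0, 0), []) (filter (\<lambda>v. sends' (fst v) h) V)"
  have v: "v \<in> set V" "sends' (fst v) h" using hd0_filter[OF ex] by (auto simp: v_def)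
  have "filter (\<lambda>v. sends' (fst v) h) V \<noteq> []" using v by (auto simp: filter_empty_conv)
  then have "augment n k E I0 t W h i P = snd v"
    unfolding augment_def V_def[symmetric] v_def by (cases "filter (\<lambda>v. sends' (fst v) h) V") auto
  moreover have "linked A {} (snd v)"
    using V(3)[of "fst v" "snd v"] v by (auto intro: linked_finish)
  ultimately show ?thesis by (simp add: A_def)
qed

section \<open>Tokens travel along the predecessor map\<close>

definition "A = R \<union> (\<lambda>j. (j, 0 :: nat)) ` {..<k}"
definition "P = preds n k E I0 t W h"

lemma linked_P: "linked A {} P"
proof -
  have "linked (R \<union> (\<lambda>j. (j, 0)) ` {..<m}) {} (fold (augment n k E I0 t W h) [0..<m] [])" if "m \<le> k" for m
    using that by (induction m) (simp_all add: linked_initial augment_linked)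
  then show ?thesis unfolding A_def P_def preds_def by blast
qed

lemma P_facts:
  "y \<in> R \<Longrightarrow> edge' (look P y) y" "y \<in> R \<Longrightarrow> look P y \<in> A"
  "x \<in> A \<Longrightarrow> x \<in> look P ` R \<or> sends' x h" "y \<notin> R \<Longrightarrow> look P y = y"
  using linked_P unfolding linked_def by (auto simp del: split_paired_All)

lemma look_cases:
  "look P y = y \<or> y \<in> R \<and> snd (look P y) < snd y \<and> sends' (look P y) (fst y)"
  using P_facts(1,4)[of y] unfolding edge_def by auto

lemma trace_fixed: "look P y = y \<Longrightarrow> trace m P y = y"
  unfolding trace_funpow by (induction m) auto

text \<open>Outside \<open>R\<close>, in particular in round 0, \<open>look P\<close> is the
  identity, and inside \<open>R\<close> a step either stays or lowers the round; hence
  \<open>m \<ge> snd y\<close> steps end in a fixed point.\<close>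

lemma look_trace: "snd y \<le> m \<Longrightarrow> look P (trace m P y) = trace m P y"
proof (induction m arbitrary: y)
  case 0
  then have "y \<notin> R" by (auto simp: R_iff)
  then show ?case using P_facts(4) by (simp add: trace_funpow)
next
  case (Suc m)
  show ?case
  proof (cases "look P y = y")
    case False
    then have "snd (look P y) \<le> m" using look_cases[of y] Suc.prems by auto
    from Suc.IH[OF this] show ?thesis
      by (simp add: trace_funpow funpow_swap1 del: funpow.simps add: funpow_Suc_right)
  qed (simp add: trace_fixed)
qed

lemma trace_look:
  assumes "snd y \<le> W" shows "trace W P (look P y) = trace W P y"
  using look_trace[OF assms] by (simp add: trace_funpow funpow_swap1)

context
  fixes \<pi> :: "nat \<Rightarrow> nat \<Rightarrow> nat option"
  assumes \<pi>: "\<And>r u. 1 \<le> r \<Longrightarrow> r \<le> W \<Longrightarrow> u < n \<Longrightarrow> \<pi> (t + r - 1) u = slot_token W P (u, r)"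
begin

text \<open>Induction on the round: the predecessor is the token itself, held initially by
  \<open>u\<close>, or an earlier slot with the same trace, which has broadcast the token to
  \<open>u\<close> or is a slot of \<open>u\<close>.\<close>

lemma slot_has:
  assumes "(u, r) \<in> R" "trace W P (u, r) = (i, 0)"
  shows "has E I0 \<pi> (t + r - 1) u i" and "\<pi> (t + r - 1) u = Some i"
proof -
  have plan: "\<pi> (t + r - 1) u = Some i" if "(u, r) \<in> R" "trace W P (u, r) = (i, 0)" for u r
    using \<pi>[of r u] that by (auto simp: slot_token_def R_iff)
  show "\<pi> (t + r - 1) u = Some i" by (rule plan[OF assms])
  show "has E I0 \<pi> (t + r - 1) u i"
    using assms
  proof (induction r arbitrary: u rule: less_induct)
    case (less r)
    let ?z = "look P (u, r)"
    have r: "1 \<le> r" "r \<le> W" using less.prems by (auto simp: R_iff)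
    have "?z \<noteq> (u, r)" using trace_fixed[of "(u, r)" W] less.prems(2) r by auto
    then have z: "snd ?z < r" "sends' ?z u" using look_cases[of "(u, r)"] by auto
    have tz: "trace W P ?z = (i, 0)" using trace_look[of "(u, r)"] less.prems r by simp
    obtain v s where vs: "?z = (v, s)" by (cases ?z)
    show ?case
    proof (cases "s = 0")
      case True
      then have "?z \<notin> R" using vs by (simp add: R_iff)
      then have "?z = (i, 0)" using trace_fixed[of ?z W] P_facts(4) tz by metis
      then have "has E I0 \<pi> 0 u i" using z(2) by (simp add: sends_def)
      then show ?thesis by (rule has_mono) simp
    next
      case False
      have "(v, s) \<in> R" using P_facts(2)[OF less.prems(1)] vs False by (auto simp: A_def)
      then have IH: "has E I0 \<pi> (t + s - 1) v i" "\<pi> (t + s - 1) v = Some i"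
        using less.IH[of s v] plan[of v s] z(1) tz vs by auto
      have "u = v \<or> E (t + s - 1) v u" using z(2) False vs by (simp add: sends_def)
      then have "has E I0 \<pi> (Suc (t + s - 1)) u i" using IH by auto
      then show ?thesis by (rule has_mono) (use z(1) vs False in simp)
    qed
  qed
qed

text \<open>The path is now followed forwards: \<open>x\<close> either reaches \<open>h\<close> or
  is the predecessor of a later slot with the same trace, and rounds cannot increase beyond
  \<open>W\<close>.\<close>

lemma trace_arrives:
  assumes "x \<in> A" "trace W P x = (i, 0)"
  shows "has E I0 \<pi> (t + W) h i"
  using assms
proof (induction "W - snd x" arbitrary: x rule: less_induct)
  case less
  consider "sends' x h" | y where "y \<in> R" "x = look P y"
    using P_facts(3)[OF less.prems(1)] by auto
  then show ?case
  proof cases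
    case 1
    show ?thesis
    proof (cases "snd x = 0")
      case True
      then have "x \<notin> R" by (simp add: R_iff)
      then have "x = (i, 0)" using trace_fixed[of x W] P_facts(4) less.prems(2) by metis
      then have "has E I0 \<pi> 0 h i" using 1 by (simp add: sends_def)
      then show ?thesis by (rule has_mono) simp
    next
      case False
      obtain u r where x: "x = (u, r)" by (cases x)
      have R: "(u, r) \<in> R" using less.prems(1) False x by (auto simp: A_def)
      have "E (t + r - 1) u h" using 1 x False R by (auto simp: sends_def R_iff)
      then have "has E I0 \<pi> (Suc (t + r - 1)) h i"
        using slot_has[OF R, of i] less.prems(2) x by auto
      then show ?thesis by (rule has_mono) (use R in \<open>auto simp: R_iff\<close>)
    qed
  next
    case 2
    have y: "snd y \<le> W" "1 \<le> snd y" using 2(1) by (auto simp: R_iff)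
    have ty: "trace W P y = (i, 0)" using trace_look[of y] y less.prems(2) 2(2) by simp
    have "look P y \<noteq> y" using trace_fixed[of y W] ty y by auto
    then have "snd x < snd y" using look_cases[of y] 2(2) by auto
    moreover have "y \<in> A" using 2(1) by (simp add: A_def)
    ultimately show ?thesis using less.hyps[of y] ty y by simp
  qed
qed

lemma gathered: "i < k \<Longrightarrow> has E I0 \<pi> (t + W) h i"
proof (rule trace_arrives)
  have "(i, 0) \<notin> R" by (simp add: R_iff)
  then show "trace W P (i, 0) = (i, 0)" using P_facts(4) trace_fixed by blast
qed (simp add: A_def)

end

end


section \<open>The algorithm\<close>

definition floods :: "nat \<Rightarrow> nat \<Rightarrow> nat \<Rightarrow> nat option list list" where
  "floods n k d = concat (map (\<lambda>i. replicate d (replicate n (Some i))) [0..<k])"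

definition fast_plan :: "nat \<Rightarrow> nat \<Rightarrow> (nat \<Rightarrow> nat \<Rightarrow> nat \<Rightarrow> bool) \<Rightarrow> (nat \<Rightarrow> nat \<Rightarrow> bool) \<Rightarrow> nat \<Rightarrow> nat \<Rightarrow>
    nat option list list" where
  "fast_plan n k E I0 d m =
     concat (map (\<lambda>j. gather n k E I0 (j * (n + k)) (n + k) (get 0 (hitters n k E (m * (n + k)) d m) j))
       [0..<m]) @ floods n k d"

text \<open>The least \<open>L\<close> with \<open>n < 2 ^ L\<close>, then \<open>m = \<lceil>sqrt (k L)\<rceil>\<close> and the least \<open>d\<close> with \<open>d m > 2 n L\<close>.\<close>

definition bits :: "nat \<Rightarrow> nat" where
  "bits n = fst (fold (\<lambda>_ p. if snd p \<le> n then (Suc (fst p), snd p + snd p) else p) [0..<n] (0, 1))"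

definition hit_count :: "nat \<Rightarrow> nat \<Rightarrow> nat" where
  "hit_count n k = length (filter (\<lambda>j. j * j < k * bits n) [0..<k * bits n])"

definition window :: "nat \<Rightarrow> nat \<Rightarrow> nat" where
  "window n k = length (filter (\<lambda>j. j * hit_count n k \<le> 2 * n * bits n) [0..<Suc (2 * n * bits n)])"

definition fast_length :: "nat \<Rightarrow> nat \<Rightarrow> nat" where
  "fast_length n k = hit_count n k * (n + k) + k * window n k"

definition plan :: "nat \<Rightarrow> nat \<Rightarrow> (nat \<Rightarrow> nat \<Rightarrow> nat \<Rightarrow> bool) \<Rightarrow> (nat \<Rightarrow> nat \<Rightarrow> bool) \<Rightarrow> nat option list list" where
  "plan n k E I0 =
     (if fast_length n k \<le> n * k then fast_plan n k E I0 (window n k) (hit_count n k) else floods n k n)"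

definition entry :: "bool list list \<Rightarrow> nat \<Rightarrow> nat \<Rightarrow> bool" where
  "entry M u i = get False (get [] M u) i"

definition planned :: "nat option list list \<Rightarrow> nat \<Rightarrow> nat \<Rightarrow> nat option" where
  "planned pl t u = get None (get [] pl t) u"

definition sent :: "nat option list list \<Rightarrow> bool list list \<Rightarrow> nat \<Rightarrow> nat \<Rightarrow> nat option" where
  "sent pl M t u =
     (if planned pl t u \<noteq> None \<and> entry M u (the0 0 (planned pl t u)) then planned pl t u else None)"

definition update :: "nat \<Rightarrow> nat \<Rightarrow> (nat \<Rightarrow> nat \<Rightarrow> nat \<Rightarrow> bool) \<Rightarrow> nat option list list \<Rightarrow> nat \<Rightarrow>
    bool list list \<Rightarrow> bool list list" where
  "update n k E pl t M = map (\<lambda>u. map (\<lambda>i. entry M u i \<or>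
     list_ex (\<lambda>v. E t v u \<and> sent pl M t v = Some i) [0..<n]) [0..<k]) [0..<n]"

text \<open>\<open>simulate\<close> recomputes this from the initial state for every round; that
  costs only a polynomial factor and keeps it a plain nested \<open>map\<close>.\<close>

definition tokens_after :: "nat \<Rightarrow> nat \<Rightarrow> (nat \<Rightarrow> nat \<Rightarrow> nat \<Rightarrow> bool) \<Rightarrow> nat option list list \<Rightarrow>
    bool list list \<Rightarrow> nat \<Rightarrow> bool list list" where
  "tokens_after n k E pl M t = fold (\<lambda>s M. update n k E pl s M) [0..<t] M"

definition simulate :: "nat \<Rightarrow> nat \<Rightarrow> (nat \<Rightarrow> nat \<Rightarrow> nat \<Rightarrow> bool) \<Rightarrow> nat option list list \<Rightarrow>
    bool list list \<Rightarrow> nat option list list list" where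
  "simulate n k E pl M =
     map (\<lambda>t. map (\<lambda>u. map (\<lambda>v. if E t u v then sent pl (tokens_after n k E pl M t) t u else None)
       [0..<n]) [0..<n]) [0..<n * k]"

text \<open>The final \<open>unit\<close> encodes the \<open>Leaf\<close> that ends the
  heterogeneous list in \<open>enc_instance\<close>, so the two encodings agree as trees.\<close>

type_synonym input = "nat \<times> nat \<times> bool list list \<times> bool list list list \<times> unit"

definition adj :: "bool list list list \<Rightarrow> nat \<Rightarrow> nat \<Rightarrow> nat \<Rightarrow> bool" where
  "adj G t u v = entry (get [] G t) u v"

definition solve :: "input \<Rightarrow> nat option list list list" where
  "solve x = simulate (fst x) (fst (snd x)) (adj (fst (snd (snd (snd x)))))
     (plan (fst x) (fst (snd x)) (adj (fst (snd (snd (snd x))))) (entry (fst (snd (snd x)))))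
     (fst (snd (snd x)))"

definition input_of :: "gossip \<Rightarrow> input" where
  "input_of I = (nodes I, tokens I,
     map (\<lambda>u. map (\<lambda>i. i \<in> init I u) [0..<tokens I]) [0..<nodes I],
     map (\<lambda>t. map (\<lambda>u. map (\<lambda>v. (u, v) \<in> net I (Suc t)) [0..<nodes I]) [0..<nodes I])
       [0..<nodes I * tokens I], ())"


subsection \<open>Plans deliver all tokens\<close>

lemma length_concat_uniform:
  "(\<And>x. x \<in> set xs \<Longrightarrow> length x = d) \<Longrightarrow> length (concat xs) = length xs * d"
  by (induction xs) auto

lemma nth_concat_uniform:
  assumes "\<And>x. x \<in> set xs \<Longrightarrow> length x = d" "i < length xs" "r < d"
  shows "concat xs ! (i * d + r) = xs ! i ! r"
  using assms
proof (induction xs arbitrary: i)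
  case (Cons x xs)
  then show ?case by (cases i) (auto simp: nth_append)
qed simp

lemma length_floods: "length (floods n k d) = k * d"
  unfolding floods_def by (subst length_concat_uniform[of _ d]) auto

lemma nth_floods: "i < k \<Longrightarrow> r < d \<Longrightarrow> floods n k d ! (i * d + r) = replicate n (Some i)"
  unfolding floods_def by (subst nth_concat_uniform[of _ d]) auto

lemma length_gather: "length (gather n k E I0 t W h) = W"
  by (simp add: gather_def)

lemma nth_gather:
  assumes "1 \<le> r" "r \<le> W" "u < n"
  shows "gather n k E I0 t W h ! (r - 1) ! u = slot_token W (preds n k E I0 t W h) (u, r)"
proof -
  have "[1..<Suc W] ! (r - 1) = r" using assms by (subst nth_upt) auto
  then show ?thesis using assms unfolding gather_def by (simp del: upt_Suc)
qed

lemma length_fast_plan: "length (fast_plan n k E I0 d m) = m * (n + k) + k * d"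
  unfolding fast_plan_def length_append length_floods
  by (subst length_concat_uniform[of _ "n + k"]) (auto simp: length_gather)

lemma planned_nth:
  "t < length pl \<Longrightarrow> u < length (pl ! t) \<Longrightarrow> planned pl t u = pl ! t ! u"
  by (simp add: planned_def get_nth)

context network
begin

lemma flood_window:
  assumes pl: "length pl \<le> T" "s + k * d \<le> length pl"
    and "\<And>i r. i < k \<Longrightarrow> r < d \<Longrightarrow> pl ! (s + i * d + r) = replicate n (Some i)"
    and i: "i < k" and u: "has E I0 (planned pl) s u i" and v: "reach E d (s + i * d) u v"
  shows "has E I0 (planned pl) T v i"
proof -
  have le: "s + i * d + d \<le> length pl"
  proof -
    have "Suc i * d \<le> k * d" using i by (intro mult_right_mono) auto
    then show ?thesis using pl(2) by simp
  qed
  have "has E I0 (planned pl) (s + i * d + d) v i"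
  proof (rule reach_has[OF v])
    show "has E I0 (planned pl) (s + i * d) u i" by (rule has_mono[OF u]) simp
    fix q w x assume q: "s + i * d \<le> q" "q < s + i * d + d" "E q w x"
    define r where "r = q - (s + i * d)"
    have r: "q = s + i * d + r" "r < d" using q by (auto simp: r_def)
    have "w < n" using E_less[of q w x] q le pl by simp
    moreover have "pl ! q = replicate n (Some i)" using assms(3)[OF i r(2)] r(1) by simp
    ultimately show "planned pl q w = Some i" using q le by (subst planned_nth) auto
  qed
  then show ?thesis by (rule has_mono) (use le pl in simp)
qed

lemma floods_deliver:
  assumes T: "T = n * k" and i: "i < k" and v: "v < n"
  shows "has E I0 (planned (floods n k n)) T v i"
proof -
  obtain u where u: "u < n" "I0 u i" using present[OF i] by blast
  have le: "0 + k * n \<le> length (floods n k n)" "length (floods n k n) \<le> T"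
    by (simp_all add: length_floods T mult.commute)
  \<comment> \<open>A window of \<open>n\<close> rounds reaches \<open>v\<close> from all nodes, so
    any initial holder of the token will do.\<close>
  have "min n (Suc n) \<le> card {u. u < n \<and> reach E n (i * n) u v}"
    by (rule card_reaching[OF v]) (use window_le[OF i, of 0 n] T in \<open>simp add: mult.commute\<close>)
  then have "card {..<n} \<le> card {u. u < n \<and> reach E n (i * n) u v}" by simp
  then have "{u. u < n \<and> reach E n (i * n) u v} = {..<n}" by (intro card_seteq) auto
  then have "reach E n (0 + i * n) u v" using u by auto
  moreover have "has E I0 (planned (floods n k n)) 0 u i" using u by simp
  ultimately show ?thesis
    by (intro flood_window[OF le(2,1) _ i]) (simp_all add: nth_floods)
qed

lemma fast_plan_delivers:
  assumes T: "m * (n + k) + k * d \<le> T" and m: "k \<le> n" "n < 2 ^ L" "2 * n * L < d * m"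
    and i: "i < k" and v: "v < n"
  shows "has E I0 (planned (fast_plan n k E I0 d m)) T v i"
proof -
  define W where "W = n + k"
  define H where "H = hitters n k E (m * W) d m"
  define pl where "pl = fast_plan n k E I0 d m"
  define G where "G = concat (map (\<lambda>j. gather n k E I0 (j * W) W (get 0 H j)) [0..<m])"
  have pl: "pl = G @ floods n k d" by (simp add: pl_def fast_plan_def G_def H_def W_def)
  have lenG: "length G = m * W"
    unfolding G_def by (subst length_concat_uniform[of _ W]) (auto simp: length_gather)
  have len: "length pl = m * W + k * d" by (simp add: pl lenG length_floods)
  have T': "m * W + k * d \<le> T" using T by (simp add: W_def)
  have H: "set H \<subseteq> {..<n}" "length H = m"
    using hitters_miss[OF T', of m] by (auto simp: H_def)
  have gathered: "has E I0 (planned pl) (m * W) (H ! j) i" if j: "j < m" for j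
  proof -
    have jm: "j * W + W \<le> m * W"
    proof -
      have "Suc j * W \<le> m * W" using j by (intro mult_right_mono) auto
      then show ?thesis by simp
    qed
    interpret gathering n k T E I0 "j * W" W "H ! j"
    proof unfold_locales
      show "H ! j < n" using H j nth_mem[of j H] by (metis lessThan_iff subsetD)
      show "j * W + W \<le> T" using jm T' by simp
      show "n + k \<le> W + 1" "1 \<le> W" using n_pos by (auto simp: W_def)
    qed
    have "planned pl (j * W + r - 1) u = slot_token W P (u, r)" if r: "1 \<le> r" "r \<le> W" "u < n" for r u
    proof -
      have eq: "j * W + r - 1 = j * W + (r - 1)" using r by simp
      have "G ! (j * W + (r - 1)) = gather n k E I0 (j * W) W (H ! j) ! (r - 1)"
        unfolding G_def using j r H(2)
        by (subst nth_concat_uniform[of _ W]) (auto simp: length_gather get_nth)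
      moreover have lt: "j * W + (r - 1) < m * W" using jm r by simp
      ultimately have *: "pl ! (j * W + (r - 1)) = gather n k E I0 (j * W) W (H ! j) ! (r - 1)"
        by (simp add: pl nth_append lenG)
      moreover have "length (gather n k E I0 (j * W) W (H ! j) ! (r - 1)) = n"
        using r by (simp add: gather_def del: upt_Suc)
      ultimately show ?thesis
        unfolding eq P_def using lt r by (subst planned_nth) (simp_all add: len nth_gather[symmetric])
    qed
    from gathered[OF this i] have "has E I0 (planned pl) (j * W + W) (H ! j) i" .
    then show ?thesis by (rule has_mono) (rule jm)
  qed
  obtain u where u: "u \<in> set H" "reach E d (m * W + i * d) u v"
    using hitters_hit[OF T' m i v] by (auto simp: H_def)
  then obtain j where "j < m" "u = H ! j" using H(2) by (auto simp: in_set_conv_nth)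
  then have "has E I0 (planned pl) (m * W) u i" using gathered by simp
  moreover have "pl ! (m * W + i * d + r) = replicate n (Some i)" if "i < k" "r < d" for i r
    using nth_floods[OF that, of n] by (simp add: pl nth_append lenG add.assoc)
  ultimately show ?thesis unfolding pl_def[symmetric]
    using flood_window[of pl "m * W" d i u v] u(2) i T' by (simp add: len)
qed

end


subsection \<open>The length of the plan\<close>

lemma bits_bounds:
  assumes "n \<ge> 1" shows "n < 2 ^ bits n" "2 ^ bits n \<le> 2 * n" "bits n \<ge> 1"
proof -
  define F where "F j = fold (\<lambda>_ p. if snd p \<le> n then (Suc (fst p), snd p + snd p) else p) [0..<j] (0, 1)" for j
  \<comment> \<open>If the guard never fails, the exponent after \<open>n\<close> iterations is
    \<open>n\<close>, and \<open>n < 2 ^ n\<close>; so \<open>n\<close> iterations are enough in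
    either case.\<close>
  have inv: "snd (F j) = 2 ^ fst (F j) \<and> 2 ^ fst (F j) \<le> 2 * n \<and> (n < snd (F j) \<or> fst (F j) = j)" for j
    using assms by (induction j) (auto simp: F_def)
  have eq: "bits n = fst (F n)" by (simp add: bits_def F_def)
  have "n < 2 ^ n" by simp
  then show less: "n < 2 ^ bits n" and "2 ^ bits n \<le> 2 * n"
    using inv[of n] by (auto simp: eq)
  show "bits n \<ge> 1" using less assms by (cases "bits n") auto
qed

text \<open>A predicate closed downwards selects an initial segment, so the length of the filtered
  list is its threshold. This is how \<open>hit_count\<close> and \<open>window\<close> search
  without a loop of their own.\<close>

lemma less_length_filter_upt:
  assumes "\<And>i j. i \<le> j \<Longrightarrow> p j \<Longrightarrow> p i" "j < N"
  shows "p j \<longleftrightarrow> j < length (filter p [0..<N])"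
  using assms(2)
proof (induction N)
  case (Suc N)
  show ?case
  proof (cases "p N")
    case True
    then have "p i" if "i < Suc N" for i using assms(1)[of i N] that by simp
    then have "filter p [0..<Suc N] = [0..<Suc N]" by (intro filter_True) auto
    then show ?thesis using Suc.prems \<open>\<And>i. i < Suc N \<Longrightarrow> p i\<close> by simp
  next
    case False
    have "length (filter p [0..<N]) \<le> N" using length_filter_le[of p "[0..<N]"] by simp
    then show ?thesis using False Suc by (cases "j = N") auto
  qed
qed simp

lemma hit_count_bounds:
  fixes n k :: nat
  assumes "n \<ge> 1" "k \<ge> 1"
  defines "m \<equiv> hit_count n k"
  shows "k * bits n \<le> m * m" "m \<ge> 1" "(m - 1) * (m - 1) < k * bits n"
proof -
  let ?X = "k * bits n"
  have X: "?X \<ge> 1" using assms bits_bounds(3)[of n] by simp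
  have iff: "j * j < ?X \<longleftrightarrow> j < m" if "j < ?X" for j
    unfolding m_def hit_count_def
    by (rule less_length_filter_upt[OF _ that]) (meson le_less_trans mult_le_mono)
  have "m \<le> ?X" using length_filter_le[of _ "[0..<?X]"] by (simp add: m_def hit_count_def)
  show "?X \<le> m * m"
  proof (cases "m < ?X")
    case True
    then show ?thesis using iff[of m] by simp
  next
    case False
    then have "?X = m" using \<open>m \<le> ?X\<close> by simp
    then show ?thesis by simp
  qed
  then show "m \<ge> 1" using X by (cases m) auto
  then show "(m - 1) * (m - 1) < ?X" using iff[of "m - 1"] \<open>m \<le> ?X\<close> by simp
qed

lemma window_bounds:
  fixes n k :: nat
  assumes "n \<ge> 1" "k \<ge> 1"
  shows "2 * n * bits n < window n k * hit_count n k"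
    "(window n k - 1) * hit_count n k \<le> 2 * n * bits n" "window n k \<ge> 1"
proof -
  let ?X = "2 * n * bits n" and ?m = "hit_count n k"
  have iff: "j * ?m \<le> ?X \<longleftrightarrow> j < window n k" if "j < Suc ?X" for j
    unfolding window_def
    by (rule less_length_filter_upt[OF _ that]) (meson le_trans mult_le_mono1)
  have le: "window n k \<le> Suc ?X"
    using length_filter_le[of _ "[0..<Suc ?X]"] by (simp add: window_def del: upt_Suc)
  show pos: "window n k \<ge> 1" using iff[of 0] by simp
  then show "(window n k - 1) * ?m \<le> ?X" using iff[of "window n k - 1"] le by simp
  show "?X < window n k * ?m"
  proof (cases "window n k < Suc ?X")
    case True
    then show ?thesis using iff[of "window n k"] by simp
  next
    case False
    then have "window n k = Suc ?X" using le by simp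
    then show ?thesis using hit_count_bounds(2)[OF assms]
      by (metis Suc_le_eq le_trans mult.commute mult_le_mono1 nat_mult_1)
  qed
qed

text \<open>Gathering takes \<open>m (n + k) \<le> 2 n m\<close> rounds. From
  \<open>(d - 1) m \<le> 2 n L\<close> and \<open>k L \<le> m m\<close> follows
  \<open>k d \<le> 2 n m + k \<le> 3 n m\<close>, together \<open>5 n m\<close>. Finally \<open>m
  \<le> 1 + sqrt (k L) \<le> 2 sqrt (k L) \<le> 4 sqrt (k ln n)\<close>, hence the constant
  20.\<close>

lemma fast_length_le:
  assumes "k \<ge> 1" "k \<le> n" "n \<ge> 2"
  shows "real (fast_length n k) \<le> 20 * (real n * sqrt (real k * ln (real n)))"
proof -
  define m where "m = hit_count n k"
  define d where "d = window n k"
  define L where "L = bits n"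
  have n1: "n \<ge> 1" using assms by simp
  note m = hit_count_bounds[OF n1 assms(1), folded m_def L_def]
  note d = window_bounds[OF n1 assms(1), folded m_def d_def L_def]
  have "k * d * m = k * ((d - 1) * m) + k * m"
    using d(3) by (cases d) (auto simp: algebra_simps)
  also have "\<dots> \<le> k * (2 * n * L) + k * m" using d(2) by simp
  also have "k * (2 * n * L) = 2 * n * (k * L)" by simp
  also have "\<dots> \<le> 2 * n * (m * m)" using m(1) by (rule mult_le_mono2)
  finally have "(k * d) * m \<le> (2 * n * m + k) * m" by (simp add: algebra_simps)
  then have "k * d \<le> 2 * n * m + k" using m(2) by simp
  then have "k * d \<le> 2 * (n * m) + k" by simp
  moreover have "k \<le> n * m" using assms(2) m(2) by (metis le_trans mult.right_neutral mult_le_mono2)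
  moreover have "m * (n + k) \<le> m * (2 * n)" by (rule mult_le_mono2) (use assms(2) in simp)
  then have "m * (n + k) \<le> 2 * (n * m)" by (simp only: mult.left_commute mult.commute)
  ultimately have "fast_length n k \<le> 5 * (n * m)"
    unfolding fast_length_def m_def[symmetric] d_def[symmetric] by linarith
  then have "real (fast_length n k) \<le> real (5 * (n * m))" by (simp only: of_nat_le_iff)
  then have len: "real (fast_length n k) \<le> 5 * real n * real m" by simp
  \<comment> \<open>From \<open>2 ^ L \<le> 2 n\<close> and \<open>n \<ge> 2\<close>,
    \<open>L ln 2 \<le> ln 2 + ln n \<le> 2 ln n\<close>; the estimate \<open>ln 2 \<ge> 1/2\<close>
    doubles the factor.\<close>
  have "real L \<le> 4 * ln (real n)"
  proof -
    have "(2 :: real) ^ L \<le> 2 * real n"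
      using bits_bounds(2)[OF n1] by (metis L_def of_nat_le_iff of_nat_mult of_nat_numeral of_nat_power)
    then have "ln ((2 :: real) ^ L) \<le> ln (2 * real n)" using assms by (subst ln_le_cancel_iff) auto
    then have L: "real L * ln 2 \<le> ln 2 + ln (real n)"
      using assms by (simp add: ln_realpow ln_mult)
    have "ln 2 \<le> ln (real n)" using assms by simp
    moreover have "1 / 2 \<le> ln (2 :: real)" using ln2_ge_two_thirds by simp
    then have "real L * (1 / 2) \<le> real L * ln 2" by (intro mult_left_mono) auto
    ultimately show ?thesis using L by simp
  qed
  have kL: "real (k * L) \<le> 4 * (real k * ln (real n))"
    using \<open>real L \<le> 4 * ln (real n)\<close> mult_left_mono[of "real L" "4 * ln (real n)" "real k"]
    by (simp add: algebra_simps)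
  have "real (m - 1) * real (m - 1) \<le> real (k * L)"
    using m(3) by (metis less_imp_le of_nat_le_iff of_nat_mult)
  then have "real (m - 1) \<le> sqrt (real (k * L))"
    by (simp add: real_le_rsqrt power2_eq_square)
  moreover have "1 \<le> sqrt (real (k * L))"
  proof -
    have "1 \<le> k * L" using assms(1) bits_bounds(3)[OF n1] by (simp add: L_def)
    then show ?thesis by (metis of_nat_1 of_nat_le_iff real_sqrt_ge_1_iff)
  qed
  moreover have "real m = real (m - 1) + 1" using m(2) by simp
  ultimately have "real m \<le> 2 * sqrt (real (k * L))" by linarith
  also have "\<dots> \<le> 2 * sqrt (4 * (real k * ln (real n)))" using kL by simp
  also have "\<dots> = 4 * sqrt (real k * ln (real n))" by (simp add: real_sqrt_mult)
  finally have "5 * real n * real m \<le> 5 * real n * (4 * sqrt (real k * ln (real n)))"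
    by (intro mult_left_mono) auto
  also have "\<dots> = 20 * (real n * sqrt (real k * ln (real n)))" by simp
  finally show ?thesis using len by linarith
qed

context network
begin

lemma plan_delivers:
  assumes "T = n * k" "k \<le> n" "i < k" "v < n"
  shows "has E I0 (planned (plan n k E I0)) T v i"
proof (cases "fast_length n k \<le> n * k")
  case True
  have "k \<ge> 1" using assms by simp
  then have "has E I0 (planned (fast_plan n k E I0 (window n k) (hit_count n k))) T v i"
    using True assms n_pos
    by (intro fast_plan_delivers[OF _ _ bits_bounds(1) window_bounds(1)]) (auto simp: fast_length_def)
  then show ?thesis using True by (simp add: plan_def)
next
  case False
  then show ?thesis using floods_deliver assms by (simp add: plan_def)
qed

end

lemma length_plan_le:
  assumes "k \<ge> 1" "k \<le> n" "n \<ge> 2"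
  shows "real (length (plan n k E I0)) \<le> 20 * (real n * min (real k) (sqrt (real k * ln (real n))))"
proof -
  let ?s = "sqrt (real k * ln (real n))"
  \<comment> \<open>Both bounds hold in both branches: plain flooding is used only when
    \<open>n * k\<close> is the smaller length.\<close>
  have "length (plan n k E I0) \<le> n * k" "length (plan n k E I0) \<le> fast_length n k"
    by (auto simp: plan_def length_fast_plan length_floods fast_length_def mult.commute)
  then have "real (length (plan n k E I0)) \<le> real n * real k"
    "real (length (plan n k E I0)) \<le> 20 * (real n * ?s)"
    using fast_length_le[OF assms] by (metis of_nat_le_iff of_nat_mult, linarith)
  moreover have "real n * real k \<le> 20 * (real n * real k)" by simp
  ultimately show ?thesis by (auto simp: min_def)
qed


subsection \<open>Executing the plan\<close>

lemma has_token_less: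
  "(\<And>u i. I0 u i \<Longrightarrow> i < k) \<Longrightarrow> has E I0 \<pi> t u i \<Longrightarrow> i < k"
  by (induction t arbitrary: u) auto

lemma entry_tab: "u < n \<Longrightarrow> entry (map (\<lambda>u. map (f u) [0..<k]) [0..<n]) u i \<longleftrightarrow> i < k \<and> f u i"
  by (cases "i < k") (auto simp: entry_def get_nth get_default)

lemma entry_tab_outside: "n \<le> u \<Longrightarrow> \<not> entry (map f [0..<n]) u i"
  by (simp add: entry_def get_default get_def)

definition act :: "(nat \<Rightarrow> nat \<Rightarrow> nat \<Rightarrow> bool) \<Rightarrow> (nat \<Rightarrow> nat \<Rightarrow> bool) \<Rightarrow> (nat \<Rightarrow> nat \<Rightarrow> nat option) \<Rightarrow>
    nat \<Rightarrow> nat \<Rightarrow> nat option" where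
  "act E I0 \<pi> t u = (case \<pi> t u of None \<Rightarrow> None | Some i \<Rightarrow> if has E I0 \<pi> t u i then Some i else None)"

lemma act_Some: "act E I0 \<pi> t u = Some i \<longleftrightarrow> \<pi> t u = Some i \<and> has E I0 \<pi> t u i"
  by (auto simp: act_def split: option.splits)

lemma has_Suc_act: "has E I0 \<pi> (Suc t) u i \<longleftrightarrow>
    has E I0 \<pi> t u i \<or> (\<exists>v. E t v u \<and> act E I0 \<pi> t v = Some i)"
  by (auto simp: act_Some)

context network
begin

text \<open>The matrix has only \<open>n\<close> rows and \<open>k\<close> columns, while
  \<open>has\<close> is unrestricted; \<open>E_less\<close> and \<open>has_token_less\<close> show
  that nothing happens outside this range.\<close>

lemma tokens_after_has:
  assumes I0: "\<And>u i. u < n \<Longrightarrow> entry M u i \<longleftrightarrow> I0 u i" and less: "\<And>u i. I0 u i \<Longrightarrow> i < k"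
  shows "t \<le> T \<Longrightarrow> u < n \<Longrightarrow> entry (tokens_after n k E pl M t) u i \<longleftrightarrow> has E I0 (planned pl) t u i"
    and "t \<le> T \<Longrightarrow> u < n \<Longrightarrow> sent pl (tokens_after n k E pl M t) t u = act E I0 (planned pl) t u"
proof -
  have sent: "sent pl N t u = act E I0 (planned pl) t u"
    if "\<And>i. entry N u i \<longleftrightarrow> has E I0 (planned pl) t u i" for N t u
    using that by (auto simp: sent_def act_def split: option.splits)
  show *: "entry (tokens_after n k E pl M t) u i \<longleftrightarrow> has E I0 (planned pl) t u i"
    if "t \<le> T" "u < n" for t u i
    using that
  proof (induction t arbitrary: u i)
    case 0
    then show ?case using I0 by (simp add: tokens_after_def)
  next
    case (Suc t)
    define N where "N = tokens_after n k E pl M t"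
    have N: "entry N u i \<longleftrightarrow> has E I0 (planned pl) t u i" if "u < n" for u i
      using Suc that by (simp add: N_def)
    have "entry (tokens_after n k E pl M (Suc t)) u i \<longleftrightarrow> entry (update n k E pl t N) u i"
      by (simp add: tokens_after_def N_def)
    also have "\<dots> \<longleftrightarrow> i < k \<and> (entry N u i \<or> (\<exists>v<n. E t v u \<and> sent pl N t v = Some i))"
      unfolding update_def using Suc.prems by (subst entry_tab) (auto simp: list_ex_iff)
    also have "\<dots> \<longleftrightarrow> i < k \<and> has E I0 (planned pl) (Suc t) u i"
    proof -
      have "sent pl N t v = act E I0 (planned pl) t v" if "v < n" for v
        by (rule sent) (rule N[OF that])
      then have "(\<exists>v<n. E t v u \<and> sent pl N t v = Some i) \<longleftrightarrow>
          (\<exists>v. E t v u \<and> act E I0 (planned pl) t v = Some i)"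
        using E_less[of t _ u] Suc.prems by (metis Suc_le_lessD)
      then show ?thesis unfolding has_Suc_act using N[OF Suc.prems(2)] by simp
    qed
    also have "\<dots> \<longleftrightarrow> has E I0 (planned pl) (Suc t) u i"
    proof
      assume "has E I0 (planned pl) (Suc t) u i"
      then show "i < k \<and> has E I0 (planned pl) (Suc t) u i"
        by (intro conjI has_token_less[OF less])
    qed (rule conjunct2)
    finally show ?case .
  qed
  show "sent pl (tokens_after n k E pl M t) t u = act E I0 (planned pl) t u" if "t \<le> T" "u < n"
    by (rule sent) (rule *[OF that])
qed

end

lemma enc_nat_option: "enc (z :: nat option) = enc_option z"
  by (cases z) (auto simp: enc_nat_def')

lemma enc_table_eq: "enc_table a b (\<lambda>i j. enc (f i j)) = enc (map (\<lambda>i. map (f i) [0..<b]) [0..<a])"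
  by (simp add: enc_table_def enc_list_def' comp_def)

lemma enc_instance_eq: "enc_instance I = enc (input_of I)"
proof -
  have "map (\<lambda>t. enc_table (nodes I) (nodes I) (\<lambda>u v. enc_bool ((u, v) \<in> net I t)))
      [1..<Suc (nodes I * tokens I)] =
    map enc (map (\<lambda>t. map (\<lambda>u. map (\<lambda>v. (u, v) \<in> net I (Suc t)) [0..<nodes I]) [0..<nodes I])
       [0..<nodes I * tokens I])"
    unfolding map_Suc_upt[symmetric] One_nat_def map_map comp_def enc_bool_def'[symmetric] enc_table_eq ..
  then show ?thesis
    unfolding enc_instance_def input_of_def Let_def
    by (simp add: enc_list_def'[symmetric] enc_bool_def'[symmetric] enc_nat_def'[symmetric]
        enc_table_eq del: upt_Suc) (simp add: enc_list_def')
qed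

text \<open>The shift \<open>t - 1\<close> translates the rounds of an instance, counted from 1,
  into those of a plan, counted from 0.\<close>

definition schedule_of :: "gossip \<Rightarrow> schedule" where
  "schedule_of I = (case input_of I of (n, k, M, G, _) \<Rightarrow> \<lambda>t u v.
     if 1 \<le> t \<and> t \<le> n * k \<and> (u, v) \<in> net I t
     then act (adj G) (entry M) (planned (plan n k (adj G) (entry M))) (t - 1) u else None)"

lemma solve_correct:
  fixes I :: gossip
  assumes I: "gossip_instance I"
  defines "\<sigma> \<equiv> schedule_of I" and "n \<equiv> nodes I" and "k \<equiv> tokens I"
  shows "enc (solve (input_of I)) = enc_schedule I \<sigma>"
    and "valid_schedule I \<sigma>" and "broadcast I \<sigma>"
    and "k \<le> n \<Longrightarrow> disseminates I \<sigma>"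
    and "k \<le> n \<Longrightarrow> n \<ge> 2 \<Longrightarrow>
      real (schedule_length I \<sigma>) \<le> 20 * (real n * min (real k) (sqrt (real k * ln (real n))))"
proof -
  define M where "M = map (\<lambda>u. map (\<lambda>i. i \<in> init I u) [0..<k]) [0..<n]"
  define G where "G = map (\<lambda>t. map (\<lambda>u. map (\<lambda>v. (u, v) \<in> net I (Suc t)) [0..<n]) [0..<n]) [0..<n * k]"
  have input: "input_of I = (n, k, M, G, ())"
    by (simp add: input_of_def M_def G_def n_def k_def)
  define E where "E = adj G"
  define I0 where "I0 = entry M"
  define pl where "pl = plan n k E I0"
  let ?has = "has E I0 (planned pl)" and ?act = "act E I0 (planned pl)"
  have nk: "n \<ge> 1" "k \<ge> 1" using I by (auto simp: gossip_instance_def n_def k_def)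
  have inits: "(\<Union>u<n. init I u) = {..<k}" using I by (auto simp: gossip_instance_def n_def k_def)
  have conn: "connected_graph n (net I (Suc t))" if "t < n * k" for t
    using I that by (auto simp: gossip_instance_def n_def k_def)
  have E_iff: "E t u v \<longleftrightarrow> (u, v) \<in> net I (Suc t)" if t: "t < n * k" for t u v
  proof -
    have G: "get [] G t = map (\<lambda>u. map (\<lambda>v. (u, v) \<in> net I (Suc t)) [0..<n]) [0..<n]"
      using t by (simp add: G_def get_nth)
    have "net I (Suc t) \<subseteq> {..<n} \<times> {..<n}" using conn[OF t] by (simp add: connected_graph_def)
    then show ?thesis
      unfolding E_def adj_def G by (cases "u < n") (auto simp: entry_tab entry_tab_outside)
  qed
  have I0_iff: "I0 u i \<longleftrightarrow> u < n \<and> i \<in> init I u" for u i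
  proof (cases "u < n")
    case True
    then have "i \<in> init I u \<Longrightarrow> i < k" using inits by auto
    then show ?thesis using True by (auto simp: I0_def M_def entry_tab)
  qed (auto simp: I0_def M_def entry_tab_outside)
  interpret network n k "n * k" E I0
  proof unfold_locales
    show "connected_graph n {(u, v). E t u v}" if "t < n * k" for t
      using conn[OF that] E_iff[OF that] by simp
    show "\<exists>u<n. I0 u i" if "i < k" for i
      using that inits I0_iff by (metis (no_types, lifting) UN_iff lessThan_iff)
  qed (rule nk)
  have I0_less: "i < k" if "I0 u i" for u i using that inits I0_iff by auto
  have \<sigma>: "\<sigma> t u v = (if 1 \<le> t \<and> t \<le> n * k \<and> (u, v) \<in> net I t then ?act (t - 1) u else None)" for t u v
    by (simp add: \<sigma>_def schedule_of_def input E_def I0_def pl_def)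
  have sent: "sent pl (tokens_after n k E pl M t) t u = ?act t u" if "t < n * k" "u < n" for t u
    by (rule tokens_after_has(2)) (use that I0_less in \<open>auto simp: I0_def\<close>)
  have held: "held I \<sigma> t u = {i. ?has t u i}" if "t \<le> n * k" "u < n" for t u
    using that
  proof (induction t arbitrary: u)
    case 0
    then show ?case by (auto simp: I0_iff)
  next
    case (Suc t)
    have "held I \<sigma> (Suc t) u = held I \<sigma> t u \<union> {i. \<exists>v. E t v u \<and> ?act t v = Some i}"
      using Suc.prems by (auto simp: \<sigma> E_iff)
    also have "\<dots> = {i. ?has (Suc t) u i}" unfolding has_Suc_act using Suc by auto
    finally show ?case .
  qed
  have sol: "solve (input_of I) = simulate n k E pl M"
    by (simp add: solve_def input E_def I0_def pl_def)
  have "simulate n k E pl M = map (\<lambda>t. map (\<lambda>u. map (\<lambda>v. \<sigma> (Suc t) u v) [0..<n]) [0..<n]) [0..<n * k]"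
    unfolding simulate_def using sent by (auto simp: \<sigma> E_iff)
  then show "enc (solve (input_of I)) = enc_schedule I \<sigma>"
    unfolding sol enc_schedule_def Let_def n_def[symmetric] k_def[symmetric] One_nat_def
      map_Suc_upt[symmetric] enc_nat_option[symmetric] enc_table_eq
    by (simp add: enc_list_def' comp_def)
  show "valid_schedule I \<sigma>"
    unfolding valid_schedule_def n_def[symmetric] k_def[symmetric]
  proof (intro ballI allI impI)
    fix t u v i assume t: "t \<in> {1..n * k}" and s: "\<sigma> t u v = Some i"
    then have uv: "(u, v) \<in> net I t" "?act (t - 1) u = Some i" by (auto simp: \<sigma> split: if_splits)
    then have "u < n" using E_less[of "t - 1" u v] E_iff[of "t - 1" u v] t by auto
    then show "(u, v) \<in> net I t \<and> i \<in> held I \<sigma> (t - 1) u"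
      using uv t held[of "t - 1" u] by (auto simp: act_Some)
  qed
  show "broadcast I \<sigma>"
    unfolding broadcast_def by (auto simp: \<sigma>)
  show "disseminates I \<sigma>" if "k \<le> n"
  proof -
    have "?has (n * k) u i \<longleftrightarrow> i < k" if "u < n" for u i
    proof
      show "i < k" if "?has (n * k) u i" by (rule has_token_less[OF I0_less that])
      show "?has (n * k) u i" if "i < k"
        unfolding pl_def by (rule plan_delivers[OF refl \<open>k \<le> n\<close> that \<open>u < n\<close>])
    qed
    then show ?thesis
      unfolding disseminates_def n_def[symmetric] k_def[symmetric] using held by auto
  qed
  show "real (schedule_length I \<sigma>) \<le> 20 * (real n * min (real k) (sqrt (real k * ln (real n))))"
    if "k \<le> n" "n \<ge> 2"
  proof -
    have "t \<le> length pl" if t: "t \<in> {1..n * k}" "\<sigma> t u v = Some i" for t u v i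
    proof -
      \<comment> \<open>Beyond its end a plan yields the default \<open>None\<close>, so a
        transmission in round \<open>t\<close> forces \<open>t - 1 < length pl\<close>.\<close>
      have "planned pl (t - 1) u = Some i" using t by (auto simp: \<sigma> act_Some split: if_splits)
      then have "t - 1 < length pl"
        by (cases "length pl \<le> t - 1") (auto simp: planned_def get_default get_def)
      then show ?thesis by simp
    qed
    then have "schedule_length I \<sigma> \<le> length pl"
      unfolding schedule_length_def n_def[symmetric] k_def[symmetric] by (intro Max.boundedI) auto
    then show ?thesis
      using length_plan_le[OF nk(2) that, of E I0] unfolding pl_def by linarith
  qed
qed


section \<open>The algorithm runs in polynomial time\<close>

lemma pbound_nat: "ptime f \<Longrightarrow> pbound (\<lambda>x. f x :: nat)"
  by (rule pbound_mono[OF ptime_pbound]) auto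

lemma ptime_fold_bound:
  fixes l :: "'a :: enc \<Rightarrow> 'b :: enc list" and a0 :: "'a \<Rightarrow> 'c :: enc" and b :: "'a \<Rightarrow> nat"
  assumes body: "ptime (\<lambda>p. f (fst p) (fst (snd p)) (snd (snd p)))" and l: "ptime l" and a0: "ptime a0"
    and bnd: "pbound b"
    and acc: "\<And>x j. j \<le> length (l x) \<Longrightarrow> sz (fold (f x) (take j (l x)) (a0 x)) \<le> b x"
  shows "ptime (\<lambda>x. fold (f x) (l x) (a0 x))"
  by (rule ptime_fold[OF _ l a0 bnd acc]) (use body in \<open>simp_all add: case_prod_beta'\<close>)

section \<open>Running time of flooding and of the greedy choice\<close>

lemma ptime_entry [ptime_intros]:
  "ptime M \<Longrightarrow> ptime u \<Longrightarrow> ptime i \<Longrightarrow> ptime (\<lambda>x. entry (M x) (u x) (i x))"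
  unfolding entry_def by (intro ptime_intros)

lemma ptime_adj [ptime_intros]:
  "ptime G \<Longrightarrow> ptime t \<Longrightarrow> ptime u \<Longrightarrow> ptime v \<Longrightarrow> ptime (\<lambda>x. adj (G x) (t x) (u x) (v x))"
  unfolding adj_def by (intro ptime_intros)

text \<open>Inside the body of a \<open>filter\<close>, \<open>map\<close> or \<open>fold\<close>
  the input is only a component of a tuple. The rules \<open>assms[THEN ptime_comp[rotated]]\<close>
  compose each parameter with the projection that recovers it; the later lemmas use the same
  device.\<close>

lemma ptime_spread [ptime_intros]:
  assumes "ptime n" "ptime G" "ptime t" "ptime S"
  shows "ptime (\<lambda>x. spread (n x) (adj (G x)) (t x) (S x))"
  unfolding spread_def by (intro ptime_intros assms assms[THEN ptime_comp[rotated]])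

lemma sz_upt_sublist: "set xs \<subseteq> {..<n} \<Longrightarrow> length xs \<le> n \<Longrightarrow> sz xs \<le> 1 + n * (2 * n + 2)"
proof -
  assume xs: "set xs \<subseteq> {..<n}" "length xs \<le> n"
  have "sz xs \<le> 1 + length xs * (1 + (2 * n + 1))"
    by (rule sz_list_le) (use xs(1) in auto)
  also have "\<dots> \<le> 1 + n * (1 + (2 * n + 1))" using xs(2) by (intro add_mono mult_right_mono) auto
  finally show ?thesis by simp
qed

lemma ptime_flood [ptime_intros]:
  assumes "ptime n" "ptime G" "ptime t" "ptime d" "ptime S"
  shows "ptime (\<lambda>x. flood (n x) (adj (G x)) (t x) (d x) (S x))"
  unfolding flood_def
proof (rule ptime_fold_inv[where b = "\<lambda>x. sz (S x) + (1 + n x * (2 * n x + 2))"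
      and J = "\<lambda>x j acc. sz acc \<le> sz (S x) + (1 + n x * (2 * n x + 2))"])
  show "pbound (\<lambda>x. sz (S x) + (1 + n x * (2 * n x + 2)))"
    by (intro pbound_intros ptime_pbound pbound_nat assms)
  show "sz (spread (n x) (adj (G x)) s acc) \<le> sz (S x) + (1 + n x * (2 * n x + 2))" for x s acc
  proof (rule trans_le_add2, rule sz_upt_sublist)
    show "length (spread (n x) (adj (G x)) s acc) \<le> n x"
      unfolding spread_def by (rule order_trans[OF length_filter_le]) simp
  qed (auto simp: spread_def)
qed (auto intro!: ptime_intros assms assms[THEN ptime_comp[rotated]])

lemma ptime_missed [ptime_intros]:
  assumes "ptime n" "ptime k" "ptime G" "ptime t" "ptime d" "ptime H"
  shows "ptime (\<lambda>x. missed (n x) (k x) (adj (G x)) (t x) (d x) (H x))"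
  unfolding missed_def by (intro ptime_intros assms assms[THEN ptime_comp[rotated]])

lemma ptime_hitter [ptime_intros]:
  assumes "ptime n" "ptime k" "ptime G" "ptime t" "ptime d" "ptime H"
  shows "ptime (\<lambda>x. hitter (n x) (k x) (adj (G x)) (t x) (d x) (H x))"
  unfolding hitter_def by (intro ptime_intros assms assms[THEN ptime_comp[rotated]])

text \<open>\<open>ptime\<close> concerns all inputs, also those that encode no instance, so the
  bound cannot rely on the existence of a suitable node; the default 0 satisfies it as well.\<close>

lemma hitter_le: "hitter n k E t d H \<le> n"
proof (cases "filter (\<lambda>h. n * length (missed n k E t d (h # H)) \<le> (n - d) * length (missed n k E t d H)) [0..<n]")
  case (Cons a as)
  then have "a \<in> set [0..<n]" by (metis filter_is_subset list.set_intros(1) subsetD)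
  then show ?thesis using Cons by (simp add: hitter_def)
qed (simp add: hitter_def)

lemma ptime_hitters [ptime_intros]:
  assumes "ptime n" "ptime k" "ptime G" "ptime t" "ptime d" "ptime m"
  shows "ptime (\<lambda>x. hitters (n x) (k x) (adj (G x)) (t x) (d x) (m x))"
  unfolding hitters_def
proof (rule ptime_fold_add[where c = "\<lambda>x. 2 * n x + 2"])
  show "pbound (\<lambda>x. 2 * n x + 2)" by (intro pbound_intros pbound_nat assms)
  show "sz (hitter (n x) (k x) (adj (G x)) (t x) (d x) acc # acc) \<le> sz acc + (2 * n x + 2)" for x acc
    using hitter_le[of "n x" "k x" "adj (G x)" "t x" "d x" acc] by simp
qed (intro ptime_intros assms assms[THEN ptime_comp[rotated]])+

section \<open>Running time of gathering\<close>

lemma ptime_look [ptime_intros]: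
  assumes "ptime P" "ptime y" shows "ptime (\<lambda>x. look (P x) (y x))"
  unfolding look_def by (intro ptime_intros assms assms[THEN ptime_comp[rotated]])

lemma ptime_sends [ptime_intros]:
  assumes "ptime G" "ptime M" "ptime t" "ptime y" "ptime w"
  shows "ptime (\<lambda>x. sends (adj (G x)) (entry (M x)) (t x) (y x) (w x))"
  unfolding sends_def by (intro ptime_intros assms)

lemma ptime_edge [ptime_intros]:
  assumes "ptime G" "ptime M" "ptime t" "ptime y" "ptime z"
  shows "ptime (\<lambda>x. edge (adj (G x)) (entry (M x)) (t x) (y x) (z x))"
  unfolding edge_def by (intro ptime_intros assms)

lemma ptime_slots [ptime_intros]:
  assumes "ptime n" "ptime W" "ptime h"
  shows "ptime (\<lambda>x. slots (n x) (W x) (h x))"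
  unfolding slots_def by (intro ptime_intros assms assms[THEN ptime_comp[rotated]])

lemma ptime_moves [ptime_intros]:
  assumes "ptime n" "ptime G" "ptime M" "ptime t" "ptime W" "ptime h" "ptime V"
  shows "ptime (\<lambda>x. moves (n x) (adj (G x)) (entry (M x)) (t x) (W x) (h x) (V x))"
  unfolding moves_def by (intro ptime_intros assms assms[THEN ptime_comp[rotated]])

lemma ptime_grow [ptime_intros]:
  assumes "ptime n" "ptime G" "ptime M" "ptime t" "ptime W" "ptime h" "ptime V"
  shows "ptime (\<lambda>x. grow (n x) (adj (G x)) (entry (M x)) (t x) (W x) (h x) (V x))"
  unfolding grow_def by (intro ptime_intros assms)

text \<open>Number and size of entries are bounded separately: a move adds one entry, but its
  components are known slots or values of \<open>look\<close>, so the size bound \<open>B\<close>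
  never grows.\<close>

definition small_map :: "nat \<Rightarrow> nat \<Rightarrow> (slot \<times> slot) list \<Rightarrow> bool" where
  "small_map B L P \<longleftrightarrow> length P \<le> L \<and> (\<forall>e\<in>set P. sz (fst e) \<le> B \<and> sz (snd e) \<le> B)"

lemma sz_pair: "sz p = 1 + sz (fst p) + sz (snd p)"
  by (cases p) simp

lemma small_map_sz: "small_map B L P \<Longrightarrow> sz P \<le> 1 + L * (2 + 2 * B)"
proof -
  assume P: "small_map B L P"
  have "sz P \<le> 1 + length P * (1 + (1 + 2 * B))"
    by (rule sz_list_le) (use P in \<open>fastforce simp: small_map_def sz_pair\<close>)
  also have "\<dots> \<le> 1 + L * (1 + (1 + 2 * B))"
    using P by (intro add_mono mult_right_mono) (auto simp: small_map_def)
  finally show ?thesis by simp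
qed

lemma small_map_look: "small_map B L P \<Longrightarrow> sz y \<le> B \<Longrightarrow> sz (look P y) \<le> B"
proof (induction P arbitrary: L)
  case (Cons e P)
  then have "small_map B (length P) P" by (auto simp: small_map_def)
  then show ?case using Cons.IH Cons.prems by (cases e) (auto simp: look_Cons small_map_def)
qed simp

lemma moves_small:
  assumes "v \<in> set (moves n E I0 t W h V)"
    and "\<And>y. y \<in> set (slots n W h) \<Longrightarrow> sz y \<le> B"
    and "\<And>v. v \<in> set V \<Longrightarrow> sz (fst v) \<le> B \<and> small_map B L (snd v)"
  shows "sz (fst v) \<le> B \<and> small_map B (Suc L) (snd v)"
proof -
  obtain w y where w: "w \<in> set V" "y \<in> set (slots n W h)" "v = (look (snd w) y, (y, fst w) # snd w)"
    using assms(1) unfolding moves_def by auto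
  have y: "sz y \<le> B" and V: "sz (fst w) \<le> B" "small_map B L (snd w)"
    using assms(2)[OF w(2)] assms(3)[OF w(1)] by auto
  have "sz (look (snd w) y) \<le> B" by (rule small_map_look[OF V(2) y])
  then show ?thesis using y V w(3) by (auto simp: small_map_def)
qed

lemma grow_iterate_small:
  fixes t :: nat and E :: "nat \<Rightarrow> nat \<Rightarrow> nat \<Rightarrow> bool" and I0 :: "nat \<Rightarrow> nat \<Rightarrow> bool"
  assumes "\<And>y. y \<in> set (slots n W h) \<Longrightarrow> sz y \<le> B" "sz (i, 0 :: nat) \<le> B" "small_map B L P"
  defines "V j \<equiv> fold (\<lambda>_ V. grow n E I0 t W h V) [0..<j] [((i, 0), P)]"
  shows "length (V j) \<le> Suc j \<and> (\<forall>v\<in>set (V j). sz (fst v) \<le> B \<and> small_map B (L + j) (snd v))"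
proof (induction j)
  case 0
  then show ?case using assms by (simp add: V_def)
next
  case (Suc j)
  have V_Suc: "V (Suc j) = grow n E I0 t W h (V j)" by (simp add: V_def)
  have old: "sz (fst v) \<le> B \<and> small_map B (L + Suc j) (snd v)" if "v \<in> set (V j)" for v
    using Suc that by (fastforce simp: small_map_def)
  show ?case
  proof (cases "moves n E I0 t W h (V j)")
    case Nil
    then show ?thesis using V_Suc old Suc by (simp add: grow_def)
  next
    case (Cons v vs)
    then have "V (Suc j) = v # V j" using V_Suc by (simp add: grow_def)
    moreover have "sz (fst v) \<le> B \<and> small_map B (Suc (L + j)) (snd v)"
      by (rule moves_small[of v n E I0 t W h "V j", OF _ assms(1)]) (use Cons Suc in auto)
    ultimately show ?thesis using old Suc by simp
  qed
qed

lemma slots_sz: "y \<in> set (slots n W h) \<Longrightarrow> sz y \<le> 2 * n + 2 * W + 3"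
  by (auto simp: slots_def)

lemma search_list_sz:
  assumes "length V \<le> N" "\<forall>v\<in>set V. sz (fst v) \<le> B \<and> small_map B L (snd v)"
  shows "sz V \<le> 1 + N * (3 + B + L * (2 + 2 * B))"
proof -
  have "sz V \<le> 1 + length V * (1 + (1 + B + (1 + L * (2 + 2 * B))))"
  proof (rule sz_list_le)
    fix v assume "v \<in> set V"
    then show "sz v \<le> 1 + B + (1 + L * (2 + 2 * B))"
      using assms(2) small_map_sz[of B L "snd v"] by (fastforce simp: sz_pair)
  qed
  also have "\<dots> \<le> 1 + N * (1 + (1 + B + (1 + L * (2 + 2 * B))))"
    using assms(1) by (intro add_mono mult_right_mono) auto
  finally show ?thesis by (simp add: algebra_simps)
qed

lemma ptime_search [ptime_intros]:
  assumes "ptime n" "ptime k" "ptime G" "ptime M" "ptime t" "ptime W" "ptime h" "ptime i" "ptime P"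
  shows "ptime (\<lambda>x. search (n x) (k x) (adj (G x)) (entry (M x)) (t x) (W x) (h x) (i x) (P x))"
  unfolding search_def
proof (rule ptime_fold_bound)
  define N where "N x = n x * W x + k x" for x
  define B where "B x = (2 * n x + 2 * W x + 3) + (2 * i x + 3 + sz (P x))" for x
  define b where "b x = 1 + (1 + N x) * (3 + B x + (sz (P x) + N x) * (2 + 2 * B x))" for x
  show "pbound b"
    unfolding b_def B_def N_def by (intro pbound_intros ptime_pbound pbound_nat assms)
  fix x j assume j: "j \<le> length [0..<n x * W x + k x]"
  let ?V = "fold (\<lambda>_ V. grow (n x) (adj (G x)) (entry (M x)) (t x) (W x) (h x) V) [0..<j] [((i x, 0), P x)]"
  have "small_map (B x) (sz (P x)) (P x)"
  proof -
    have "sz (fst e) \<le> sz (P x)" "sz (snd e) \<le> sz (P x)" if "e \<in> set (P x)" for e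
      using sz_elem_le[OF that] by (cases e; simp)+
    then show ?thesis using length_le_sz[of "P x"] by (fastforce simp: small_map_def B_def)
  qed
  moreover have "sz y \<le> B x" if "y \<in> set (slots (n x) (W x) (h x))" for y
    using slots_sz[OF that] by (simp add: B_def)
  moreover have "sz (i x, 0 :: nat) \<le> B x" by (simp add: B_def)
  ultimately have "length ?V \<le> Suc j \<and>
      (\<forall>v\<in>set ?V. sz (fst v) \<le> B x \<and> small_map (B x) (sz (P x) + j) (snd v))"
    by (intro grow_iterate_small) auto
  then have V: "length ?V \<le> 1 + N x \<and>
      (\<forall>v\<in>set ?V. sz (fst v) \<le> B x \<and> small_map (B x) (sz (P x) + N x) (snd v))"
    using j by (fastforce simp: N_def small_map_def)
  have "sz ?V \<le> b x"
    unfolding b_def by (rule search_list_sz) (use V in auto)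
  then show "sz (fold (\<lambda>_. grow (n x) (adj (G x)) (entry (M x)) (t x) (W x) (h x))
      (take j [0..<n x * W x + k x]) [((i x, 0), P x)]) \<le> b x"
    using j by (simp add: take_upt)
qed (intro ptime_intros assms assms[THEN ptime_comp[rotated]])+

lemma ptime_augment [ptime_intros]:
  assumes "ptime n" "ptime k" "ptime G" "ptime M" "ptime t" "ptime W" "ptime h" "ptime i" "ptime P"
  shows "ptime (\<lambda>x. augment (n x) (k x) (adj (G x)) (entry (M x)) (t x) (W x) (h x) (i x) (P x))"
  unfolding augment_def by (intro ptime_intros assms assms[THEN ptime_comp[rotated]])

text \<open>The number of entries grows by an additive amount independent of \<open>L\<close>, so
  \<open>k\<close> augmentations in a row stay polynomial.\<close>

lemma augment_small:
  assumes "2 * n + 2 * W + 3 \<le> B" "2 * i + 3 \<le> B" "small_map B L P"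
  shows "small_map B (L + (n * W + k)) (augment n k E I0 t W h i P)"
proof -
  let ?V = "search n k E I0 t W h i P"
  have V: "\<forall>v\<in>set ?V. small_map B (L + (n * W + k)) (snd v)"
    using grow_iterate_small[of n W h B i L P E I0 t "n * W + k"] assms slots_sz[of _ n W h]
    unfolding search_def by fastforce
  show ?thesis
  proof (cases "filter (\<lambda>v. sends E I0 t (fst v) h) ?V")
    case Nil
    then show ?thesis using assms(3) by (simp add: augment_def small_map_def)
  next
    case (Cons v vs)
    then have "v \<in> set ?V" by (metis filter_is_subset list.set_intros(1) subsetD)
    then show ?thesis using V Cons by (simp add: augment_def)
  qed
qed

lemma ptime_preds [ptime_intros]:
  assumes "ptime n" "ptime k" "ptime G" "ptime M" "ptime t" "ptime W" "ptime h"
  shows "ptime (\<lambda>x. preds (n x) (k x) (adj (G x)) (entry (M x)) (t x) (W x) (h x))"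
  unfolding preds_def
proof (rule ptime_fold_inv)
  define N where "N x = n x * W x + k x" for x
  define B where "B x = (2 * n x + 2 * W x + 3) + (2 * k x + 3)" for x
  define b where "b x = 1 + (k x * N x) * (2 + 2 * B x)" for x
  define J where "J x j P \<longleftrightarrow> small_map (B x) (j * N x) P" for x j P
  show "pbound b"
    unfolding b_def B_def N_def by (intro pbound_intros pbound_nat assms)
  show "J x 0 []" for x by (simp add: J_def small_map_def)
  show "J x (Suc j) (augment (n x) (k x) (adj (G x)) (entry (M x)) (t x) (W x) (h x) ([0..<k x] ! j) P)"
    if "j < length [0..<k x]" "J x j P" for x j P
    using augment_small[of "n x" "W x" "B x" j "j * N x" P "k x"] that
    by (auto simp: J_def B_def N_def add.commute)
  show "sz P \<le> b x" if "j \<le> length [0..<k x]" "J x j P" for x j P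
  proof -
    have "j * N x \<le> k x * N x" using that(1) by (intro mult_right_mono) auto
    then have "small_map (B x) (k x * N x) P"
      using that(2) unfolding J_def small_map_def by (meson le_trans)
    then show ?thesis unfolding b_def by (rule small_map_sz)
  qed
qed (intro ptime_intros assms assms[THEN ptime_comp[rotated]])+

lemma ptime_trace [ptime_intros]:
  assumes "ptime W" "ptime P" "ptime y"
  shows "ptime (\<lambda>x. trace (W x) (P x) (y x))"
  unfolding trace_def
proof (rule ptime_fold_inv[where J = "\<lambda>x j z. sz z \<le> sz (P x) + sz (y x)" and b = "\<lambda>x. sz (P x) + sz (y x)"])
  show "pbound (\<lambda>x. sz (P x) + sz (y x))" by (intro pbound_intros ptime_pbound assms)
  show "sz (look (P x) z) \<le> sz (P x) + sz (y x)" if "sz z \<le> sz (P x) + sz (y x)" for x z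
  proof (rule small_map_look[OF _ that])
    have "sz (fst e) \<le> sz (P x)" "sz (snd e) \<le> sz (P x)" if "e \<in> set (P x)" for e
      using sz_elem_le[OF that] by (cases e; simp)+
    then show "small_map (sz (P x) + sz (y x)) (length (P x)) (P x)"
      by (fastforce simp: small_map_def)
  qed
qed (auto intro!: ptime_intros assms assms[THEN ptime_comp[rotated]])

lemma ptime_slot_token [ptime_intros]:
  assumes "ptime W" "ptime P" "ptime y"
  shows "ptime (\<lambda>x. slot_token (W x) (P x) (y x))"
  unfolding slot_token_def by (intro ptime_intros assms)

lemma ptime_gather [ptime_intros]:
  assumes "ptime n" "ptime k" "ptime G" "ptime M" "ptime t" "ptime W" "ptime h"
  shows "ptime (\<lambda>x. gather (n x) (k x) (adj (G x)) (entry (M x)) (t x) (W x) (h x))"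
  unfolding gather_def by (intro ptime_intros assms assms[THEN ptime_comp[rotated]])

section \<open>Running time of planning and simulation\<close>

lemma ptime_floods [ptime_intros]:
  assumes "ptime n" "ptime k" "ptime d"
  shows "ptime (\<lambda>x. floods (n x) (k x) (d x))"
  unfolding floods_def by (intro ptime_intros assms assms[THEN ptime_comp[rotated]])

lemma ptime_fast_plan [ptime_intros]:
  assumes "ptime n" "ptime k" "ptime G" "ptime M" "ptime d" "ptime m"
  shows "ptime (\<lambda>x. fast_plan (n x) (k x) (adj (G x)) (entry (M x)) (d x) (m x))"
  unfolding fast_plan_def by (intro ptime_intros assms assms[THEN ptime_comp[rotated]])

text \<open>Repeated doubling of a unary number would be exponential; the guard doubles only numbers
  up to \<open>n\<close>, so the power never exceeds \<open>2 * n + 1\<close>.\<close>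

lemma ptime_bits [ptime_intros]:
  assumes "ptime n" shows "ptime (\<lambda>x. bits (n x))"
  unfolding bits_def
proof (rule ptime_fst, rule ptime_fold_inv[where b = "\<lambda>x. 6 * n x + 5"
      and J = "\<lambda>x j p. fst p \<le> j \<and> snd p \<le> 2 * n x + 1"])
  show "pbound (\<lambda>x. 6 * n x + 5)" by (intro pbound_intros pbound_nat assms)
  show "sz p \<le> 6 * n x + 5" if "j \<le> length [0..<n x]" "fst p \<le> j \<and> snd p \<le> 2 * n x + 1"
    for x j and p :: "nat \<times> nat"
    using that by (cases p) auto
qed (auto intro!: ptime_intros assms assms[THEN ptime_comp[rotated]])

lemma ptime_hit_count [ptime_intros]:
  assumes "ptime n" "ptime k" shows "ptime (\<lambda>x. hit_count (n x) (k x))"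
  unfolding hit_count_def by (intro ptime_intros assms assms[THEN ptime_comp[rotated]])

lemma ptime_window [ptime_intros]:
  assumes "ptime n" "ptime k" shows "ptime (\<lambda>x. window (n x) (k x))"
  unfolding window_def by (intro ptime_intros assms assms[THEN ptime_comp[rotated]])

lemma ptime_plan [ptime_intros]:
  assumes "ptime n" "ptime k" "ptime G" "ptime M"
  shows "ptime (\<lambda>x. plan (n x) (k x) (adj (G x)) (entry (M x)))"
  unfolding plan_def fast_length_def by (intro ptime_intros assms)

lemma ptime_sent [ptime_intros]:
  assumes "ptime pl" "ptime M" "ptime t" "ptime u"
  shows "ptime (\<lambda>x. sent (pl x) (M x) (t x) (u x))"
  unfolding sent_def planned_def by (intro ptime_intros assms)

lemma ptime_update [ptime_intros]:
  assumes "ptime n" "ptime k" "ptime G" "ptime pl" "ptime t" "ptime M"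
  shows "ptime (\<lambda>x. update (n x) (k x) (adj (G x)) (pl x) (t x) (M x))"
  unfolding update_def by (intro ptime_intros assms assms[THEN ptime_comp[rotated]])

lemma update_sz: "sz (update n k E pl t M) \<le> 1 + n * (1 + (1 + k * 4))"
proof -
  have row: "sz (map f xs) \<le> 1 + length xs * 4" for f :: "nat \<Rightarrow> bool" and xs
  proof (induction xs)
    case (Cons y ys)
    then show ?case by (cases "f y") auto
  qed simp
  have "sz (update n k E pl t M) \<le> 1 + length (update n k E pl t M) * (1 + (1 + k * 4))"
  proof (rule sz_list_le)
    fix r assume "r \<in> set (update n k E pl t M)"
    then obtain f where "r = map f [0..<k]" unfolding update_def by auto
    then show "sz r \<le> 1 + k * 4" using row[of f "[0..<k]"] by simp
  qed
  then show ?thesis by (simp add: update_def)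
qed

lemma ptime_tokens_after [ptime_intros]:
  assumes "ptime n" "ptime k" "ptime G" "ptime pl" "ptime M" "ptime t"
  shows "ptime (\<lambda>x. tokens_after (n x) (k x) (adj (G x)) (pl x) (M x) (t x))"
  unfolding tokens_after_def
proof (rule ptime_fold_inv[where b = "\<lambda>x. sz (M x) + (1 + n x * (1 + (1 + k x * 4)))"
      and J = "\<lambda>x j N. sz N \<le> sz (M x) + (1 + n x * (1 + (1 + k x * 4)))"])
  show "pbound (\<lambda>x. sz (M x) + (1 + n x * (1 + (1 + k x * 4))))"
    by (intro pbound_intros ptime_pbound pbound_nat assms)
  show "sz (update (n x) (k x) (adj (G x)) (pl x) s N) \<le> sz (M x) + (1 + n x * (1 + (1 + k x * 4)))" for x s N
    by (rule trans_le_add2) (rule update_sz)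
qed (auto intro!: ptime_intros assms assms[THEN ptime_comp[rotated]])

lemma ptime_simulate [ptime_intros]:
  assumes "ptime n" "ptime k" "ptime G" "ptime pl" "ptime M"
  shows "ptime (\<lambda>x. simulate (n x) (k x) (adj (G x)) (pl x) (M x))"
  unfolding simulate_def by (intro ptime_intros assms assms[THEN ptime_comp[rotated]])

lemma ptime_solve: "ptime solve"
proof -
  have "ptime (\<lambda>x. solve x)"
    unfolding solve_def by (intro ptime_intros)
  then show ?thesis .
qed


theorem theorem5:
  fixes c :: real
  assumes "c > 0"
  shows "\<exists>(A :: com) (q :: nat poly) (C :: real).
    polynomial_time_on (enc_instance ` {I. gossip_instance I}) A q \<and>
    (\<forall>I n k. gossip_instance I \<and> nodes I = n \<and> tokens I = k \<and> k \<le> n \<longrightarrow>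
       measure_pmf.prob (output_pmf A q (enc_instance I))
         {y. \<exists>\<sigma>. y = enc_schedule I \<sigma> \<and>
               valid_schedule I \<sigma> \<and> disseminates I \<sigma> \<and> broadcast I \<sigma> \<and>
               real (schedule_length I \<sigma>) \<le> C * (real n * min (real k) (sqrt (real k * ln (real n))))}
         \<ge> 1 - real n powr (- c))"
proof -
  \<comment> \<open>The program receives its input paired with a list of coins; with no coins this
    list is \<open>Leaf\<close>, the encoding of \<open>()\<close>.\<close>
  have "ptime (\<lambda>z :: input \<times> unit. solve (fst z))"
    by (intro ptime_comp[OF _ ptime_solve] ptime_intros)
  then obtain A p where A: "\<And>z :: input \<times> unit. \<exists>T. returns A (enc z) T (enc (solve (fst z))) \<and> T \<le> poly p (sz z)"
    by (rule ptime_program) blast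
  have coins: "coins 0 x = {[]}" for x by (auto simp: coins_def)
  \<comment> \<open>Pairing with the empty coin list adds 2 to the size of the input, which the
    substitution of \<open>[:2, 1:]\<close> into \<open>p\<close> accounts for.\<close>
  have run: "\<exists>T. returns A (with_coins (enc_instance I) []) T (enc (solve (input_of I))) \<and>
      T \<le> poly (pcompose p [:2, 1:]) (dsize (enc_instance I))" for I
  proof -
    have "with_coins (enc_instance I) [] = enc (input_of I, ())"
      by (simp add: with_coins_def enc_instance_eq)
    moreover have "sz (input_of I, ()) = 2 + dsize (enc_instance I)"
      by (simp add: sz_def enc_instance_eq)
    ultimately show ?thesis using A[of "(input_of I, ())"] by (simp add: poly_pcompose)
  qed
  have "polynomial_time_on (enc_instance ` {I. gossip_instance I}) A 0"
    unfolding polynomial_time_on_def using run coins by (intro exI[of _ "pcompose p [:2, 1:]"]) fastforce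
  moreover have "1 - real n powr (- c) \<le> measure_pmf.prob (output_pmf A 0 (enc_instance I))
         {y. \<exists>\<sigma>. y = enc_schedule I \<sigma> \<and>
               valid_schedule I \<sigma> \<and> disseminates I \<sigma> \<and> broadcast I \<sigma> \<and>
               real (schedule_length I \<sigma>) \<le> 20 * (real n * min (real k) (sqrt (real k * ln (real n))))}"
    (is "_ \<le> measure_pmf.prob _ ?Y")
    if I: "gossip_instance I" "nodes I = n" "tokens I = k" "k \<le> n" for I n k
  proof (cases "n \<ge> 2")
    case True
    obtain T where T: "returns A (with_coins (enc_instance I) []) T (enc (solve (input_of I)))"
      using run by blast
    then have "(THE y. \<exists>T. returns A (with_coins (enc_instance I) []) T y) = enc (solve (input_of I))"
      by (blast dest: returns_deterministic)
    then have "output_pmf A 0 (enc_instance I) = return_pmf (enc (solve (input_of I)))"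
      by (simp add: output_pmf_def coins pmf_of_set_singleton)
    moreover have "enc (solve (input_of I)) \<in> ?Y"
      using solve_correct[OF I(1)] I(2-4) True by (intro CollectI exI[of _ "schedule_of I"]) simp
    ultimately have "measure_pmf.prob (output_pmf A 0 (enc_instance I)) ?Y = 1"
      by simp
    then show ?thesis by simp
  next
    \<comment> \<open>For \<open>n = 1\<close> the required probability
      \<open>1 - 1 powr (- c)\<close> is 0.\<close>
    case False
    then have "n = 1" using I by (auto simp: gossip_instance_def)
    then show ?thesis by simp
  qed
  ultimately show ?thesis
    by (intro exI[of _ A] exI[of _ "0 :: nat poly"] exI[of _ "20 :: real"]) blast
qed

end
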